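(* Let $\tau > 0$, let $M \in \mathbb{R}^{n\times n}$ be a symmetric positive definite matrix, let $K \in \mathbb{R}^{n\times n}$, and put $A = \tau M^{-1}K$ and $\hat{A} = M^{1/2} A M^{-1/2}$. Then, for any rational function $r(z)$ that is bounded on the numerical range $\mathcal{W}(\hat{A})$, $$\|r(A) - \mathrm{e}^{A}\|_2 \le (1+\sqrt{2})\, \kappa(M)^{1/2} \sup_{z \in \mathcal{W}(\hat{A})} |r(z) - \mathrm{e}^z|,$$ where $\kappa(M) = \|M\|_2\|M^{-1}\|_2$.
   Context: For a square matrix $B \in \mathbb{C}^{n\times n}$, the numerical range (field of values) is $\mathcal{W}(B) = \{v^\ast B v : v \in \mathbb{C}^n, \|v\|_2 = 1\}$. $M^{1/2}$ denotes the symmetric positive definite square root of $M$ and $M^{-1/2}$ its inverse. $\|\cdot\|_2$ is the Euclidean norm for vectors and the induced operator (spectral) norm for matrices. $\mathrm{e}^{A}=\sum_{k\ge 0} A^k/k!$ is the matrix exponential, and $r(A)$ is the rational function $r$ evaluated at the matrix $A$ in the usual sense of matrix functions. *)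

theory Defs
  imports "HOL-Analysis.Analysis"
    "HOL-Computational_Algebra.Computational_Algebra"
    "HOL-Computational_Algebra.Field_as_Ring"
begin

definition sym_pos_def :: "real^'n^'n \<Rightarrow> bool" where
  "sym_pos_def M \<longleftrightarrow> transpose M = M \<and> (\<forall>x. x \<noteq> 0 \<longrightarrow> 0 < x \<bullet> (M *v x))"

definition spd_sqrt :: "real^'n^'n \<Rightarrow> real^'n^'n" where
  "spd_sqrt M = (THE S. sym_pos_def S \<and> S ** S = M)"

abbreviation cmat :: "real^'n^'n \<Rightarrow> complex^'n^'n" where
  "cmat \<equiv> map_matrix complex_of_real"

text \<open>The norm of the vector type is the Euclidean norm, so this is the induced 2-norm.
  (The norm on the type of matrices itself is the Frobenius norm.)\<close>

definition spectral_norm :: "('a::real_normed_field)^'n^'n \<Rightarrow> real" where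
  "spectral_norm A = onorm (\<lambda>v. A *v v)"

definition cond_number :: "real^'n^'n \<Rightarrow> real" where
  "cond_number M = spectral_norm M * spectral_norm (matrix_inv M)"

definition numerical_range :: "complex^'n^'n \<Rightarrow> complex set" where
  "numerical_range B = {(\<Sum>i\<in>UNIV. cnj (v $ i) * (B *v v) $ i) | v. norm v = 1}"

text \<open>The operations of the type classes act entrywise on vectors, so powers and exponentials
  with respect to the matrix product have to be introduced separately.\<close>

definition mat_power :: "('a::comm_semiring_1)^'n^'n \<Rightarrow> nat \<Rightarrow> 'a^'n^'n" where
  "mat_power A k = ((\<lambda>B. A ** B) ^^ k) (mat 1)"

definition mat_exp :: "complex^'n^'n \<Rightarrow> complex^'n^'n" where
  "mat_exp A = (\<Sum>k. (1 / fact k) *\<^sub>R mat_power A k)"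

definition mat_poly :: "complex poly \<Rightarrow> complex^'n^'n \<Rightarrow> complex^'n^'n" where
  "mat_poly p A = (\<Sum>i\<le>degree p. mat (coeff p i) ** mat_power A i)"

text \<open>Rational functions are elements of the fraction field of the polynomial ring. Numerator and
  denominator are those of the representation in lowest terms (with monic denominator), so that
  the zeros of the denominator are exactly the poles.\<close>

definition rat_num :: "complex poly fract \<Rightarrow> complex poly" where
  "rat_num r = fst (quot_of_fract r)"

definition rat_den :: "complex poly fract \<Rightarrow> complex poly" where
  "rat_den r = snd (quot_of_fract r)"

lemma rat_den_nonzero: "rat_den r \<noteq> 0"
  unfolding rat_den_def by simp

lemma coprime_rat_num_den: "coprime (rat_num r) (rat_den r)"
  unfolding rat_num_def rat_den_def by (rule coprime_quot_of_fract)

lemma rat_num_den: "Fract (rat_num r) (rat_den r) = r"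
  unfolding rat_num_def rat_den_def by (rule Fract_quot_of_fract)

definition rat_eval :: "complex poly fract \<Rightarrow> complex \<Rightarrow> complex" where
  "rat_eval r z = poly (rat_num r) z / poly (rat_den r) z"

lemma rat_eval_Fract:
  assumes "poly q z \<noteq> 0"
  shows "rat_eval (Fract p q) z = poly p z / poly q z"
proof -
  let ?a = "rat_num (Fract p q)" and ?b = "rat_den (Fract p q)"
  have "q \<noteq> 0" using assms by auto
  then have eq: "?a * q = p * ?b"
    using rat_num_den[of "Fract p q"] rat_den_nonzero by (simp add: eq_fract)
  have "?b dvd q"
    using coprime_rat_num_den eq by (metis coprime_commute coprime_dvd_mult_right_iff dvd_triv_right)
  then obtain k where "q = ?b * k" by (rule dvdE)
  then have "poly ?b z \<noteq> 0" using assms by (metis poly_mult mult_zero_left)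
  then show ?thesis
    using arg_cong[OF eq, of "\<lambda>p. poly p z"] assms by (simp add: rat_eval_def frac_eq_eq)
qed

definition rat_eval_mat :: "complex poly fract \<Rightarrow> complex^'n^'n \<Rightarrow> complex^'n^'n" where
  "rat_eval_mat r A = mat_poly (rat_num r) A ** matrix_inv (mat_poly (rat_den r) A)"

text \<open>Division by zero yields zero, so the absence of poles has to be demanded explicitly: on a
  one-point set, boundedness of the values alone would not exclude a pole.\<close>

definition rat_bounded_on :: "complex poly fract \<Rightarrow> complex set \<Rightarrow> bool" where
  "rat_bounded_on r S \<longleftrightarrow> (\<forall>z\<in>S. poly (rat_den r) z \<noteq> 0) \<and> bounded (rat_eval r ` S)"

end

(* Write N for the spectral norm and W for the numerical range. Since A = M^(-1/2) Ahat M^(1/2),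
   the theorem reduces to the Crouzeix--Palencia theorem N(f(B)) <= (1 + sqrt 2) sup_W |f| for
   f = r - exp and B = Ahat.

   That theorem is proved by the argument of Ransford and Schwenninger. The compact convex set W
   is enclosed in a slightly larger convex domain D with smooth boundary curve sigma. For f
   holomorphic near the closure of D with |f| <= 1, let g be the Cauchy transform of the conjugate
   of f over the curve. The double layer potential kernel is nonnegative and has total mass 2 at
   points of D, and it has mass at most 1 at boundary points; the latter bound and the maximum
   principle give |g| <= 1 on D. The operator version of the kernel is positive semidefinite with
   integral 2 I, whence N(f(B) + g(B)^H) <= 2. If K is the best constant for D, then expanding
     f(B) f(B)^H f(B) f(B)^H = f(B) (f(B) + g(B)^H)^H f(B) f(B)^H - (f g f)(B) f(B)^H
   yields K^4 <= 2 K^3 + K^2, that is, K <= 1 + sqrt 2. *)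
theory Submission
  imports Defs "HOL-Complex_Analysis.Complex_Analysis" "HOL-Real_Asymp.Real_Asymp"
begin

text \<open>Formal power series claim the same infix \<open>$\<close> as vectors.\<close>

no_notation fps_nth (infixl "$" 75)

section \<open>Complex matrices\<close>

text \<open>The numerical range is not invariant under similarity. Passing from \<open>Ahat\<close>
  to \<open>A\<close> costs the norms of the two square roots, which by symmetry are the square
  roots of the norms of \<open>M\<close> and its inverse; this is the factor with kappa. The number
  \<open>1 + sqrt 2\<close> is the positive root of \<open>x^2 = 2 x + 1\<close>. Three obstacles
  shape the proof. The boundary of the numerical range may have corners or collapse to a segment or
  a point, so the set is enlarged by smoothing its support function, which keeps the curve explicit;
  a limit in the margin recovers the set itself. Next, \<open>g\<close> is holomorphic only inside
  the domain, while the extremal argument multiplies functions defined near its closure, so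
  dilations of \<open>g\<close> take its place. Finally, the supremum defining the best constant has
  to be finite beforehand and need not be attained: a crude Cauchy integral estimate settles the
  former, a quantitative contradiction the latter. That supremum is taken for one fixed matrix and
  one fixed curve. The exponential enters only as a limit of Taylor polynomials, so the bound is
  needed just for a rational function minus a polynomial.\<close>

lemma mat_mult_nth: "(mat c ** A) $ i $ j = c * (A $ i $ j :: 'a::comm_semiring_1)"
  by (simp add: matrix_matrix_mult_def mat_def if_distrib[of "\<lambda>x. x * _"] cong: if_cong)

lemma mult_mat_nth: "(A ** mat c) $ i $ j = c * (A $ i $ j :: 'a::comm_semiring_1)"
  by (simp add: matrix_matrix_mult_def mat_def if_distrib[of "\<lambda>x. _ * x"] mult.commute cong: if_cong)

lemma mat_commute: "A ** mat c = mat c ** (A :: 'a::comm_semiring_1^'n^'n)"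
  by (simp add: vec_eq_iff mat_mult_nth mult_mat_nth)

lemma mat_vector_mult: "mat c *v x = c *s (x :: 'a::comm_semiring_1^'n)"
  by (simp add: vec_eq_iff matrix_vector_mult_def mat_def if_distrib[of "\<lambda>x. x * _"] cong: if_cong)

lemma mat_add: "mat (a + b) = (mat a + mat b :: 'a::comm_semiring_1^'n^'n)"
  by (simp add: vec_eq_iff mat_def)

lemma mat_diff: "mat (a - b) = (mat a - mat b :: 'a::comm_ring_1^'n^'n)"
  by (simp add: vec_eq_iff mat_def)

lemma mat_mult: "mat (a * b) = (mat a ** mat b :: 'a::comm_semiring_1^'n^'n)"
  unfolding vec_eq_iff mat_mult_nth by (simp add: mat_def)

lemma mat_zero: "mat 0 = (0 :: 'a::comm_semiring_1^'n^'n)"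
  by (simp add: vec_eq_iff mat_def)

lemma mat_mult_mult: "(A :: 'a::comm_semiring_1^'n^'n) ** (mat c ** B) = mat c ** (A ** B :: 'a::comm_semiring_1^'n^'n)"
  by (simp add: matrix_mul_assoc mat_commute[of A])

lemma matrix_mult_diff_left: "(A - B) ** C = A ** C - B ** (C :: 'a::comm_ring_1^'n^'n)"
  by (simp add: vec_eq_iff matrix_matrix_mult_def algebra_simps sum_subtractf)

lemma matrix_mult_diff_right: "C ** (A - B) = C ** A - C ** (B :: 'a::comm_ring_1^'n^'n)"
  by (simp add: vec_eq_iff matrix_matrix_mult_def algebra_simps sum_subtractf)

lemma matrix_mult_minus_left: "(- A) ** C = - (A ** (C :: 'a::comm_ring_1^'n^'n))"
  by (simp add: vec_eq_iff matrix_matrix_mult_def sum_negf)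

lemma matrix_mult_minus_right: "C ** (- A) = - (C ** (A :: 'a::comm_ring_1^'n^'n))"
  by (simp add: vec_eq_iff matrix_matrix_mult_def sum_negf)

lemma matrix_mult_add_left: "(A + B) ** C = A ** C + B ** (C :: 'a::comm_ring_1^'n^'n)"
  by (simp add: vec_eq_iff matrix_matrix_mult_def algebra_simps sum.distrib)

lemmas matrix_ring = matrix_mult_diff_left matrix_mult_diff_right matrix_add_ldistrib
  matrix_mult_add_left matrix_mult_minus_left matrix_mult_minus_right

lemma matrix_inv_props:
  fixes A :: "'a::field^'n^'n"
  assumes "invertible A"
  shows "matrix_inv A ** A = mat 1" "A ** matrix_inv A = mat 1"
  using someI_ex[OF assms[unfolded invertible_def]] by (auto simp: matrix_inv_def)

lemma inverse_of_left:
  fixes A :: "'a::field^'n^'n"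
  assumes "B ** A = mat 1"
  shows "matrix_inv A = B" "A ** B = mat 1" "invertible A"
proof -
  show 1: "A ** B = mat 1" using assms by (simp add: matrix_left_right_inverse)
  show inv: "invertible A" using assms 1 unfolding invertible_def by blast
  show "matrix_inv A = B"
  proof -
    have "matrix_inv A = (B ** A) ** matrix_inv A" by (simp add: assms)
    also have "\<dots> = B" by (simp add: matrix_mul_assoc[symmetric] matrix_inv_props(2)[OF inv])
    finally show ?thesis .
  qed
qed

lemma invertible_if_inj:
  fixes A :: "'a::field^'n^'n"
  assumes "\<And>x. A *v x = 0 \<Longrightarrow> x = 0"
  shows "invertible A"
  using assms by (simp add: invertible_left_inverse matrix_left_invertible_ker)

section \<open>Boundedness of the matrix operations and the spectral norm\<close>

lemma bounded_bilinear_matrix_mult: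
  "bounded_bilinear ((**) :: complex^'n^'n \<Rightarrow> complex^'n^'n \<Rightarrow> complex^'n^'n)"
  unfolding bilinear_conv_bounded_bilinear[symmetric] bilinear_def
  by (auto intro!: linearI simp: matrix_ring)
     (simp_all add: vec_eq_iff matrix_matrix_mult_def scaleR_sum_right)

lemma bounded_linear_matrix_vector:
  fixes A :: "'a::real_normed_field^'n^'n"
  shows "bounded_linear ((*v) A)"
proof -
  have "bounded_linear (\<lambda>x. \<Sum>j\<in>UNIV. A $ i $ j * x $ j)" for i
    by (intro bounded_linear_sum bounded_linear_mult_right[THEN bounded_linear_compose]
        bounded_linear_vec_nth)
  then have c: "\<exists>K. \<forall>x. norm (\<Sum>j\<in>UNIV. A $ i $ j * x $ j) \<le> norm x * K" for i
    by (auto simp: bounded_linear_def bounded_linear_axioms_def)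
  then obtain K where K: "\<And>i x. norm (\<Sum>j\<in>UNIV. A $ i $ j * x $ j) \<le> norm x * K i"
    by metis
  show ?thesis
  proof (rule bounded_linear_intro[where K = "\<Sum>i\<in>UNIV. K i"])
    show "A *v (x + y) = A *v x + A *v y" for x y by (rule matrix_vector_right_distrib)
    show "A *v (r *\<^sub>R x) = r *\<^sub>R (A *v x)" for r x
      by (simp add: vec_eq_iff matrix_vector_mult_def scaleR_sum_right)
    show "norm (A *v x) \<le> norm x * sum K UNIV" for x
    proof -
      have "norm (A *v x) \<le> (\<Sum>i\<in>UNIV. norm ((A *v x) $ i))"
        by (simp add: norm_vec_def L2_set_le_sum)
      also have "\<dots> \<le> (\<Sum>i\<in>UNIV. norm x * K i)"
        by (intro sum_mono) (use K in \<open>simp add: matrix_vector_mult_def\<close>)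
      finally show ?thesis by (simp add: sum_distrib_left)
    qed
  qed
qed

lemma norm_matrix_vector: "norm (A *v x) \<le> spectral_norm A * norm x"
  unfolding spectral_norm_def by (rule onorm[OF bounded_linear_matrix_vector])

lemma spectral_norm_nonneg: "0 \<le> spectral_norm A"
  unfolding spectral_norm_def by (rule onorm_pos_le[OF bounded_linear_matrix_vector])

lemma spectral_norm_le:
  assumes "\<And>x. norm (A *v x) \<le> b * norm x" "0 \<le> b"
  shows "spectral_norm A \<le> b"
  unfolding spectral_norm_def using assms by (intro onorm_bound) auto

lemma spectral_norm_add: "spectral_norm (A + B) \<le> spectral_norm A + spectral_norm B"
proof (rule spectral_norm_le)
  fix x
  have "norm ((A + B) *v x) \<le> norm (A *v x) + norm (B *v x)"
    by (simp add: matrix_vector_mult_add_rdistrib norm_triangle_ineq)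
  also have "\<dots> \<le> (spectral_norm A + spectral_norm B) * norm x"
    unfolding distrib_right by (intro add_mono norm_matrix_vector)
  finally show "norm ((A + B) *v x) \<le> (spectral_norm A + spectral_norm B) * norm x" .
qed (simp add: spectral_norm_nonneg)

lemma spectral_norm_minus: "spectral_norm (- X) = spectral_norm X"
proof -
  have "(*v) (- X) = (\<lambda>v. - (X *v v))"
    by (auto simp: vec_eq_iff matrix_vector_mult_def sum_negf)
  then show ?thesis by (simp add: spectral_norm_def onorm_neg)
qed

lemma spectral_norm_mult: "spectral_norm (A ** B) \<le> spectral_norm A * spectral_norm B"
proof (rule spectral_norm_le)
  fix x
  have "norm ((A ** B) *v x) \<le> spectral_norm A * norm (B *v x)"
    by (simp add: matrix_vector_mul_assoc[symmetric] norm_matrix_vector)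
  also have "\<dots> \<le> spectral_norm A * (spectral_norm B * norm x)"
    by (intro mult_left_mono norm_matrix_vector spectral_norm_nonneg)
  finally show "norm ((A ** B) *v x) \<le> spectral_norm A * spectral_norm B * norm x"
    by (simp add: mult.assoc)
qed (simp add: spectral_norm_nonneg)

lemma norm_vector_scalar: "norm (c *s x) = norm c * norm (x :: complex^'n)"
  by (simp add: norm_vec_def L2_set_right_distrib[symmetric] norm_mult)

lemma matrix_vector_scalar: "A *v (c *s x) = c *s (A *v (x :: complex^'n))"
  by (simp add: vec_eq_iff matrix_vector_mult_def sum_distrib_left algebra_simps)

lemma bounded_linear_matrix_vector_left: "bounded_linear (\<lambda>A :: complex^'n^'n. A *v x)"
  unfolding linear_conv_bounded_linear[symmetric]
  by (rule linearI)
     (simp add: matrix_vector_mult_add_rdistrib,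
      simp add: vec_eq_iff matrix_vector_mult_def scaleR_sum_right)

text \<open>Limits and integrals of matrices refer to the norm of the type, the Frobenius norm. This
  comparison transfers them to the spectral norm.\<close>

lemma spectral_norm_le_norm:
  obtains C where "\<And>A :: complex^'n^'n. spectral_norm A \<le> C * norm A" "0 \<le> C"
proof -
  have bil: "bounded_bilinear ((*v) :: complex^'n^'n \<Rightarrow> complex^'n \<Rightarrow> complex^'n)"
    unfolding bilinear_conv_bounded_bilinear[symmetric] bilinear_def
    by (simp add: bounded_linear.linear[OF bounded_linear_matrix_vector_left]
        bounded_linear.linear[OF bounded_linear_matrix_vector])
  obtain K where "0 < K"
    and "\<forall>(A :: complex^'n^'n) (x :: complex^'n). norm (A *v x) \<le> norm A * norm x * K"
    using bounded_bilinear.pos_bounded[OF bil] by (elim exE conjE)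
  then have K: "\<And>(A :: complex^'n^'n) (x :: complex^'n). norm (A *v x) \<le> norm A * norm x * K" by simp
  have "spectral_norm A \<le> K * norm A" for A :: "complex^'n^'n"
    by (rule spectral_norm_le) (use K[of A] \<open>0 < K\<close> in \<open>simp_all add: mult.commute mult.left_commute\<close>)
  then show thesis using \<open>0 < K\<close> by (intro that[of K]) simp_all
qed

lemma tendsto_spectral_norm:
  fixes A :: "complex^'n^'n"
  assumes "(F \<longlongrightarrow> A) net"
  shows "((\<lambda>i. spectral_norm (F i)) \<longlongrightarrow> spectral_norm A) net"
proof -
  obtain C where C: "\<And>A :: complex^'n^'n. spectral_norm A \<le> C * norm A" "0 \<le> C"
    using spectral_norm_le_norm by blast
  have bd: "\<bar>spectral_norm X - spectral_norm Y\<bar> \<le> C * norm (X - Y)" for X Y :: "complex^'n^'n"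
    using spectral_norm_add[of "X - Y" Y] spectral_norm_add[of "Y - X" X] C(1)[of "X - Y"]
      spectral_norm_minus[of "X - Y"] by simp
  have "((\<lambda>i. C * norm (F i - A)) \<longlongrightarrow> C * norm (A - A)) net"
    by (rule tendsto_mult[OF tendsto_const tendsto_norm[OF tendsto_diff[OF assms tendsto_const]]])
  then have lim: "((\<lambda>i. C * norm (F i - A)) \<longlongrightarrow> 0) net" by simp
  have "((\<lambda>i. spectral_norm (F i) - spectral_norm A) \<longlongrightarrow> 0) net"
    by (rule Lim_null_comparison[OF _ lim]) (simp add: bd)
  then show ?thesis by (simp add: LIM_zero_iff)
qed

section \<open>Conjugate transposes\<close>

definition ctrans :: "complex^'n^'n \<Rightarrow> complex^'n^'n" where
  "ctrans A = (\<chi> i j. cnj (A $ j $ i))"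

lemma inner_vec_complex: "x \<bullet> y = Re (\<Sum>i\<in>UNIV. cnj (x $ i) * y $ i)" for x y :: "complex^'n"
  by (simp add: inner_vec_def inner_complex_def Re_sum)

lemma inner_ctrans: "(ctrans A *v x) \<bullet> y = x \<bullet> (A *v y)"
proof -
  have "(\<Sum>i\<in>UNIV. cnj ((ctrans A *v x) $ i) * y $ i)
      = (\<Sum>i\<in>UNIV. \<Sum>j\<in>UNIV. A $ j $ i * cnj (x $ j) * y $ i)"
    by (simp add: ctrans_def matrix_vector_mult_def sum_distrib_right cnj_sum)
  also have "\<dots> = (\<Sum>j\<in>UNIV. \<Sum>i\<in>UNIV. A $ j $ i * cnj (x $ j) * y $ i)"
    by (rule sum.swap)
  also have "\<dots> = (\<Sum>i\<in>UNIV. cnj (x $ i) * (A *v y) $ i)"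
    by (simp add: matrix_vector_mult_def sum_distrib_left algebra_simps)
  finally show ?thesis by (simp add: inner_vec_complex)
qed

lemma ctrans_simps: "ctrans (ctrans A) = A" "ctrans (A + B) = ctrans A + ctrans B"
  "ctrans (mat c) = mat (cnj c)" "ctrans (A ** B) = ctrans B ** ctrans A"
  by (auto simp: ctrans_def vec_eq_iff mat_def matrix_matrix_mult_def cnj_sum algebra_simps)

lemma bounded_linear_ctrans: "bounded_linear ctrans"
  unfolding linear_conv_bounded_linear[symmetric]
  by (rule linearI) (simp_all add: ctrans_def vec_eq_iff)

lemma spectral_norm_ctrans_le: "spectral_norm (ctrans A) \<le> spectral_norm A"
proof (rule spectral_norm_le[OF _ spectral_norm_nonneg])
  fix x
  let ?y = "ctrans A *v x"
  have "norm ?y * norm ?y = x \<bullet> (A *v ?y)"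
    by (simp add: inner_ctrans[symmetric] power2_norm_eq_inner[symmetric] power2_eq_square)
  also have "\<dots> \<le> norm x * norm (A *v ?y)" by (rule norm_cauchy_schwarz)
  also have "\<dots> \<le> norm x * (spectral_norm A * norm ?y)"
    by (intro mult_left_mono norm_matrix_vector) auto
  finally have "norm ?y * norm ?y \<le> (spectral_norm A * norm x) * norm ?y" by (simp add: algebra_simps)
  then show "norm ?y \<le> spectral_norm A * norm x"
    by (cases "norm ?y = 0") (simp_all add: spectral_norm_nonneg)
qed

lemma spectral_norm_ctrans: "spectral_norm (ctrans A) = spectral_norm A"
  using spectral_norm_ctrans_le[of A] spectral_norm_ctrans_le[of "ctrans A"] by (simp add: ctrans_simps)

text \<open>Half of the C-star identity, from \<open>|A^H x|^2 = x \<bullet> (A A^H x)\<close>.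
  Applied twice, it bounds the fourth power of a norm by the norm of a product of four
  factors.\<close>

lemma spectral_norm_mult_ctrans: "(spectral_norm A)\<^sup>2 \<le> spectral_norm (A ** ctrans A)"
proof -
  have "spectral_norm (ctrans A) \<le> sqrt (spectral_norm (A ** ctrans A))"
  proof (rule spectral_norm_le)
    fix x
    have "(norm (ctrans A *v x))\<^sup>2 = x \<bullet> ((A ** ctrans A) *v x)"
      by (simp add: power2_norm_eq_inner inner_ctrans matrix_vector_mul_assoc)
    also have "\<dots> \<le> norm x * norm ((A ** ctrans A) *v x)" by (rule norm_cauchy_schwarz)
    also have "\<dots> \<le> norm x * (spectral_norm (A ** ctrans A) * norm x)"
      by (intro mult_left_mono norm_matrix_vector) auto
    finally have "(norm (ctrans A *v x))\<^sup>2 \<le> (sqrt (spectral_norm (A ** ctrans A)) * norm x)\<^sup>2"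
      by (simp add: power_mult_distrib spectral_norm_nonneg power2_eq_square algebra_simps)
    then show "norm (ctrans A *v x) \<le> sqrt (spectral_norm (A ** ctrans A)) * norm x"
      by (rule power2_le_imp_le) (simp add: spectral_norm_nonneg)
  qed (simp add: spectral_norm_nonneg)
  then have "(spectral_norm A)\<^sup>2 \<le> (sqrt (spectral_norm (A ** ctrans A)))\<^sup>2"
    by (intro power_mono) (simp_all add: spectral_norm_ctrans spectral_norm_nonneg)
  then show ?thesis by (simp add: spectral_norm_nonneg)
qed

lemma matrix_inv_nth:
  fixes X :: "complex^'n^'n"
  assumes "invertible X"
  shows "matrix_inv X $ i $ j = det (\<chi> a b. if b = i then axis j 1 $ a else X $ a $ b) / det X"
proof -
  have "X *v (matrix_inv X *v axis j 1) = axis j 1"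
    by (simp add: matrix_vector_mul_assoc matrix_inv_props[OF assms])
  then have "matrix_inv X *v axis j 1
      = (\<chi> k. det (\<chi> a b. if b = k then axis j 1 $ a else X $ a $ b) / det X)"
    using assms by (subst (asm) cramer) (auto simp: invertible_det_nz)
  moreover have "(matrix_inv X *v axis j 1) $ i = matrix_inv X $ i $ j"
    by (simp add: matrix_vector_mult_def axis_def if_distrib[of "\<lambda>x. _ * x"] cong: if_cong)
  ultimately show ?thesis by simp
qed

text \<open>By Cramer's rule (\<open>matrix_inv_nth\<close>) each entry of the inverse is a quotient
  of polynomials in the entries of the matrix.\<close>

lemma continuous_on_matrix_inv:
  fixes X :: "'b::topological_space \<Rightarrow> complex^'n^'n"
  assumes "continuous_on S X" "\<And>s. s \<in> S \<Longrightarrow> invertible (X s)"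
  shows "continuous_on S (\<lambda>s. matrix_inv (X s))"
proof -
  have X: "continuous_on S (\<lambda>s. X s $ i $ j)" for i j
    by (intro continuous_intros assms)
  have "continuous_on S (\<lambda>s. det (\<chi> a b. if b = i then axis j 1 $ a else X s $ a $ b) / det (X s))"
    for i j
  proof (rule continuous_on_divide)
    have "continuous_on S (\<lambda>s. (if q then c else X s $ a $ b))" for q a b c
      by (cases q) (simp_all add: X)
    then show "continuous_on S (\<lambda>s. det (\<chi> a b. if b = i then axis j 1 $ a else X s $ a $ b))"
      unfolding det_def by (intro continuous_on_sum continuous_on_mult continuous_on_prod continuous_on_const) simp_all
    show "continuous_on S (\<lambda>s. det (X s))"
      unfolding det_def by (intro continuous_on_sum continuous_on_mult continuous_on_prod continuous_on_const X)
  qed (use assms(2) in \<open>auto simp: invertible_det_nz\<close>)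
  then have "continuous_on S (\<lambda>s. matrix_inv (X s) $ i $ j)" for i j
    by (rule continuous_on_cong[THEN iffD1, rotated -1]) (auto simp: matrix_inv_nth assms(2))
  then have "continuous_on S (\<lambda>s. \<chi> i j. matrix_inv (X s) $ i $ j)"
    by (intro continuous_on_vec_lambda)
  then show ?thesis by simp
qed

lemma has_vector_derivative_iff_quotient:
  "(f has_vector_derivative f') (at s within S)
    \<longleftrightarrow> ((\<lambda>u. (f u - f s) /\<^sub>R (u - s)) \<longlongrightarrow> f') (at s within S)"
proof -
  have "((\<lambda>u. (f u - f s) /\<^sub>R (u - s)) \<longlongrightarrow> f') (at s within S)
    \<longleftrightarrow> ((\<lambda>u. norm ((f u - f s) /\<^sub>R (u - s) - f')) \<longlongrightarrow> 0) (at s within S)"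
    unfolding tendsto_norm_zero_iff by (rule LIM_zero_iff[symmetric])
  also have "\<dots> \<longleftrightarrow> ((\<lambda>u. norm (f u - f s - (u - s) *\<^sub>R f') / norm (u - s)) \<longlongrightarrow> 0) (at s within S)"
  proof (rule tendsto_cong, unfold eventually_at_filter, intro always_eventually allI impI)
    fix u assume "u \<noteq> s"
    then have "(f u - f s) /\<^sub>R (u - s) - f' = (f u - f s - (u - s) *\<^sub>R f') /\<^sub>R (u - s)"
      by (simp add: scaleR_diff_right)
    then show "norm ((f u - f s) /\<^sub>R (u - s) - f') = norm (f u - f s - (u - s) *\<^sub>R f') / norm (u - s)"
      by (simp add: divide_inverse mult.commute)
  qed
  also have "\<dots> \<longleftrightarrow> (f has_vector_derivative f') (at s within S)"
    by (simp add: has_vector_derivative_def has_derivative_iff_norm bounded_linear_scaleR_left)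
  finally show ?thesis by simp
qed

lemma has_vector_derivative_matrix_inv:
  fixes X :: "real \<Rightarrow> complex^'n^'n"
  assumes X: "(X has_vector_derivative X') (at s within S)" and "s \<in> S"
    and inv: "\<And>u. u \<in> S \<Longrightarrow> invertible (X u)" and "continuous_on S X"
  shows "((\<lambda>u. matrix_inv (X u)) has_vector_derivative
    - (matrix_inv (X s) ** X' ** matrix_inv (X s))) (at s within S)"
proof -
  interpret bounded_bilinear "(**) :: complex^'n^'n \<Rightarrow> complex^'n^'n \<Rightarrow> complex^'n^'n"
    by (rule bounded_bilinear_matrix_mult)
  let ?Y = "\<lambda>u. matrix_inv (X u)"
  have "continuous_on S ?Y" using assms by (intro continuous_on_matrix_inv)
  then have Y: "(?Y \<longlongrightarrow> ?Y s) (at s within S)"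
    using \<open>s \<in> S\<close> by (simp add: continuous_on_def)
  have "((\<lambda>u. (X u - X s) /\<^sub>R (u - s)) \<longlongrightarrow> X') (at s within S)"
    using X by (simp add: has_vector_derivative_iff_quotient)
  then have "((\<lambda>u. - (?Y u ** ((X u - X s) /\<^sub>R (u - s)) ** ?Y s)) \<longlongrightarrow> - (?Y s ** X' ** ?Y s)) (at s within S)"
    by (intro tendsto_minus tendsto Y tendsto_const)
  \<comment> \<open>The identity \<open>Y(u) (X(u) - X(s)) Y(s) = Y(s) - Y(u)\<close> expresses the
    difference quotient of the inverse through that of \<open>X\<close>.\<close>
  moreover have "- (?Y u ** ((X u - X s) /\<^sub>R (u - s)) ** ?Y s) = (?Y u - ?Y s) /\<^sub>R (u - s)" if "u \<in> S" for u
  proof -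
    have "?Y u ** (X u - X s) ** ?Y s = ?Y s - ?Y u"
      using matrix_inv_props[OF inv[OF \<open>s \<in> S\<close>]] matrix_inv_props[OF inv[OF that]]
      by (simp add: matrix_ring matrix_mul_assoc) (simp add: matrix_mul_assoc[symmetric])
    then show ?thesis by (simp only: scaleR_left scaleR_right) (simp add: scaleR_diff_right)
  qed
  ultimately have "((\<lambda>u. (?Y u - ?Y s) /\<^sub>R (u - s)) \<longlongrightarrow> - (?Y s ** X' ** ?Y s)) (at s within S)"
    by (elim Lim_transform_eventually) (auto simp: eventually_at_filter)
  then show ?thesis by (simp add: has_vector_derivative_iff_quotient)
qed

section \<open>The numerical range\<close>

text \<open>The operation \<open>\<bullet>\<close> on complex vectors is real valued, namely the
  real part of this form; points of the numerical range need the complex value.\<close>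

definition cinner :: "complex^'n \<Rightarrow> complex^'n \<Rightarrow> complex" where
  "cinner x y = (\<Sum>i\<in>UNIV. cnj (x $ i) * y $ i)"

lemma inner_eq_Re_cinner: "x \<bullet> y = Re (cinner x y)"
  by (simp add: inner_vec_complex cinner_def)

lemma cinner_simps:
  "cinner (x + y) z = cinner x z + cinner y z" "cinner x (y + z) = cinner x y + cinner x z"
  "cinner (c *s x) y = cnj c * cinner x y" "cinner x (c *s y) = c * cinner x y"
  by (simp_all add: cinner_def algebra_simps sum.distrib sum_distrib_left)

lemma cinner_self: "cinner x x = of_real ((norm x)\<^sup>2)"
  by (simp add: cinner_def norm_vec_def L2_set_def sum_nonneg complex_norm_square mult.commute[of "cnj _"] del: of_real_power)

lemma numerical_range_cinner: "numerical_range B = (\<lambda>v. cinner v (B *v v)) ` sphere 0 1"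
  by (auto simp: numerical_range_def cinner_def image_iff)

lemma cinner_in_numerical_range:
  assumes "w \<noteq> 0"
  shows "cinner w (B *v w) / of_real ((norm w)\<^sup>2) \<in> numerical_range B"
proof -
  let ?v = "of_real (inverse (norm w)) *s w"
  have "norm ?v = 1" using assms by (simp add: norm_vector_scalar norm_inverse)
  moreover have "cinner ?v (B *v ?v) = cinner w (B *v w) / of_real ((norm w)\<^sup>2)"
    by (simp add: matrix_vector_scalar cinner_simps power2_eq_square divide_inverse)
  ultimately show ?thesis unfolding numerical_range_cinner
    by (intro image_eqI[where x = ?v]) simp_all
qed

lemma cinner_eq_imp_in_numerical_range:
  assumes "w \<noteq> 0" "cinner w (B *v w) = c * of_real ((norm w)\<^sup>2)"
  shows "c \<in> numerical_range B"
  using cinner_in_numerical_range[OF assms(1), of B] assms by simp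

lemma compact_numerical_range: "compact (numerical_range B)"
  unfolding numerical_range_cinner cinner_def matrix_vector_mult_def
  by (intro compact_continuous_image compact_sphere) (auto intro!: continuous_intros)

lemma numerical_range_nonempty: "numerical_range B \<noteq> {}"
proof -
  obtain v :: "complex^'n" where "norm v = 1" using vector_choose_size[of 1] by auto
  then show ?thesis by (auto simp: numerical_range_cinner)
qed

text \<open>Toeplitz--Hausdorff: after an affine normalisation the form takes the values 0 and 1 at two unit
  vectors, and a unimodular factor on one of them makes it real along the segment joining them.\<close>

lemma convex_numerical_range: "convex (numerical_range B)"
proof (rule convexI)
  fix a b and u s :: real
  assume ab: "a \<in> numerical_range B" "b \<in> numerical_range B" and us: "0 \<le> u" "0 \<le> s" "u + s = 1"
  have "u *\<^sub>R a + s *\<^sub>R b = a + of_real s * (b - a)"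
  proof -
    have "u = 1 - s" using us by simp
    show ?thesis unfolding \<open>u = 1 - s\<close> by (simp add: scaleR_conv_of_real algebra_simps)
  qed
  moreover have "a + of_real s * (b - a) \<in> numerical_range B"
  proof (cases "a = b")
    case False
    obtain x y where x: "norm x = 1" "a = cinner x (B *v x)" and y: "norm y = 1" "b = cinner y (B *v y)"
      using ab by (auto simp: numerical_range_cinner)
    define C where "C = mat (1 / (b - a)) ** (B - mat a)"
    have C: "cinner w (C *v v) = (cinner w (B *v v) - a * cinner w v) / (b - a)" for v w
    proof -
      have "cinner w (C *v v) = cinner w ((1 / (b - a)) *s (B *v v + (- a) *s v))"
        by (simp add: C_def matrix_vector_mul_assoc[symmetric] mat_vector_mult
            matrix_vector_mult_diff_rdistrib)
      then show ?thesis using False unfolding cinner_simps by (simp add: field_simps)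
    qed
    define \<alpha> \<beta> where "\<alpha> = cinner x (C *v y)" and "\<beta> = cinner y (C *v x)"
    define \<delta> where "\<delta> = \<alpha> - cnj \<beta>"
    \<comment> \<open>The phase that makes \<open>e * \<delta>\<close> equal to
      \<open>|\<delta>|\<close>. The imaginary part of \<open>e * \<alpha> + cnj e * \<beta>\<close>
      is that of \<open>e * \<delta>\<close>, hence 0.\<close>
    define e where "e = (if \<delta> = 0 then 1 else cnj \<delta> / norm \<delta>)"
    have e: "norm e = 1" by (auto simp: e_def norm_divide)
    have "e * \<delta> = of_real (norm \<delta>)"
      using complex_norm_square[of \<delta>] by (auto simp: e_def power2_eq_square field_simps)
    then have "Im (e * \<delta>) = 0" by simp
    then have im: "Im (e * \<alpha> + cnj e * \<beta>) = 0" by (simp add: \<delta>_def algebra_simps)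
    define v where "v t = of_real (1 - t) *s x + (of_real t * e) *s y" for t
    have Cx: "cinner x (C *v x) = 0" and Cy: "cinner y (C *v y) = 1"
      using x y False by (simp_all add: C cinner_self)
    have Cv: "cinner (v t) (C *v v t) = of_real (t\<^sup>2) + of_real (t * (1 - t)) * (e * \<alpha> + cnj e * \<beta>)" for t
    proof -
      have ee: "e * cnj e = 1" using complex_norm_square[of e] e by simp
      have "cinner (v t) (C *v v t) = of_real (1 - t) * (of_real t * e * \<alpha>)
          + of_real t * cnj e * (of_real (1 - t) * \<beta> + of_real t * e)"
        by (simp only: v_def matrix_vector_right_distrib matrix_vector_scalar cinner_simps Cx Cy
            \<alpha>_def[symmetric] \<beta>_def[symmetric] complex_cnj_mult complex_cnj_complex_of_real
            mult_1_right mult_zero_right add_0_left distrib_left) (simp only: ac_simps)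
      also have "\<dots> = of_real (t\<^sup>2) + of_real (t * (1 - t)) * (e * \<alpha> + cnj e * \<beta>)"
        using ee unfolding of_real_power of_real_mult by algebra
      finally show ?thesis .
    qed
    have v_nz: "v t \<noteq> 0" for t
    proof
      assume 0: "v t = 0"
      show False
      proof (cases "t = 0")
        case True
        then show False using 0 x by (simp add: v_def)
      next
        case False
        then have "of_real t * e \<noteq> 0" using e by auto
        \<comment> \<open>As a multiple of \<open>x\<close>, the vector \<open>y\<close> would give
          the form the value 0, but that value is 1.\<close>
        then have "y = (- of_real (1 - t) / (of_real t * e)) *s x"
          using 0 by (simp add: v_def vec_eq_iff field_simps add_eq_0_iff)
        then obtain k where "y = k *s x" by blast
        then have "cinner y (C *v y) = 0" by (simp add: matrix_vector_scalar cinner_simps Cx)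
        then show False using Cy by simp
      qed
    qed
    define F where "F t = Re (cinner (v t) (C *v v t)) / (norm (v t))\<^sup>2" for t
    have "continuous_on {0..1} v" unfolding v_def vector_scalar_mult_def
      by (intro continuous_intros)
    then have "continuous_on {0..1} F" unfolding F_def Cv
      by (intro continuous_intros) (use v_nz in auto)
    moreover have "F 0 = 0" "F 1 = 1"
      using e y by (auto simp: F_def Cv) (auto simp: v_def norm_vector_scalar)
    ultimately obtain t where t: "F t = s"
      using IVT'[of F 0 s 1] us by auto
    have "cinner (v t) (C *v v t) = of_real s * of_real ((norm (v t))\<^sup>2)"
    proof (rule complex_eqI)
      show "Im (cinner (v t) (C *v v t)) = Im (of_real s * of_real ((norm (v t))\<^sup>2))"
        using im by (simp add: Cv flip: of_real_mult of_real_power)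
      show "Re (cinner (v t) (C *v v t)) = Re (of_real s * of_real ((norm (v t))\<^sup>2))"
        using v_nz[of t] by (simp add: t[symmetric] F_def flip: of_real_mult of_real_power)
    qed
    then have "cinner (v t) (B *v v t) = (a + of_real s * (b - a)) * of_real ((norm (v t))\<^sup>2)"
      using False by (simp add: C cinner_self field_simps)
    then show ?thesis by (intro cinner_eq_imp_in_numerical_range[OF v_nz[of t]])
  qed (use ab in simp)
  ultimately show "u *\<^sub>R a + s *\<^sub>R b \<in> numerical_range B" by simp
qed

section \<open>Smooth convex neighbourhoods\<close>

text \<open>Used twice in succession, on a support function, to prepare its smoothing by second
  differences.\<close>

lemma continuous_antiderivative:
  fixes f :: "real \<Rightarrow> real"
  assumes "continuous_on UNIV f"
  shows "\<exists>F. \<forall>x. (F has_real_derivative f x) (at x)"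
proof -
  have int: "f integrable_on {a..b}" for a b
    by (intro integrable_continuous_real continuous_on_subset[OF assms]) auto
  \<comment> \<open>An integral over an interval with reversed endpoints is 0, so the base point is
    moved to the left of both 0 and \<open>x\<close>. By \<open>F\<close>, its position does not
    matter.\<close>
  define F where "F x = integral {- (\<bar>x\<bar> + 1)..x} f - integral {- (\<bar>x\<bar> + 1)..0} f" for x
  have F: "F x = integral {- n..x} f - integral {- n..0} f" if "\<bar>x\<bar> + 1 \<le> n" for x n
  proof -
    have "integral {- n..- (\<bar>x\<bar> + 1)} f + integral {- (\<bar>x\<bar> + 1)..y} f = integral {- n..y} f"
      if "- (\<bar>x\<bar> + 1) \<le> y" for y
      by (rule Henstock_Kurzweil_Integration.integral_combine) (use int that \<open>\<bar>x\<bar> + 1 \<le> n\<close> in auto)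
    moreover have "- (\<bar>x\<bar> + 1) \<le> x" "- (\<bar>x\<bar> + 1) \<le> 0" by linarith+
    ultimately show ?thesis unfolding F_def by (metis add_diff_cancel_left)
  qed
  have "(F has_real_derivative f x) (at x)" for x
  proof -
    define n where "n = \<bar>x\<bar> + 2"
    have "((\<lambda>y. integral {- n..y} f) has_real_derivative f x) (at x within {- n..n})"
      by (rule integral_has_real_derivative) (auto intro: continuous_on_subset[OF assms] simp: n_def)
    then have "((\<lambda>y. integral {- n..y} f) has_real_derivative f x) (at x)"
      by (subst (asm) at_within_interior) (auto simp: n_def)
    then have "((\<lambda>y. integral {- n..y} f - integral {- n..0} f) has_real_derivative f x) (at x)"
      by (auto intro!: derivative_eq_intros)
    then show ?thesis
    proof (rule has_field_derivative_transform_within_open)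
      show "open (ball x 1)" "x \<in> ball x 1" by auto
      show "integral {- n..y} f - integral {- n..0} f = F y" if "y \<in> ball x 1" for y
        using that by (intro F[symmetric]) (auto simp: n_def dist_real_def)
    qed
  qed
  then show ?thesis by blast
qed

text \<open>The second difference quotient of \<open>G\<close> is an average of \<open>f\<close>
  against a hat function of width \<open>b\<close>, and so a twice differentiable approximation of a
  function that is merely Lipschitz. The bound comes from the mean value theorem, applied to
  \<open>m\<close> and then to \<open>F\<close>.\<close>

lemma second_difference_bound:
  fixes f :: "real \<Rightarrow> real"
  assumes F: "\<And>x. (F has_real_derivative f x) (at x)" and G: "\<And>x. (G has_real_derivative F x) (at x)"
    and lip: "\<And>x y. \<bar>f x - f y\<bar> \<le> R * \<bar>x - y\<bar>" and "b > 0"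
  shows "\<bar>(G (x + b) - 2 * G x + G (x - b)) / b\<^sup>2 - f x\<bar> \<le> 2 * R * b"
proof -
  have R: "0 \<le> R" using lip[of 1 0] by simp
  define m where "m s = G (x + s) + G (x - s) - 2 * G x - s\<^sup>2 * f x" for s
  have "(m has_real_derivative F (x + s) - F (x - s) - 2 * s * f x) (at s)" for s
    unfolding m_def by (auto intro!: derivative_eq_intros DERIV_chain'[OF _ G, where f = "\<lambda>s. x + s"]
        DERIV_chain'[OF _ G, where f = "\<lambda>s. x - s"])
  then obtain s where s: "0 < s" "s < b" "m b - m 0 = (b - 0) * (F (x + s) - F (x - s) - 2 * s * f x)"
    using MVT2[of 0 b m "\<lambda>s. F (x + s) - F (x - s) - 2 * s * f x"] \<open>b > 0\<close> by blast
  obtain y where y: "x - s < y" "y < x + s" "F (x + s) - F (x - s) = (x + s - (x - s)) * f y"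
    using MVT2[of "x - s" "x + s" F f] F s by auto
  have "m b = b * (2 * s * (f y - f x))"
    using s(3) y(3) by (simp add: m_def algebra_simps)
  then have "\<bar>m b\<bar> = b * (2 * s * \<bar>f y - f x\<bar>)" using s by (simp add: abs_mult)
  also have "\<dots> \<le> b * (2 * b * (R * b))"
    using s y R by (intro mult_left_mono mult_mono order_trans[OF lip[of y x]]) auto
  finally have "\<bar>m b\<bar> \<le> 2 * R * b * b\<^sup>2" by (simp add: power2_eq_square algebra_simps)
  moreover have "(G (x + b) - 2 * G x + G (x - b)) / b\<^sup>2 - f x = m b / b\<^sup>2"
    using \<open>b > 0\<close> by (simp add: m_def field_simps)
  ultimately show ?thesis using \<open>b > 0\<close> by (simp add: abs_divide divide_le_eq)
qed

text \<open>A chord, of length \<open>2 |sin ((a - b) / 2)|\<close>, is at most as long as its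
  arc.\<close>

lemma norm_cis_diff_le: "norm (cis a - cis b) \<le> \<bar>a - b\<bar>"
proof -
  have "(norm (cis a - cis b))\<^sup>2 = 2 - 2 * cos (2 * ((a - b) / 2))"
    using sin_cos_squared_add[of a] sin_cos_squared_add[of b]
    by (simp add: cmod_power2 power2_diff cos_diff algebra_simps)
  also have "\<dots> = 4 * (sin ((a - b) / 2))\<^sup>2"
    unfolding cos_double_sin by simp
  also have "\<dots> \<le> 4 * ((a - b) / 2)\<^sup>2"
    using abs_sin_x_le_abs_x[of "(a - b) / 2"] by (simp only: abs_le_square_iff)
  also have "\<dots> = \<bar>a - b\<bar>\<^sup>2" by (simp add: power_divide)
  finally show ?thesis by (rule power2_le_imp_le) simp
qed

section \<open>Support functions of compact sets and their smoothing\<close>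

definition support_fun :: "complex set \<Rightarrow> real \<Rightarrow> real" where
  "support_fun W \<theta> = (SUP z\<in>W. Re (cis (- \<theta>) * z))"

context
  fixes W :: "complex set"
  assumes W: "compact W" "W \<noteq> {}"
begin

lemma support_fun_attained:
  obtains p where "p \<in> W" "support_fun W \<theta> = Re (cis (- \<theta>) * p)"
    "\<And>z. z \<in> W \<Longrightarrow> Re (cis (- \<theta>) * z) \<le> Re (cis (- \<theta>) * p)"
proof -
  have "continuous_on W (\<lambda>z. Re (cis (- \<theta>) * z))" by (intro continuous_intros)
  then obtain p where p: "p \<in> W" "\<And>z. z \<in> W \<Longrightarrow> Re (cis (- \<theta>) * z) \<le> Re (cis (- \<theta>) * p)"
    using continuous_attains_sup[OF W, of "\<lambda>z. Re (cis (- \<theta>) * z)"] by blast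
  then have "support_fun W \<theta> = Re (cis (- \<theta>) * p)"
    unfolding support_fun_def by (intro cSup_eq_maximum) auto
  with p show thesis by (intro that)
qed

lemma le_support_fun: "z \<in> W \<Longrightarrow> Re (cis (- \<theta>) * z) \<le> support_fun W \<theta>"
  by (rule support_fun_attained[of \<theta>]) auto

lemma support_fun_lipschitz:
  assumes R: "\<And>z. z \<in> W \<Longrightarrow> norm z \<le> R"
  shows "\<bar>support_fun W \<theta> - support_fun W \<phi>\<bar> \<le> R * \<bar>\<theta> - \<phi>\<bar>"
proof -
  have "support_fun W \<theta> - support_fun W \<phi> \<le> R * \<bar>\<theta> - \<phi>\<bar>" for \<theta> \<phi>
  proof -
    obtain p where p: "p \<in> W" "support_fun W \<theta> = Re (cis (- \<theta>) * p)" by (rule support_fun_attained)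
    then have "support_fun W \<theta> - support_fun W \<phi> \<le> Re ((cis (- \<theta>) - cis (- \<phi>)) * p)"
      using le_support_fun[of p \<phi>] by (simp add: left_diff_distrib)
    also have "\<dots> \<le> norm (cis (- \<theta>) - cis (- \<phi>)) * norm p"
      by (metis complex_Re_le_cmod norm_mult)
    also have "\<dots> \<le> \<bar>\<theta> - \<phi>\<bar> * R"
      using norm_cis_diff_le[of "- \<theta>" "- \<phi>"] R[OF p(1)] by (intro mult_mono) auto
    finally show ?thesis by (simp add: mult.commute)
  qed
  from this[of \<theta> \<phi>] this[of \<phi> \<theta>] show ?thesis by (simp add: abs_le_iff abs_minus_commute)
qed

lemma abs_support_fun_le:
  assumes R: "\<And>z. z \<in> W \<Longrightarrow> norm z \<le> R"
  shows "\<bar>support_fun W \<theta>\<bar> \<le> R"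
proof -
  obtain p where p: "p \<in> W" "support_fun W \<theta> = Re (cis (- \<theta>) * p)" by (rule support_fun_attained)
  have "\<bar>Re (cis (- \<theta>) * p)\<bar> \<le> norm p"
    using abs_Re_le_cmod[of "cis (- \<theta>) * p"] by (simp add: norm_mult)
  then show ?thesis using R[OF p(1)] p(2) by simp
qed

text \<open>A discrete form of \<open>f'' + f >= 0\<close>, which makes sense for support functions
  without derivatives. For a single point equality holds, since the two directions add up to
  \<open>2 * cos b\<close> times the middle one; the maximising point for \<theta> then gives the
  inequality.\<close>

lemma support_fun_chord:
  "2 * cos b * support_fun W \<theta> \<le> support_fun W (\<theta> + b) + support_fun W (\<theta> - b)"
proof -
  obtain p where p: "p \<in> W" "support_fun W \<theta> = Re (cis (- \<theta>) * p)" by (rule support_fun_attained)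
  have "cis (- (\<theta> + b)) + cis (- (\<theta> - b)) = of_real (2 * cos b) * cis (- \<theta>)"
    by (simp add: complex_eq_iff cos_add cos_diff sin_add sin_diff)
  then have "Re (cis (- (\<theta> + b)) * p) + Re (cis (- (\<theta> - b)) * p) = Re (of_real (2 * cos b) * (cis (- \<theta>) * p))"
    by (simp only: mult.assoc[symmetric] distrib_right[symmetric] plus_complex.sel[symmetric])
  also have "\<dots> = 2 * cos b * Re (cis (- \<theta>) * p)" by (simp only: times_complex.sel Re_complex_of_real Im_complex_of_real)
  finally have "2 * cos b * Re (cis (- \<theta>) * p) = Re (cis (- (\<theta> + b)) * p) + Re (cis (- (\<theta> - b)) * p)" by simp
  then show ?thesis
    using p le_support_fun[of p "\<theta> + b"] le_support_fun[of p "\<theta> - b"] by simp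
qed

lemma support_fun_periodic: "support_fun W (\<theta> + 2 * pi) = support_fun W \<theta>"
proof -
  have "cis (- (\<theta> + 2 * pi)) = cis (- \<theta>) * cis (- (2 * pi))" by (simp add: cis_mult)
  also have "cis (- (2 * pi)) = 1" by (simp add: complex_eq_iff)
  finally show ?thesis by (simp add: support_fun_def)
qed

text \<open>The direction to test is the one from the closest point \<open>p\<close> of
  \<open>W\<close> to \<open>z\<close>: there \<open>p\<close> attains the support function, and
  \<open>z\<close> exceeds it by exactly its distance from \<open>p\<close>.\<close>

lemma near_if_le_support_fun:
  assumes "convex W" "\<And>\<theta>. Re (cis (- \<theta>) * z) \<le> support_fun W \<theta> + d" "0 \<le> d"
  obtains w where "w \<in> W" "dist w z \<le> d"
proof -
  have cl: "closed W" using W(1) by (rule compact_imp_closed)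
  define p where "p = closest_point W z"
  have p: "p \<in> W" unfolding p_def using cl W(2) by (rule closest_point_in_set)
  have "dist p z \<le> d"
  proof (cases "z = p")
    case False
    define \<theta> where "\<theta> = Arg (z - p)"
    have c: "z - p = of_real (norm (z - p)) * cis \<theta>"
      unfolding \<theta>_def by (metis rcis_def rcis_cmod_Arg)
    have "Re (cis (- \<theta>) * (w - p)) \<le> 0" if "w \<in> W" for w
    proof -
      have "(z - p) \<bullet> (w - p) \<le> 0"
        unfolding p_def by (rule closest_point_dot[OF assms(1) cl that])
      then have "norm (z - p) * Re (cis (- \<theta>) * (w - p)) \<le> 0"
        by (subst (asm) c) (simp add: inner_complex_def algebra_simps)
      then show ?thesis using False by (simp add: mult_le_0_iff)
    qed
    then have "support_fun W \<theta> \<le> Re (cis (- \<theta>) * p)"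
      by (rule_tac support_fun_attained[of \<theta>]) (force simp: algebra_simps)
    moreover have "Re (cis (- \<theta>) * z) = Re (cis (- \<theta>) * p) + Re (cis (- \<theta>) * (z - p))"
      by (simp add: algebra_simps)
    moreover have "cis (- \<theta>) * (z - p) = of_real (norm (z - p))"
      by (subst c) (simp add: mult.left_commute cis_mult del: of_real_mult)
    ultimately show ?thesis using assms(2)[of \<theta>] by (simp add: dist_norm norm_minus_commute)
  qed (use assms in simp)
  with p show thesis by (rule that)
qed

text \<open>The support function \<open>f\<close> of \<open>W\<close> is only Lipschitz. The second
  difference quotient of its second antiderivative smooths it, and the added constant
  \<open>e\<close> pays both for the smoothing error, keeping \<open>h\<close> above
  \<open>f\<close>, and for the possible loss of positivity of \<open>h + h2\<close>.\<close>

lemma smooth_convex_neighbourhood: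
  assumes "convex W" "d > 0"
  obtains h h1 h2 where
    "\<And>\<theta>. (h has_real_derivative h1 \<theta>) (at \<theta>)" "\<And>\<theta>. (h1 has_real_derivative h2 \<theta>) (at \<theta>)"
    "continuous_on UNIV h2" "\<And>\<theta>. h (\<theta> + 2 * pi) = h \<theta>" "\<And>\<theta>. 0 < h \<theta> + h2 \<theta>"
    "\<And>z \<theta>. z \<in> W \<Longrightarrow> Re (cis (- \<theta>) * z) < h \<theta>"
    "\<And>z. (\<And>\<theta>. Re (cis (- \<theta>) * z) \<le> h \<theta>) \<Longrightarrow> \<exists>w\<in>W. dist w z < d"
proof -
  define f where "f = support_fun W"
  obtain R where R: "\<And>z. z \<in> W \<Longrightarrow> norm z \<le> R" using compact_imp_bounded[OF W(1)] by (auto simp: bounded_iff)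
  have lip: "\<bar>f x - f y\<bar> \<le> R * \<bar>x - y\<bar>" for x y
    unfolding f_def by (rule support_fun_lipschitz[OF R])
  have "R-lipschitz_on UNIV f"
    using lip[of 1 0] by (intro lipschitz_onI) (auto simp: dist_real_def lip)
  then have cont: "continuous_on UNIV f" by (rule lipschitz_on_continuous_on)
  obtain F where F: "\<And>x. (F has_real_derivative f x) (at x)" using continuous_antiderivative[OF cont] by blast
  then have "continuous_on UNIV F" by (meson DERIV_continuous_on has_field_derivative_at_within)
  then obtain G where G: "\<And>x. (G has_real_derivative F x) (at x)" using continuous_antiderivative by blast
  \<comment> \<open>A third of the margin: the smoothing error will be below \<open>e\<close>, so
    \<open>h\<close> lies strictly between \<open>f\<close> and \<open>f + 2 * e\<close>, and
    \<open>2 * e\<close> is still less than \<open>d\<close>.\<close>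
  define e where "e = d / 3"
  \<comment> \<open>One \<open>b\<close> has to control two errors: \<open>2 * R * b\<close> from
    smoothing, and the deviation of \<open>2 * (1 - cos b) / b^2\<close> from 1, by which
    \<open>support_fun_chord\<close> falls short of \<open>f'' >= - f\<close>.\<close>
  have "((\<lambda>b::real. 2 * R * b + R * \<bar>1 - 2 * (1 - cos b) / b\<^sup>2\<bar>) \<longlongrightarrow> 2 * R * 0 + R * \<bar>1 - 1\<bar>) (at_right 0)"
    by (intro tendsto_intros) real_asymp+
  then have "eventually (\<lambda>b::real. 2 * R * b + R * \<bar>1 - 2 * (1 - cos b) / b\<^sup>2\<bar> < e) (at_right 0)"
    using \<open>d > 0\<close> by (intro order_tendstoD(2)) (auto simp: e_def)
  then obtain b where b: "b > 0" "2 * R * b + R * \<bar>1 - 2 * (1 - cos b) / b\<^sup>2\<bar> < e"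
    by (metis (mono_tags, lifting) eventually_at_right_field field_lbound_gt_zero dense)
  have R0: "0 \<le> R" using lip[of 1 0] by simp
  have "0 \<le> R * \<bar>1 - 2 * (1 - cos b) / b\<^sup>2\<bar>" using R0 by simp
  then have b2: "2 * R * b < e" using b(2) by linarith
  define h where "h x = (G (x + b) - 2 * G x + G (x - b)) / b\<^sup>2 + e" for x
  define h1 where "h1 x = (F (x + b) - 2 * F x + F (x - b)) / b\<^sup>2" for x
  define h2 where "h2 x = (f (x + b) - 2 * f x + f (x - b)) / b\<^sup>2" for x
  have near: "\<bar>h x - e - f x\<bar> \<le> 2 * R * b" for x
    using second_difference_bound[OF F G lip b(1)] by (simp add: h_def)
  show thesis
  proof (rule that[of h h1 h2])
    show "(h has_real_derivative h1 x) (at x)" for x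
    proof -
      have "((\<lambda>x. G (x + b) - 2 * G x + G (x - b)) has_real_derivative F (x + b) - 2 * F x + F (x - b)) (at x)"
        by (auto intro!: derivative_eq_intros DERIV_chain'[OF _ G, where f = "\<lambda>s. s + b"]
          DERIV_chain'[OF _ G, where f = "\<lambda>s. s - b"] G)
      from DERIV_add[OF DERIV_cdivide[OF this, of "b\<^sup>2"] DERIV_const[of e]] show ?thesis
        by (simp add: h_def[abs_def] h1_def)
    qed
    show "(h1 has_real_derivative h2 x) (at x)" for x
    proof -
      have "((\<lambda>x. F (x + b) - 2 * F x + F (x - b)) has_real_derivative f (x + b) - 2 * f x + f (x - b)) (at x)"
        by (auto intro!: derivative_eq_intros DERIV_chain'[OF _ F, where f = "\<lambda>s. s + b"]
          DERIV_chain'[OF _ F, where f = "\<lambda>s. s - b"] F)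
      from DERIV_cdivide[OF this, of "b\<^sup>2"] show ?thesis
        by (simp add: h1_def[abs_def] h2_def)
    qed
    show "continuous_on UNIV h2"
      unfolding h2_def using b(1) by (intro continuous_intros continuous_on_compose2[OF cont]) auto
    show "h (x + 2 * pi) = h x" for x
    proof -
      \<comment> \<open>The antiderivatives of the periodic \<open>f\<close> need not be periodic:
        over a period \<open>F\<close> changes by a constant and \<open>G\<close> by an affine
        function, and the second difference annihilates the latter.\<close>
      have "((\<lambda>x. F (x + 2 * pi) - F x) has_real_derivative 0) (at x)" for x
        by (auto intro!: derivative_eq_intros DERIV_chain'[OF _ F, where f = "\<lambda>s. s + 2 * pi"] F
            simp: f_def support_fun_periodic)
      then have "F (x + 2 * pi) - F x = F (0 + 2 * pi) - F 0" for x
        by (rule DERIV_isconst_all[rule_format]) 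
      then obtain c where c: "\<And>x. F (x + 2 * pi) - F x = c" by blast
      have "((\<lambda>x. G (x + 2 * pi) - G x - c * x) has_real_derivative 0) (at x)" for x
        using c[of x]
        by (auto intro!: derivative_eq_intros DERIV_chain'[OF _ G, where f = "\<lambda>s. s + 2 * pi"] G)
      then have G': "G (x + 2 * pi) - G x - c * x = G (0 + 2 * pi) - G 0 - c * 0" for x
        by (rule DERIV_isconst_all[rule_format])
      have "G (x + 2 * pi + b) - 2 * G (x + 2 * pi) + G (x + 2 * pi - b) = G (x + b) - 2 * G x + G (x - b)"
        using G'[of "x + b"] G'[of x] G'[of "x - b"] by (simp add: algebra_simps)
      then show ?thesis by (simp add: h_def)
    qed
    show "0 < h x + h2 x" for x
    proof -
      have "- (2 * (1 - cos b) / b\<^sup>2) * f x \<le> h2 x"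
        using support_fun_chord[of b x] b(1) by (simp add: h2_def f_def field_simps)
      moreover have "f x - 2 * R * b + e \<le> h x" using near[of x] by (simp add: abs_le_iff)
      moreover have "\<bar>(1 - 2 * (1 - cos b) / b\<^sup>2) * f x\<bar> \<le> \<bar>1 - 2 * (1 - cos b) / b\<^sup>2\<bar> * R"
        unfolding abs_mult f_def by (intro mult_left_mono abs_support_fun_le[OF R]) auto
      moreover have "(1 - 2 * (1 - cos b) / b\<^sup>2) * f x = f x + - (2 * (1 - cos b) / b\<^sup>2) * f x"
        by (simp add: algebra_simps)
      ultimately show ?thesis using b(2) by (simp add: mult.commute)
    qed
    show "Re (cis (- x) * z) < h x" if "z \<in> W" for z x
      using le_support_fun[OF that, of x] near[of x] b2 by (simp add: f_def abs_le_iff)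
    show "\<exists>w\<in>W. dist w z < d" if "\<And>\<theta>. Re (cis (- \<theta>) * z) \<le> h \<theta>" for z
    proof -
      have "Re (cis (- x) * z) \<le> support_fun W x + 2 * e" for x
        using that[of x] near[of x] b2 by (simp add: f_def abs_le_iff)
      then obtain w where "w \<in> W" "dist w z \<le> 2 * e"
        using near_if_le_support_fun[OF assms(1), of z "2 * e"] \<open>d > 0\<close> by (auto simp: e_def)
      then show ?thesis using \<open>d > 0\<close> by (intro bexI[of _ w]) (auto simp: e_def)
    qed
  qed
qed

end

section \<open>The Cauchy transform on a smooth convex domain\<close>

lemma Re_divide_inner: "Re (a / b) = (a \<bullet> b) / (norm b)\<^sup>2"
  by (simp add: Re_divide inner_complex_def cmod_power2)

lemma inner_cis_mult: "cis \<theta> \<bullet> (cis \<theta> * w) = Re w"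
proof -
  have "cis \<theta> \<bullet> (cis \<theta> * w) = Re w * ((cos \<theta>)\<^sup>2 + (sin \<theta>)\<^sup>2)"
    by (simp only: inner_complex_def cis.sel times_complex.sel, algebra)
  then show ?thesis by simp
qed

lemma Re_cis_minus_mult: "Re (cis (- \<theta>) * z) = cis \<theta> \<bullet> z"
  by (simp add: inner_complex_def)

lemma inner_cis_i_cis: "cis \<phi> \<bullet> (\<i> * cis \<theta>) = - sin (\<theta> - \<phi>)"
  by (simp add: inner_complex_def sin_diff)

lemma inner_cis_le: "cis \<theta> \<bullet> w \<le> norm w"
  using norm_cauchy_schwarz[of "cis \<theta>" w] by simp

lemma periodic_of_int:
  fixes F :: "real \<Rightarrow> 'b"
  assumes "\<And>x. F (x + 2 * pi) = F x"
  shows "F (x + 2 * pi * of_int m) = F x"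
proof (induction m rule: int_induct[of _ 0])
  case (step1 i)
  then show ?case using assms[of "x + 2 * pi * of_int i"] by (simp add: algebra_simps)
next
  case (step2 i)
  then show ?case using assms[of "x + 2 * pi * of_int (i - 1)"] by (simp add: algebra_simps)
qed simp

text \<open>\<open>h + h2\<close> is the radius of curvature of the curve with support function
  \<open>h\<close>; its positivity makes the curve regular and strictly convex.\<close>

locale smooth_convex =
  fixes h h1 h2 :: "real \<Rightarrow> real"
  assumes h: "\<And>\<theta>. (h has_real_derivative h1 \<theta>) (at \<theta>)"
    and h1: "\<And>\<theta>. (h1 has_real_derivative h2 \<theta>) (at \<theta>)"
    and cont_h2: "continuous_on UNIV h2"
    and h_periodic: "\<And>\<theta>. h (\<theta> + 2 * pi) = h \<theta>"
    and curvature_pos: "\<And>\<theta>. 0 < h \<theta> + h2 \<theta>"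
begin

text \<open>The convex set with support function \<open>h\<close> is bounded by the curve \<open>\<sigma>\<close>, with outer normal
  \<open>cis \<theta>\<close> at \<open>\<sigma> \<theta>\<close> and \<open>d\<sigma> = 2 \<pi> \<i> wt(\<theta>) d\<theta>\<close>. The function \<open>\<kappa>\<close> is the double layer
  potential kernel.\<close>

definition "\<sigma> \<theta> = cis \<theta> * Complex (h \<theta>) (h1 \<theta>)"
definition "wt \<theta> = of_real ((h \<theta> + h2 \<theta>) / (2 * pi)) * cis \<theta>"
definition "D = {z. \<forall>\<theta>. cis \<theta> \<bullet> z < h \<theta>}"
definition "Dc = {z. \<forall>\<theta>. cis \<theta> \<bullet> z \<le> h \<theta>}"
definition "\<kappa> \<theta> z = 2 * Re (wt \<theta> / (\<sigma> \<theta> - z))"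

lemma h1_periodic: "h1 (\<theta> + 2 * pi) = h1 \<theta>"
proof -
  have "((\<lambda>x. h (x + 2 * pi)) has_real_derivative h1 (\<theta> + 2 * pi)) (at \<theta>)"
    using h[of "\<theta> + 2 * pi"] unfolding DERIV_shift .
  then show ?thesis using h[of \<theta>] by (simp add: h_periodic DERIV_unique)
qed

lemma h2_periodic: "h2 (\<theta> + 2 * pi) = h2 \<theta>"
proof -
  have "((\<lambda>x. h1 (x + 2 * pi)) has_real_derivative h2 (\<theta> + 2 * pi)) (at \<theta>)"
    using h1[of "\<theta> + 2 * pi"] unfolding DERIV_shift .
  then show ?thesis using h1[of \<theta>] by (simp add: h1_periodic DERIV_unique)
qed

lemma cis_periodic': "cis (\<theta> + 2 * pi) = cis \<theta>"
  by (simp add: cis.code)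

lemma \<sigma>_periodic: "\<sigma> (\<theta> + 2 * pi) = \<sigma> \<theta>"
  by (simp add: \<sigma>_def h_periodic h1_periodic cis_periodic')

lemma wt_periodic: "wt (\<theta> + 2 * pi) = wt \<theta>"
  by (simp add: wt_def h_periodic h2_periodic cis_periodic')

lemma angle_reduce:
  obtains \<phi> where "\<phi> \<in> {0..2 * pi}" "cis \<phi> = cis \<theta>" "h \<phi> = h \<theta>"
proof -
  define n where "n = \<lfloor>\<theta> / (2 * pi)\<rfloor>"
  have n: "of_int n \<le> \<theta> / (2 * pi)" "\<theta> / (2 * pi) < of_int n + 1"
    unfolding n_def by linarith+
  let ?\<phi> = "\<theta> - 2 * pi * of_int n"
  show thesis
  proof (rule that[of ?\<phi>])
    show "?\<phi> \<in> {0..2 * pi}" using n by (simp add: field_simps)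
    show "cis ?\<phi> = cis \<theta>" using periodic_of_int[of cis, OF cis_periodic', of "?\<phi>" n] by simp
    show "h ?\<phi> = h \<theta>" using periodic_of_int[of h, OF h_periodic, of "?\<phi>" n] by simp
  qed
qed

lemma continuous_h [continuous_intros]: "continuous_on S h"
  by (meson DERIV_continuous_on h has_field_derivative_at_within)

lemma cis_derivative: "(cis has_vector_derivative \<i> * cis \<theta>) (at \<theta> within S)"
  using has_derivative_cis[of "\<lambda>x. x" "\<lambda>x. x" \<theta> S]
  by (simp add: has_vector_derivative_def)

lemma \<sigma>_derivative: "(\<sigma> has_vector_derivative 2 * pi * \<i> * wt \<theta>) (at \<theta> within S)"
proof -
  have eq: "\<sigma> = (\<lambda>\<theta>. cis \<theta> * (of_real (h \<theta>) + \<i> * of_real (h1 \<theta>)))"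
    by (simp add: \<sigma>_def fun_eq_iff complex_eq_iff)
  have h': "((\<lambda>x. complex_of_real (h x)) has_vector_derivative of_real (h1 \<theta>)) (at \<theta> within S)"
    "((\<lambda>x. complex_of_real (h1 x)) has_vector_derivative of_real (h2 \<theta>)) (at \<theta> within S)"
    by (rule has_vector_derivative_of_real[OF has_field_derivative_at_within[OF h]],
        rule has_vector_derivative_of_real[OF has_field_derivative_at_within[OF h1]])
  have "(\<sigma> has_vector_derivative
      cis \<theta> * (of_real (h1 \<theta>) + \<i> * of_real (h2 \<theta>))
      + \<i> * cis \<theta> * (of_real (h \<theta>) + \<i> * of_real (h1 \<theta>))) (at \<theta> within S)"
    unfolding eq
    by (intro has_vector_derivative_mult has_vector_derivative_add has_vector_derivative_mult_right
        cis_derivative h')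
  moreover have "cis \<theta> * (of_real (h1 \<theta>) + \<i> * of_real (h2 \<theta>))
      + \<i> * cis \<theta> * (of_real (h \<theta>) + \<i> * of_real (h1 \<theta>)) = 2 * pi * \<i> * wt \<theta>"
    by (simp add: wt_def algebra_simps)
  ultimately show ?thesis by simp
qed

lemma continuous_\<sigma>: "continuous_on S \<sigma>"
  by (rule continuous_on_vector_derivative[OF \<sigma>_derivative])

lemma continuous_wt: "continuous_on S wt"
  unfolding wt_def by (intro continuous_intros continuous_on_subset[OF cont_h2]) auto

text \<open>\<open>D\<close> is an intersection of infinitely many open half planes, so its openness
  needs a uniform gap. Compactness of one period provides it.\<close>

lemma open_support_gap:
  assumes "z \<in> D"
  obtains \<eta> where "\<eta> > 0" "\<And>\<theta>. cis \<theta> \<bullet> z + \<eta> \<le> h \<theta>"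
proof -
  have "continuous_on {0..2 * pi} (\<lambda>\<theta>. h \<theta> - cis \<theta> \<bullet> z)" by (intro continuous_intros)
  then obtain x where x: "\<And>\<theta>. \<theta> \<in> {0..2 * pi} \<Longrightarrow> h x - cis x \<bullet> z \<le> h \<theta> - cis \<theta> \<bullet> z"
    using continuous_attains_inf[of "{0..2 * pi}" "\<lambda>\<theta>. h \<theta> - cis \<theta> \<bullet> z"] by fastforce
  show thesis
  proof (rule that[of "h x - cis x \<bullet> z"])
    show "h x - cis x \<bullet> z > 0" using assms by (simp add: D_def)
    show "cis \<theta> \<bullet> z + (h x - cis x \<bullet> z) \<le> h \<theta>" for \<theta>
    proof -
      obtain \<phi> where \<phi>: "\<phi> \<in> {0..2 * pi}" "cis \<phi> = cis \<theta>" "h \<phi> = h \<theta>" by (rule angle_reduce)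
      then show ?thesis using x[of \<phi>] by simp
    qed
  qed
qed

lemma open_D: "open D"
  unfolding open_contains_ball
proof
  fix z assume "z \<in> D"
  then obtain \<eta> where \<eta>: "\<eta> > 0" "\<And>\<theta>. cis \<theta> \<bullet> z + \<eta> \<le> h \<theta>"
    using open_support_gap by blast
  have "w \<in> D" if "w \<in> ball z \<eta>" for w
    unfolding D_def
  proof (intro CollectI allI)
    fix \<theta>
    have "cis \<theta> \<bullet> (w - z) < \<eta>"
      using inner_cis_le[of \<theta> "w - z"] that by (simp add: dist_norm norm_minus_commute)
    then show "cis \<theta> \<bullet> w < h \<theta>" using \<eta>(2)[of \<theta>] by (simp add: inner_diff_right)
  qed
  then show "\<exists>e>0. ball z e \<subseteq> D" using \<eta>(1) by blast
qed

lemma convex_D: "convex D"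
proof -
  have "D = (\<Inter>\<theta>. {z. cis \<theta> \<bullet> z < h \<theta>})" by (auto simp: D_def)
  then show ?thesis by (auto intro!: convex_INT convex_halfspace_lt)
qed

lemma Dc_eq: "Dc = (\<Inter>\<theta>. {z. cis \<theta> \<bullet> z \<le> h \<theta>})"
  by (auto simp: Dc_def)

lemma convex_Dc: "convex Dc"
  unfolding Dc_eq by (auto intro!: convex_INT convex_halfspace_le)

lemma D_subset_Dc: "D \<subseteq> Dc"
  by (auto simp: D_def Dc_def less_imp_le)

lemma compact_Dc: "compact Dc"
proof -
  have "closed Dc" by (simp add: Dc_eq closed_halfspace_le closed_INT)
  moreover have "norm z \<le> (\<bar>h 0\<bar> + \<bar>h pi\<bar>) + (\<bar>h (pi / 2)\<bar> + \<bar>h (- (pi / 2))\<bar>)" if "z \<in> Dc" for z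
  proof -
    have "cis \<theta> \<bullet> z \<le> h \<theta>" for \<theta> using that by (simp add: Dc_def)
    from this[of 0] this[of pi] this[of "pi / 2"] this[of "- (pi / 2)"]
    have "\<bar>Re z\<bar> \<le> \<bar>h 0\<bar> + \<bar>h pi\<bar>" "\<bar>Im z\<bar> \<le> \<bar>h (pi / 2)\<bar> + \<bar>h (- (pi / 2))\<bar>" by (simp_all add: inner_complex_def)
    then show ?thesis using cmod_le[of z] by linarith
  qed
  ultimately show ?thesis by (auto simp: compact_eq_bounded_closed bounded_iff)
qed

lemma inner_cis_\<sigma>: "cis \<theta> \<bullet> \<sigma> \<theta> = h \<theta>"
  by (simp add: \<sigma>_def inner_cis_mult)

text \<open>The derivative of \<open>cis \<phi> \<bullet> \<sigma> x\<close> is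
  \<open>- sin (x - \<phi>) * (h x + h2 x)\<close>: starting from its value \<open>h \<phi>\<close>
  the function falls during the first half turn and rises back during the second.\<close>

lemma inner_cis_\<sigma>_less:
  assumes "\<phi> < \<theta>" "\<theta> < \<phi> + 2 * pi"
  shows "cis \<phi> \<bullet> \<sigma> \<theta> < h \<phi>"
proof -
  define k where "k x = cis \<phi> \<bullet> \<sigma> x" for x
  have der: "(k has_real_derivative - sin (x - \<phi>) * (h x + h2 x)) (at x)" for x
  proof -
    have "2 * pi * \<i> * wt x = (h x + h2 x) *\<^sub>R (\<i> * cis x)"
      by (simp add: wt_def scaleR_conv_of_real)
    then have "cis \<phi> \<bullet> (2 * pi * \<i> * wt x) = - sin (x - \<phi>) * (h x + h2 x)"
      by (simp only: inner_scaleR_right inner_cis_i_cis mult.commute)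
    then show ?thesis
      using bounded_linear.has_vector_derivative[OF bounded_linear_inner_right \<sigma>_derivative[of x UNIV], of "cis \<phi>"]
      by (simp add: k_def[abs_def] has_real_derivative_iff_has_vector_derivative)
  qed
  have k\<phi>: "k \<phi> = h \<phi>" "k (\<phi> + 2 * pi) = h \<phi>" by (simp_all add: k_def inner_cis_\<sigma> \<sigma>_periodic)
  have "k \<theta> < h \<phi>"
  proof (cases "\<theta> \<le> \<phi> + pi")
    case True
    obtain x where x: "\<phi> < x" "x < \<theta>" "k \<theta> - k \<phi> = (\<theta> - \<phi>) * (- sin (x - \<phi>) * (h x + h2 x))"
      using MVT2[of \<phi> \<theta> k, OF assms(1) der] by blast
    then have "0 < (\<theta> - \<phi>) * (sin (x - \<phi>) * (h x + h2 x))"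
      using True by (intro mult_pos_pos sin_gt_zero curvature_pos) auto
    then show ?thesis using x(3) k\<phi> by simp
  next
    case False
    obtain x where x: "\<theta> < x" "x < \<phi> + 2 * pi"
      "k (\<phi> + 2 * pi) - k \<theta> = (\<phi> + 2 * pi - \<theta>) * (- sin (x - \<phi>) * (h x + h2 x))"
      using MVT2[of \<theta> "\<phi> + 2 * pi" k, OF assms(2) der] by blast
    have "0 < (\<phi> + 2 * pi - \<theta>) * (- sin (x - \<phi>) * (h x + h2 x))"
      using x False assms by (intro mult_pos_pos curvature_pos) (auto intro: sin_lt_zero)
    then show ?thesis using x(3) k\<phi> by simp
  qed
  then show ?thesis by (simp add: k_def)
qed

lemma \<sigma>_in_Dc: "\<sigma> \<theta> \<in> Dc"
  unfolding Dc_def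
proof (intro CollectI allI)
  fix \<phi>
  define n where "n = \<lfloor>(\<theta> - \<phi>) / (2 * pi)\<rfloor>"
  define x where "x = \<theta> - 2 * pi * of_int n"
  have "of_int n \<le> (\<theta> - \<phi>) / (2 * pi)" "(\<theta> - \<phi>) / (2 * pi) < of_int n + 1"
    unfolding n_def by linarith+
  then have "\<phi> \<le> x" "x < \<phi> + 2 * pi" by (simp_all add: x_def field_simps)
  moreover have "\<sigma> \<theta> = \<sigma> x" using periodic_of_int[of \<sigma>, OF \<sigma>_periodic, of x n] by (simp add: x_def)
  ultimately show "cis \<phi> \<bullet> \<sigma> \<theta> \<le> h \<phi>"
    using inner_cis_\<sigma>_less[of \<phi> x] by (cases "x = \<phi>") (simp_all add: inner_cis_\<sigma>)
qed

text \<open>At the angle where \<open>z\<close> touches its supporting line, the nonnegative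
  function \<open>h x - cis x \<bullet> z\<close> has a minimum, so its derivative vanishes as well.
  Value and derivative together give both coordinates of
  \<open>cis (- \<theta>) * z\<close>.\<close>

lemma boundary_point:
  assumes "z \<in> Dc" "z \<notin> D"
  obtains \<theta> where "\<theta> \<in> {0..2 * pi}" "z = \<sigma> \<theta>"
proof -
  obtain \<theta>' where "\<not> cis \<theta>' \<bullet> z < h \<theta>'" using assms(2) by (auto simp: D_def)
  moreover have "cis \<theta>' \<bullet> z \<le> h \<theta>'" using assms(1) by (simp add: Dc_def)
  moreover obtain \<theta> where \<theta>: "\<theta> \<in> {0..2 * pi}" "cis \<theta> = cis \<theta>'" "h \<theta> = h \<theta>'"
    by (rule angle_reduce)
  ultimately have eq: "cis \<theta> \<bullet> z = h \<theta>" by simp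
  have "((\<lambda>x. h x - (cos x * Re z + sin x * Im z)) has_real_derivative
      h1 \<theta> - (cos \<theta> * Im z - sin \<theta> * Re z)) (at \<theta>)"
    by (auto intro!: derivative_eq_intros h)
  moreover have "h \<theta> - (cos \<theta> * Re z + sin \<theta> * Im z) \<le> h y - (cos y * Re z + sin y * Im z)" for y
    using assms(1) eq by (simp add: Dc_def inner_complex_def)
  ultimately have "h1 \<theta> - (cos \<theta> * Im z - sin \<theta> * Re z) = 0"
    by (intro DERIV_local_min[where d = 1 and x = \<theta>]) auto
  then have "cis (- \<theta>) * z = Complex (h \<theta>) (h1 \<theta>)"
    using eq by (simp add: complex_eq_iff inner_complex_def)
  then have "cis \<theta> * (cis (- \<theta>) * z) = \<sigma> \<theta>" by (simp add: \<sigma>_def)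
  then have "z = \<sigma> \<theta>" by (simp add: mult.assoc[symmetric] cis_mult)
  with \<theta>(1) show thesis by (rule that)
qed

lemma \<sigma>_ne: "z \<in> D \<Longrightarrow> \<sigma> \<theta> \<noteq> z"
  using inner_cis_\<sigma>[of \<theta>] by (auto simp: D_def dest: spec[of _ \<theta>])

section \<open>Cauchy's theorem and formula over the curve\<close>

lemma contour_integral_zero:
  assumes "f holomorphic_on U" "convex U" "open U" "Dc \<subseteq> U"
  shows "((\<lambda>\<theta>. f (\<sigma> \<theta>) * wt \<theta>) has_integral 0) {0..2 * pi}"
proof -
  obtain g where g: "\<And>x. x \<in> U \<Longrightarrow> (g has_field_derivative f x) (at x within U)"
    using holomorphic_convex_primitive'[OF assms(2,3,1)] by blast
  have der: "((g \<circ> \<sigma>) has_vector_derivative (2 * pi * \<i> * wt \<theta>) * f (\<sigma> \<theta>)) (at \<theta> within {0..2 * pi})" for \<theta>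
    by (rule field_vector_diff_chain_within[OF \<sigma>_derivative DERIV_subset[OF g]])
       (use \<sigma>_in_Dc assms(4) in auto)
  then have "((\<lambda>\<theta>. (2 * pi * \<i> * wt \<theta>) * f (\<sigma> \<theta>)) has_integral (g \<circ> \<sigma>) (2 * pi) - (g \<circ> \<sigma>) 0) {0..2 * pi}"
    by (intro fundamental_theorem_of_calculus der) simp
  then have "((\<lambda>\<theta>. inverse (2 * pi * \<i>) * ((2 * pi * \<i> * wt \<theta>) * f (\<sigma> \<theta>))) has_integral inverse (2 * pi * \<i>) * 0) {0..2 * pi}"
    using \<sigma>_periodic[of 0] by (intro has_integral_mult_right) simp
  then show ?thesis by (simp add: mult.commute field_simps)
qed

text \<open>No single branch of the logarithm serves \<open>\<sigma> \<theta> - z\<close> along the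
  whole curve. Rotated by \<open>cis (- \<theta>)\<close> this vector stays in the right half plane,
  where \<open>Ln\<close> applies and contributes nothing over a period; the rotation accounts for
  the full \<open>2 * pi * \<i>\<close>.\<close>

lemma winding_integral:
  assumes "z \<in> D"
  shows "((\<lambda>\<theta>. wt \<theta> / (\<sigma> \<theta> - z)) has_integral 1) {0..2 * pi}"
proof -
  define w where "w \<theta> = cis (- \<theta>) * (\<sigma> \<theta> - z)" for \<theta>
  have w: "w \<theta> \<notin> \<real>\<^sub>\<le>\<^sub>0" for \<theta>
  proof -
    have "Re (w \<theta>) > 0"
      unfolding w_def Re_cis_minus_mult using assms inner_cis_\<sigma>[of \<theta>] by (simp add: D_def inner_diff_right)
    then show ?thesis by (auto simp: complex_nonpos_Reals_iff)
  qed
  have cis': "((\<lambda>\<theta>. cis (- \<theta>)) has_vector_derivative - \<i> * cis (- \<theta>)) (at \<theta> within S)" for \<theta> S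
    using has_derivative_cis[of "\<lambda>x. - x" "\<lambda>x. - x" \<theta> S]
    by (auto simp: has_vector_derivative_def intro!: derivative_eq_intros)
  have "(w has_vector_derivative cis (- \<theta>) * (2 * pi * \<i> * wt \<theta>) + (- \<i> * cis (- \<theta>)) * (\<sigma> \<theta> - z)) (at \<theta> within S)" for \<theta> S
    unfolding w_def
    by (intro has_vector_derivative_mult has_vector_derivative_diff_const[THEN iffD2] \<sigma>_derivative cis')
  then have "((Ln \<circ> w) has_vector_derivative
      (cis (- \<theta>) * (2 * pi * \<i> * wt \<theta>) + (- \<i> * cis (- \<theta>)) * (\<sigma> \<theta> - z)) * inverse (w \<theta>)) (at \<theta> within {0..2 * pi})" for \<theta>
    by (rule field_vector_diff_chain_within) (use w in \<open>auto intro!: derivative_eq_intros simp: divide_inverse\<close>)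
  moreover have "(cis (- \<theta>) * (2 * pi * \<i> * wt \<theta>) + (- \<i> * cis (- \<theta>)) * (\<sigma> \<theta> - z)) * inverse (w \<theta>)
      = 2 * pi * \<i> * (wt \<theta> / (\<sigma> \<theta> - z)) - \<i>" for \<theta>
    using \<sigma>_ne[OF assms, of \<theta>] by (simp add: w_def field_simps)
  ultimately have der: "((Ln \<circ> w) has_vector_derivative 2 * pi * \<i> * (wt \<theta> / (\<sigma> \<theta> - z)) - \<i>)
      (at \<theta> within {0..2 * pi})" for \<theta> by simp
  have "((\<lambda>\<theta>. 2 * pi * \<i> * (wt \<theta> / (\<sigma> \<theta> - z)) - \<i>) has_integral (Ln \<circ> w) (2 * pi) - (Ln \<circ> w) 0) {0..2 * pi}"
    by (intro fundamental_theorem_of_calculus der) simp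
  moreover have "w (2 * pi) = w 0"
    using \<sigma>_periodic[of 0] by (simp add: w_def cis.code)
  ultimately have "((\<lambda>\<theta>. 2 * pi * \<i> * (wt \<theta> / (\<sigma> \<theta> - z)) - \<i>) has_integral 0) {0..2 * pi}" by simp
  moreover have "((\<lambda>\<theta>. \<i>) has_integral 2 * pi * \<i>) {0..2 * pi}"
    using has_integral_const_real[of \<i> 0 "2 * pi"] by (simp add: scaleR_conv_of_real)
  ultimately have "((\<lambda>\<theta>. 2 * pi * \<i> * (wt \<theta> / (\<sigma> \<theta> - z)) - \<i> + \<i>) has_integral 0 + 2 * pi * \<i>) {0..2 * pi}"
    by (rule has_integral_add)
  then have "((\<lambda>\<theta>. inverse (2 * pi * \<i>) * (2 * pi * \<i> * (wt \<theta> / (\<sigma> \<theta> - z)))) has_integral inverse (2 * pi * \<i>) * (2 * pi * \<i>)) {0..2 * pi}"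
    by (intro has_integral_mult_right) simp
  then show ?thesis by (simp add: field_simps)
qed

lemma cauchy_formula:
  assumes "f holomorphic_on U" "convex U" "open U" "Dc \<subseteq> U" "z \<in> D"
  shows "((\<lambda>\<theta>. f (\<sigma> \<theta>) * (wt \<theta> / (\<sigma> \<theta> - z))) has_integral f z) {0..2 * pi}"
proof -
  \<comment> \<open>The difference quotient of \<open>f\<close>, with its singularity at
    \<open>z\<close> removed.\<close>
  let ?q = "\<lambda>w. if w = z then deriv f z else (f w - f z) / (w - z)"
  have "?q holomorphic_on U" using assms by (intro pole_lemma_open)
  then have "((\<lambda>\<theta>. ?q (\<sigma> \<theta>) * wt \<theta>) has_integral 0) {0..2 * pi}"
    using assms by (intro contour_integral_zero[of _ U])
  note sum = has_integral_add[OF this has_integral_mult_right[OF winding_integral[OF assms(5)], of "f z"]]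
  have "?q (\<sigma> \<theta>) * wt \<theta> + f z * (wt \<theta> / (\<sigma> \<theta> - z)) = f (\<sigma> \<theta>) * (wt \<theta> / (\<sigma> \<theta> - z))" for \<theta>
    using \<sigma>_ne[OF assms(5), of \<theta>] by (simp add: diff_divide_distrib left_diff_distrib)
  with sum show ?thesis by simp
qed

section \<open>The double layer potential kernel\<close>

lemma \<kappa>_nonneg: "z \<in> Dc \<Longrightarrow> 0 \<le> \<kappa> \<theta> z"
proof -
  assume "z \<in> Dc"
  then have "0 \<le> cis \<theta> \<bullet> (\<sigma> \<theta> - z)" by (simp add: Dc_def inner_diff_right inner_cis_\<sigma>)
  moreover have "wt \<theta> = ((h \<theta> + h2 \<theta>) / (2 * pi)) *\<^sub>R cis \<theta>" by (simp add: wt_def scaleR_conv_of_real)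
  ultimately show ?thesis using curvature_pos[of \<theta>] by (simp add: \<kappa>_def Re_divide_inner)
qed

lemma \<kappa>_integral:
  assumes "z \<in> D"
  shows "((\<lambda>\<theta>. \<kappa> \<theta> z) has_integral 2) {0..2 * pi}"
  using has_integral_mult_right[OF has_integral_Re[OF winding_integral[OF assms]], of 2]
  by (simp add: \<kappa>_def)

lemma of_real_\<kappa>: "of_real (\<kappa> \<theta> z) = wt \<theta> / (\<sigma> \<theta> - z) + cnj (wt \<theta> / (\<sigma> \<theta> - z))"
  by (simp only: \<kappa>_def complex_add_cnj)

text \<open>At a boundary point the kernel is, up to the factor \<open>1 / \<pi>\<close>, the derivative of the angle
  under which the curve is seen, and that angle varies within an interval of length \<open>\<pi>\<close>.\<close>

lemma \<kappa>_boundary: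
  fixes \<theta>0 :: real
  defines "S \<equiv> {\<theta>0<..<\<theta>0 + 2 * pi}"
  shows "(\<lambda>\<theta>. \<kappa> \<theta> (\<sigma> \<theta>0)) integrable_on S" "integral S (\<lambda>\<theta>. \<kappa> \<theta> (\<sigma> \<theta>0)) \<le> 1"
proof -
  let ?k = "\<lambda>\<theta>. \<kappa> \<theta> (\<sigma> \<theta>0)"
  \<comment> \<open>Rotated in this way, the curve seen from \<open>\<sigma> \<theta>0\<close> lies
    in the upper half plane, where \<open>Ln\<close> is differentiable and its imaginary part is
    strictly between 0 and \<open>pi\<close>.\<close>
  define u where "u \<theta> = - \<i> * cis (- \<theta>0) * (\<sigma> \<theta> - \<sigma> \<theta>0)" for \<theta>
  have Im_u: "Im (u \<theta>) > 0" if "\<theta> \<in> S" for \<theta>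
  proof -
    have "Im (u \<theta>) = - Re (cis (- \<theta>0) * (\<sigma> \<theta> - \<sigma> \<theta>0))" by (simp add: u_def)
    then show ?thesis using that inner_cis_\<sigma>_less[of \<theta>0 \<theta>]
      by (simp only: Re_cis_minus_mult) (simp add: S_def inner_diff_right inner_cis_\<sigma>)
  qed
  have int: "(?k has_integral (Im (Ln (u b)) - Im (Ln (u a))) / pi) {a..b}"
    if "{a..b} \<subseteq> S" "a \<le> b" for a b
  proof -
    have "(u has_vector_derivative - \<i> * cis (- \<theta>0) * (2 * pi * \<i> * wt \<theta>)) (at \<theta> within T)" for \<theta> T
      unfolding u_def
      by (intro has_vector_derivative_mult_right has_vector_derivative_diff_const[THEN iffD2] \<sigma>_derivative)
    then have "((Ln \<circ> u) has_vector_derivative (- \<i> * cis (- \<theta>0) * (2 * pi * \<i> * wt \<theta>)) * inverse (u \<theta>))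
        (at \<theta> within {a..b})" if "\<theta> \<in> {a..b}" for \<theta>
      by (rule field_vector_diff_chain_within)
        (use Im_u[of \<theta>] that \<open>{a..b} \<subseteq> S\<close> in
          \<open>auto intro!: derivative_eq_intros simp: complex_nonpos_Reals_iff divide_inverse\<close>)
    moreover have "(- \<i> * cis (- \<theta>0) * (2 * pi * \<i> * wt \<theta>)) * inverse (u \<theta>)
        = \<i> * (of_real (2 * pi) * (wt \<theta> / (\<sigma> \<theta> - \<sigma> \<theta>0)))" for \<theta>
      by (simp add: u_def divide_inverse cis_mult)
    ultimately have "((\<lambda>\<theta>. \<i> * (of_real (2 * pi) * (wt \<theta> / (\<sigma> \<theta> - \<sigma> \<theta>0)))) has_integral Ln (u b) - Ln (u a)) {a..b}"
      using fundamental_theorem_of_calculus[OF that(2), of "Ln \<circ> u"] by simp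
    from has_integral_mult_right[OF has_integral_Im[OF this], of "1 / pi"]
    have "((\<lambda>\<theta>. 1 / pi * Im (\<i> * (of_real (2 * pi) * (wt \<theta> / (\<sigma> \<theta> - \<sigma> \<theta>0))))) has_integral
      1 / pi * Im (Ln (u b) - Ln (u a))) {a..b}" .
    moreover have "1 / pi * Im (\<i> * (of_real (2 * pi) * X)) = 2 * Re X" for X by simp
    ultimately have "((\<lambda>\<theta>. 2 * Re (wt \<theta> / (\<sigma> \<theta> - \<sigma> \<theta>0))) has_integral
      1 / pi * Im (Ln (u b) - Ln (u a))) {a..b}" by (simp only:)
    then show ?thesis unfolding \<kappa>_def by simp
  qed
  \<comment> \<open>At both ends of \<open>S\<close> the curve returns to
    \<open>\<sigma> \<theta>0\<close> and \<open>u\<close> vanishes, so \<open>S\<close> is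
    exhausted by closed intervals. Nonnegativity of the kernel permits monotone convergence.\<close>
  define T where "T n = {\<theta>0 + 1 / real (Suc n)..\<theta>0 + 2 * pi - 1 / real (Suc n)}" for n
  have TS: "T n \<subseteq> S" for n
  proof -
    define e where "e = 1 / real (Suc n)"
    have "e > 0" by (simp add: e_def)
    then show ?thesis unfolding T_def S_def e_def[symmetric] by auto
  qed
  have T: "?k integrable_on T n" "integral (T n) ?k \<le> 1" for n
  proof -
    show "?k integrable_on T n"
      using int[of "\<theta>0 + 1 / real (Suc n)" "\<theta>0 + 2 * pi - 1 / real (Suc n)"] TS[of n]
      by (cases "\<theta>0 + 1 / real (Suc n) \<le> \<theta>0 + 2 * pi - 1 / real (Suc n)") (auto simp: T_def)
    show "integral (T n) ?k \<le> 1"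
    proof (cases "\<theta>0 + 1 / real (Suc n) \<le> \<theta>0 + 2 * pi - 1 / real (Suc n)")
      case True
      let ?a = "\<theta>0 + 1 / real (Suc n)" and ?b = "\<theta>0 + 2 * pi - 1 / real (Suc n)"
      have "Im (u ?a) > 0" "Im (u ?b) > 0" using TS[of n] True by (auto intro!: Im_u simp: T_def)
      then have "0 < Im (Ln (u ?a))" "Im (Ln (u ?b)) < pi"
        using Im_Ln_pos_lt[of "u ?a"] Im_Ln_pos_lt[of "u ?b"] by fastforce+
      then show ?thesis
        using integral_unique[OF int[of ?a ?b]] TS[of n] True by (simp add: T_def)
    qed (simp add: T_def)
  qed
  let ?f = "\<lambda>n \<theta>. if \<theta> \<in> T n then ?k \<theta> else 0"
  have If: "?f n integrable_on S" "integral S (?f n) = integral (T n) ?k" for n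
    using T(1)[of n] TS[of n]
    by (simp_all add: integrable_restrict_Int integral_restrict_Int Int_absorb2)
  have "?k integrable_on S \<and> (\<lambda>n. integral S (?f n)) \<longlonglongrightarrow> integral S ?k"
  proof (rule monotone_convergence_increasing)
    show "?f n \<theta> \<le> ?f (Suc n) \<theta>" for n \<theta>
    proof -
      have "1 / real (Suc (Suc n)) \<le> 1 / real (Suc n)" by (simp add: field_simps)
      then have "T n \<subseteq> T (Suc n)" unfolding T_def by (intro atLeastatMost_subset_iff[THEN iffD2]) auto
      then show ?thesis using \<kappa>_nonneg[OF \<sigma>_in_Dc, of \<theta> \<theta>0] by auto
    qed
    show "(\<lambda>n. ?f n \<theta>) \<longlonglongrightarrow> ?k \<theta>" if "\<theta> \<in> S" for \<theta>
    proof (rule tendsto_eventually)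
      define m where "m = min (\<theta> - \<theta>0) (\<theta>0 + 2 * pi - \<theta>)"
      have "m > 0" using that by (auto simp: m_def S_def)
      then have "eventually (\<lambda>n. 1 / real (Suc n) < m) sequentially"
        using LIMSEQ_inverse_real_of_nat by (auto simp: inverse_eq_divide intro: order_tendstoD)
      then show "eventually (\<lambda>n. ?f n \<theta> = ?k \<theta>) sequentially"
        by eventually_elim (auto simp: T_def m_def)
    qed
    show "bounded (range (\<lambda>n. integral S (?f n)))"
      unfolding If bounded_iff
      using T(2) integral_nonneg[OF T(1)] \<kappa>_nonneg[OF \<sigma>_in_Dc]
      by (intro exI[of _ 1]) auto
  qed (rule If)
  then show "?k integrable_on S" "integral S ?k \<le> 1"
    using T(2) by (auto intro!: LIMSEQ_le_const2 simp: If(2))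
qed

lemma integral_period_shift:
  fixes F :: "real \<Rightarrow> complex"
  assumes per: "\<And>x. F (x + 2 * pi) = F x" and cont: "continuous_on UNIV F" and a: "a \<in> {0..2 * pi}"
  shows "integral {a..a + 2 * pi} F = integral {0..2 * pi} F"
proof -
  have int: "F integrable_on {c..d}" for c d
    by (intro integrable_continuous_real continuous_on_subset[OF cont]) auto
  have "integral {2 * pi..a + 2 * pi} F = integral {0..a} F"
    using integral_shift_real_ivl[of "2 * pi" "2 * pi" "a + 2 * pi" F] by (simp add: per)
  moreover have "integral {a..2 * pi} F + integral {2 * pi..a + 2 * pi} F = integral {a..a + 2 * pi} F"
    by (rule Henstock_Kurzweil_Integration.integral_combine) (use a int in auto)
  moreover have "integral {0..a} F + integral {a..2 * pi} F = integral {0..2 * pi} F"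
    by (rule Henstock_Kurzweil_Integration.integral_combine) (use a int in auto)
  ultimately show ?thesis by (metis add.commute)
qed

section \<open>The Cauchy transform of the conjugate and its bound\<close>

definition "ctransform f z = integral {0..2 * pi} (\<lambda>\<theta>. cnj (f (\<sigma> \<theta>)) * (wt \<theta> / (\<sigma> \<theta> - z)))"

lemma continuous_kernel: "z \<in> D \<Longrightarrow> continuous_on T (\<lambda>\<theta>. wt \<theta> / (\<sigma> \<theta> - z))"
  by (intro continuous_intros continuous_wt continuous_\<sigma>) (use \<sigma>_ne in auto)

lemma continuous_on_f\<sigma>:
  assumes "f holomorphic_on U" "Dc \<subseteq> U"
  shows "continuous_on T (\<lambda>\<theta>. f (\<sigma> \<theta>))"
  by (rule continuous_on_compose2[OF holomorphic_on_imp_continuous_on[OF assms(1)] continuous_\<sigma>])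
     (use \<sigma>_in_Dc assms(2) in auto)

text \<open>The density is arbitrary because the result serves both \<open>ctransform\<close> and
  the entries of the quotient \<open>H\<close> in \<open>calc_companion\<close>.\<close>

lemma cauchy_type_holomorphic:
  assumes \<phi>: "continuous_on UNIV \<phi>"
  shows "(\<lambda>z. integral {0..2 * pi} (\<lambda>\<theta>. \<phi> \<theta> / (\<sigma> \<theta> - z))) holomorphic_on D"
proof -
  have "(\<lambda>z. integral (cbox 0 (2 * pi)) (\<lambda>\<theta>. \<phi> \<theta> / (\<sigma> \<theta> - z))) holomorphic_on D"
  proof (rule leibniz_rule_holomorphic[where fx = "\<lambda>z \<theta>. \<phi> \<theta> / (\<sigma> \<theta> - z)\<^sup>2"])
    show "((\<lambda>z. \<phi> \<theta> / (\<sigma> \<theta> - z)) has_field_derivative \<phi> \<theta> / (\<sigma> \<theta> - z)\<^sup>2) (at z within D)"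
      if "z \<in> D" for z \<theta>
      using \<sigma>_ne[OF that, of \<theta>] by (auto intro!: derivative_eq_intros simp: power2_eq_square)
    show "(\<lambda>\<theta>. \<phi> \<theta> / (\<sigma> \<theta> - z)) integrable_on cbox 0 (2 * pi)" if "z \<in> D" for z
      by (intro integrable_continuous continuous_intros continuous_\<sigma> continuous_on_subset[OF \<phi>])
         (use that \<sigma>_ne in auto)
    show "continuous_on (D \<times> cbox 0 (2 * pi)) (\<lambda>(z, \<theta>). \<phi> \<theta> / (\<sigma> \<theta> - z)\<^sup>2)"
      unfolding split_beta
      by (intro continuous_intros continuous_on_compose2[OF \<phi>]
          continuous_on_compose2[OF continuous_\<sigma>[of UNIV]]) (use \<sigma>_ne in auto)
  qed (rule convex_D)
  then show ?thesis by simp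
qed

lemma ctransform_holomorphic:
  assumes "f holomorphic_on U" "Dc \<subseteq> U"
  shows "ctransform f holomorphic_on D"
  using cauchy_type_holomorphic[of "\<lambda>\<theta>. cnj (f (\<sigma> \<theta>)) * wt \<theta>"]
  by (simp add: ctransform_def[abs_def] continuous_on_mult continuous_on_cnj continuous_wt continuous_on_f\<sigma>[OF assms])

context
  fixes f :: "complex \<Rightarrow> complex" and U :: "complex set" and B :: real
  assumes f: "f holomorphic_on U" "convex U" "open U" "Dc \<subseteq> U"
    and B: "\<And>z. z \<in> Dc \<Longrightarrow> norm (f z) \<le> B"
begin

text \<open>Adding the Cauchy formula completes the conjugated kernel to \<kappa>, and subtracting
  \<open>f z\<close> times its mass 2 leaves a difference of values of \<open>f\<close>. That
  difference cancels the growth of the kernel as \<open>z\<close> approaches the boundary.\<close>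

lemma cnj_ctransform:
  assumes "z \<in> D"
  shows "cnj (ctransform f z) = f z + integral {0..2 * pi} (\<lambda>\<theta>. (f (\<sigma> \<theta>) - f z) * of_real (\<kappa> \<theta> z))"
proof -
  let ?k = "\<lambda>\<theta>. wt \<theta> / (\<sigma> \<theta> - z)"
  have int: "(\<lambda>\<theta>. f (\<sigma> \<theta>) * cnj (?k \<theta>)) integrable_on {0..2 * pi}"
    by (intro integrable_continuous_real continuous_intros continuous_on_f\<sigma>[OF f(1,4)] continuous_on_cnj
        continuous_kernel[OF assms])
  have "cnj (ctransform f z) = integral {0..2 * pi} (\<lambda>\<theta>. f (\<sigma> \<theta>) * cnj (?k \<theta>))"
    unfolding ctransform_def integral_cnj by simp
  then have 1: "((\<lambda>\<theta>. f (\<sigma> \<theta>) * cnj (?k \<theta>)) has_integral cnj (ctransform f z)) {0..2 * pi}"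
    using int by (simp add: has_integral_integral)
  have 2: "((\<lambda>\<theta>. f (\<sigma> \<theta>) * ?k \<theta>) has_integral f z) {0..2 * pi}"
    by (rule cauchy_formula[OF f assms])
  have 3: "((\<lambda>\<theta>. f z * of_real (\<kappa> \<theta> z)) has_integral f z * of_real 2) {0..2 * pi}"
    by (intro has_integral_mult_right has_integral_of_real \<kappa>_integral assms)
  have "((\<lambda>\<theta>. f (\<sigma> \<theta>) * ?k \<theta> + f (\<sigma> \<theta>) * cnj (?k \<theta>) - f z * of_real (\<kappa> \<theta> z))
      has_integral f z + cnj (ctransform f z) - f z * of_real 2) {0..2 * pi}"
    by (intro has_integral_diff has_integral_add 1 2 3)
  moreover have "f (\<sigma> \<theta>) * ?k \<theta> + f (\<sigma> \<theta>) * cnj (?k \<theta>) - f z * of_real (\<kappa> \<theta> z) = (f (\<sigma> \<theta>) - f z) * of_real (\<kappa> \<theta> z)" for \<theta>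
    unfolding of_real_\<kappa> by (simp only: algebra_simps)
  ultimately have "((\<lambda>\<theta>. (f (\<sigma> \<theta>) - f z) * of_real (\<kappa> \<theta> z))
      has_integral cnj (ctransform f z) - f z) {0..2 * pi}" by simp
  then show ?thesis by (simp add: integral_unique)
qed

text \<open>The transform need not be defined by its integral at boundary points; its limits along
  sequences are found by dominated convergence in \<open>cnj_ctransform\<close>.\<close>

lemma ctransform_boundary_limit:
  assumes z: "\<And>n. z n \<in> D" "z \<longlonglongrightarrow> z0" "z0 \<notin> D"
  obtains l where "(\<lambda>n. cnj (ctransform f (z n))) \<longlonglongrightarrow> l" "norm l \<le> B"
proof -
  have zc: "z n \<in> Dc" for n using z(1) D_subset_Dc by auto
  have z0: "z0 \<in> Dc"
    using compact_imp_closed[OF compact_Dc] zc z(2) by (meson closed_sequentially)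
  obtain \<theta>0 where \<theta>0: "\<theta>0 \<in> {0..2 * pi}" "z0 = \<sigma> \<theta>0" using boundary_point[OF z0 z(3)] by blast
  \<comment> \<open>A period that starts at the singular angle: in its interior the kernel at
    \<open>z0\<close> has no singularity.\<close>
  define S where "S = {\<theta>0<..<\<theta>0 + 2 * pi}"
  have ne: "\<sigma> \<theta> \<noteq> z0" if "\<theta> \<in> S" for \<theta>
    using inner_cis_\<sigma>_less[of \<theta>0 \<theta>] that inner_cis_\<sigma>[of \<theta>0] by (auto simp: S_def \<theta>0(2))
  have \<kappa>int: "(\<lambda>\<theta>. \<kappa> \<theta> z0) integrable_on S" and \<kappa>1: "integral S (\<lambda>\<theta>. \<kappa> \<theta> z0) \<le> 1"
    using \<kappa>_boundary[of \<theta>0] by (simp_all add: S_def \<theta>0(2))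
  have \<kappa>0: "0 \<le> integral S (\<lambda>\<theta>. \<kappa> \<theta> z0)" by (intro integral_nonneg \<kappa>int \<kappa>_nonneg z0)
  obtain L where L: "\<And>x. x \<in> Dc \<Longrightarrow> norm (deriv f x) \<le> L"
  proof -
    have "continuous_on Dc (deriv f)"
      using holomorphic_on_imp_continuous_on[OF holomorphic_deriv[OF f(1,3)]] f(4) continuous_on_subset by blast
    then have "bounded (deriv f ` Dc)" using compact_Dc compact_continuous_image compact_imp_bounded by blast
    then show thesis using that by (auto simp: bounded_iff)
  qed
  have lip: "norm (f x - f y) \<le> L * norm (x - y)" if "x \<in> Dc" "y \<in> Dc" for x y
  proof (rule field_differentiable_bound[OF convex_Dc _ L that])
    show "(f has_field_derivative deriv f w) (at w within Dc)" if "w \<in> Dc" for w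
      using f that by (meson DERIV_deriv_iff_field_differentiable has_field_derivative_at_within
          holomorphic_on_imp_differentiable_at subsetD)
  qed
  obtain M where M: "\<And>\<theta>. \<theta> \<in> {\<theta>0..\<theta>0 + 2 * pi} \<Longrightarrow> norm (wt \<theta>) \<le> M"
  proof -
    have "bounded (wt ` {\<theta>0..\<theta>0 + 2 * pi})"
      by (intro compact_imp_bounded compact_continuous_image continuous_wt) auto
    then obtain a where "\<forall>x\<in>{\<theta>0..\<theta>0 + 2 * pi}. norm (wt x) \<le> a" by (auto simp: bounded_iff)
    then show thesis by (intro that[of a]) simp
  qed
  define F where "F n \<theta> = (f (\<sigma> \<theta>) - f (z n)) * of_real (\<kappa> \<theta> (z n))" for n \<theta>
  define F0 where "F0 \<theta> = (f (\<sigma> \<theta>) - f z0) * of_real (\<kappa> \<theta> z0)" for \<theta>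
  have Fcont: "continuous_on T (F n)" for n T
    unfolding F_def \<kappa>_def by (intro continuous_intros continuous_on_f\<sigma>[OF f(1,4)] continuous_kernel z)
  have cn: "cnj (ctransform f (z n)) = f (z n) + integral S (F n)" for n
  proof -
    have "integral {\<theta>0..\<theta>0 + 2 * pi} (F n) = integral {0..2 * pi} (F n)"
      by (rule integral_period_shift[OF _ Fcont \<theta>0(1)]) (simp add: F_def \<kappa>_def \<sigma>_periodic wt_periodic)
    moreover have "integral {\<theta>0..\<theta>0 + 2 * pi} (F n) = integral S (F n)"
      unfolding S_def by (rule integral_open_interval_real)
    moreover have "F n = (\<lambda>\<theta>. (f (\<sigma> \<theta>) - f (z n)) * of_real (\<kappa> \<theta> (z n)))" by (simp add: F_def fun_eq_iff)
    ultimately show ?thesis using cnj_ctransform[OF z(1)[of n]] by simp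
  qed
  \<comment> \<open>The kernel is of the order of the reciprocal distance from \<open>z n\<close> to
    the curve point, and the Lipschitz bound for \<open>f\<close> on the convex set
    \<open>Dc\<close> cancels exactly that. Hence the bound is uniform in \<open>n\<close>.\<close>
  have bd: "norm (F n \<theta>) \<le> 2 * L * M" if "\<theta> \<in> S" for n \<theta>
  proof -
    have wt: "norm (wt \<theta>) \<le> M" using that by (intro M) (auto simp: S_def)
    have nz: "norm (\<sigma> \<theta> - z n) > 0" using \<sigma>_ne[OF z(1)] by simp
    have "0 \<le> L" using L[OF z0] norm_ge_zero order_trans by blast
    have "\<bar>\<kappa> \<theta> (z n)\<bar> \<le> 2 * (norm (wt \<theta>) / norm (\<sigma> \<theta> - z n))"
      unfolding \<kappa>_def using abs_Re_le_cmod[of "wt \<theta> / (\<sigma> \<theta> - z n)"] by (simp add: norm_divide abs_mult)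
    then have "norm (F n \<theta>) \<le> (L * norm (\<sigma> \<theta> - z n)) * (2 * (norm (wt \<theta>) / norm (\<sigma> \<theta> - z n)))"
      unfolding F_def norm_mult norm_of_real
      using \<open>0 \<le> L\<close> by (intro mult_mono lip \<sigma>_in_Dc zc) auto
    also have "\<dots> = 2 * L * norm (wt \<theta>)" using nz by simp
    also have "\<dots> \<le> 2 * L * M" using wt \<open>0 \<le> L\<close> by (intro mult_left_mono) auto
    finally show ?thesis .
  qed
  have fz: "(\<lambda>n. f (z n)) \<longlonglongrightarrow> f z0"
    by (rule continuous_on_tendsto_compose[OF holomorphic_on_imp_continuous_on[OF f(1)] z(2)])
       (use zc z0 f(4) in \<open>auto intro!: always_eventually\<close>)
  have conv: "(\<lambda>n. F n \<theta>) \<longlonglongrightarrow> F0 \<theta>" if "\<theta> \<in> S" for \<theta>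
    unfolding F_def F0_def \<kappa>_def by (intro tendsto_intros fz z(2)) (use ne[OF that] in auto)
  have FS: "F n integrable_on S" for n
    unfolding S_def
    by (intro integrable_on_open_interval_real[THEN iffD2] integrable_continuous_real Fcont)
  have dom: "F0 integrable_on S" "(\<lambda>n. integral S (F n)) \<longlonglongrightarrow> integral S F0"
    using dominated_convergence[of F S "\<lambda>_. 2 * L * M" F0] FS bd conv
    by (auto simp: S_def integrable_on_open_interval_real)
  show thesis
  proof (rule that[of "f z0 + integral S F0"])
    show "(\<lambda>n. cnj (ctransform f (z n))) \<longlonglongrightarrow> f z0 + integral S F0"
      unfolding cn by (intro tendsto_add fz dom)
    let ?m = "integral S (\<lambda>\<theta>. \<kappa> \<theta> z0)"
    have HI: "((\<lambda>\<theta>. f z0 * of_real (\<kappa> \<theta> z0)) has_integral f z0 * of_real ?m) S"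
      by (intro has_integral_mult_right has_integral_of_real integrable_integral \<kappa>int)
    have int\<kappa>: "(\<lambda>\<theta>. f z0 * of_real (\<kappa> \<theta> z0)) integrable_on S"
      by (rule has_integral_integrable[OF HI])
    have F0': "F0 = (\<lambda>\<theta>. f (\<sigma> \<theta>) * of_real (\<kappa> \<theta> z0) - f z0 * of_real (\<kappa> \<theta> z0))"
      by (simp add: F0_def fun_eq_iff left_diff_distrib)
    have intf: "(\<lambda>\<theta>. f (\<sigma> \<theta>) * of_real (\<kappa> \<theta> z0)) integrable_on S"
      using integrable_add[OF dom(1) int\<kappa>] by (simp add: F0')
    define I where "I = integral S (\<lambda>\<theta>. f (\<sigma> \<theta>) * of_real (\<kappa> \<theta> z0))"
    have "integral S F0 = I - f z0 * of_real ?m"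
      unfolding F0' I_def integral_diff[OF intf int\<kappa>] integral_unique[OF HI] ..
    \<comment> \<open>An average of values of \<open>f\<close> on \<open>Dc\<close> with weights
      \<open>1 - ?m\<close> at \<open>z0\<close> and \<open>\<kappa> \<theta> z0\<close> along the
      curve. The total mass is 1, and the first weight is nonnegative because the boundary mass is
      at most 1.\<close>
    then have eq: "f z0 + integral S F0 = f z0 * of_real (1 - ?m) + I"
      by (simp add: right_diff_distrib)
    have n1: "norm (f z0 * of_real (1 - ?m)) \<le> B * (1 - ?m)"
      unfolding norm_mult norm_of_real using \<kappa>1 mult_right_mono[OF B[OF z0], of "1 - ?m"] by simp
    have "norm I \<le> integral S (\<lambda>\<theta>. B * \<kappa> \<theta> z0)"
      unfolding I_def
    proof (rule integral_norm_bound_integral[OF intf])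
      show "(\<lambda>\<theta>. B * \<kappa> \<theta> z0) integrable_on S"
        using has_integral_mult_right[OF integrable_integral[OF \<kappa>int]] by (rule has_integral_integrable)
      show "norm (f (\<sigma> \<theta>) * of_real (\<kappa> \<theta> z0)) \<le> B * \<kappa> \<theta> z0" for \<theta>
        unfolding norm_mult norm_of_real
        using \<kappa>_nonneg[OF z0, of \<theta>] mult_right_mono[OF B[OF \<sigma>_in_Dc], of "\<kappa> \<theta> z0" \<theta>] by simp
    qed
    then have n2: "norm I \<le> B * ?m"
      using integral_unique[OF has_integral_mult_right[OF integrable_integral[OF \<kappa>int], of B]] by simp
    have "norm (f z0 + integral S F0) \<le> B * (1 - ?m) + B * ?m"
      unfolding eq using n1 n2 by (rule order_trans[OF norm_triangle_ineq add_mono])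
    then show "norm (f z0 + integral S F0) \<le> B" by (simp add: right_diff_distrib)
  qed
qed

text \<open>A maximum principle without continuous extension to the boundary. If the bound fails at
  \<open>z\<close>, no sequence in the superlevel set \<open>E\<close> can reach the boundary, so
  \<open>E\<close> is compact and the modulus has a maximum inside \<open>D\<close>. The transform
  is then constant, whence \<open>D = E\<close> is open, closed, bounded and nonempty.\<close>

lemma norm_ctransform_le:
  assumes "z \<in> D"
  shows "norm (ctransform f z) \<le> B"
proof (rule ccontr)
  assume gt: "\<not> norm (ctransform f z) \<le> B"
  define E where "E = {w \<in> D. norm (ctransform f z) \<le> norm (ctransform f w)}"
  have cont: "continuous_on D (ctransform f)" by (rule holomorphic_on_imp_continuous_on[OF ctransform_holomorphic[OF f(1,4)]])
  have lim: "w \<in> D" if x: "\<And>n. x n \<in> E" "x \<longlonglongrightarrow> w" for x w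
  proof (rule ccontr)
    assume "w \<notin> D"
    moreover have "x n \<in> D" for n using x(1) by (simp add: E_def)
    ultimately obtain l where l: "(\<lambda>n. cnj (ctransform f (x n))) \<longlonglongrightarrow> l" "norm l \<le> B"
      using ctransform_boundary_limit x(2) by blast
    have "norm (ctransform f z) \<le> norm l"
      by (rule LIMSEQ_le_const[OF tendsto_norm[OF l(1)]]) (use x(1) in \<open>auto simp: E_def\<close>)
    then show False using l(2) gt by simp
  qed
  have "closed E"
    unfolding closed_sequential_limits
  proof (intro allI impI, elim conjE)
    fix x w assume x: "\<forall>n. x n \<in> E" "x \<longlonglongrightarrow> w"
    then have w: "w \<in> D" using lim by blast
    have "(\<lambda>n. ctransform f (x n)) \<longlonglongrightarrow> ctransform f w"
      by (rule continuous_on_tendsto_compose[OF cont x(2) w]) (use x(1) in \<open>auto simp: E_def\<close>)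
    then have "norm (ctransform f z) \<le> norm (ctransform f w)"
      by (intro LIMSEQ_le_const[OF tendsto_norm]) (use x(1) in \<open>auto simp: E_def\<close>)
    then show "w \<in> E" using w by (simp add: E_def)
  qed
  moreover have "bounded E"
    using D_subset_Dc by (intro bounded_subset[OF compact_imp_bounded[OF compact_Dc]]) (auto simp: E_def)
  ultimately have "compact E" by (simp add: compact_eq_bounded_closed)
  moreover have "z \<in> E" using assms by (simp add: E_def)
  moreover have "continuous_on E (\<lambda>w. norm (ctransform f w))"
    by (intro continuous_on_norm continuous_on_subset[OF cont]) (auto simp: E_def)
  ultimately obtain w where w: "w \<in> E" "\<And>y. y \<in> E \<Longrightarrow> norm (ctransform f y) \<le> norm (ctransform f w)"
    using continuous_attains_sup[of E] by blast
  have "norm (ctransform f y) \<le> norm (ctransform f w)" if "y \<in> D" for y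
    using w that by (cases "y \<in> E") (auto simp: E_def)
  then have "ctransform f constant_on D"
    using maximum_modulus_principle[OF ctransform_holomorphic[OF f(1,4)] open_D convex_connected[OF convex_D] open_D]
      w(1) by (auto simp: E_def)
  then have DE: "D = E" using assms by (auto simp: E_def constant_on_def)
  have "closed D" using \<open>closed E\<close> DE by simp
  then have "D = {} \<or> D = UNIV" using open_D clopen by blast
  then show False using assms compact_imp_bounded[OF compact_Dc] D_subset_Dc not_bounded_UNIV
    by (metis bounded_subset empty_iff)
qed

end

end

section \<open>Functional calculus over the boundary curve\<close>

lemma mat_nth: "mat c $ i $ j = (if i = j then c else 0)"
  by (simp add: mat_def)

lemma scaleR_eq_mat: "r *\<^sub>R X = mat (of_real r) ** (X :: complex^'n^'n)"
  unfolding vec_eq_iff mat_mult_nth vector_scaleR_component by (simp add: scaleR_conv_of_real)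

lemma scaleR_eq_scalar: "r *\<^sub>R x = of_real r *s (x :: complex^'n)"
  unfolding vec_eq_iff vector_scaleR_component vector_smult_component by (simp add: scaleR_conv_of_real)

lemma mat_minus: "mat (- c) = - (mat c :: 'a::comm_ring_1^'n^'n)"
  by (simp add: vec_eq_iff mat_nth)

text \<open>An eigenvalue is the value of the form at a normalised eigenvector.\<close>

lemma invertible_outside_numerical_range:
  assumes "s \<notin> numerical_range X"
  shows "invertible (mat s - X)"
proof (rule invertible_if_inj, rule ccontr)
  fix w assume "(mat s - X) *v w = 0" "w \<noteq> 0"
  then have "X *v w = s *s w"
    by (simp add: matrix_vector_mult_diff_rdistrib mat_vector_mult)
  then have "cinner w (X *v w) = s * of_real ((norm w)\<^sup>2)" by (simp add: cinner_simps cinner_self)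
  then show False using cinner_eq_imp_in_numerical_range[OF \<open>w \<noteq> 0\<close>] assms by blast
qed

lemma invertible_uminus_diff:
  fixes X :: "complex^'n^'n"
  assumes "invertible (mat s - X)"
  shows "invertible (X - mat s)"
proof (rule invertible_if_inj)
  fix x assume "(X - mat s) *v x = 0"
  then have "(mat s - X) *v x = 0" by (simp add: matrix_vector_mult_diff_rdistrib)
  then have "matrix_inv (mat s - X) *v ((mat s - X) *v x) = 0" by simp
  then show "x = 0" by (simp only: matrix_vector_mul_assoc matrix_inv_props[OF assms] matrix_vector_mul_lid)
qed

lemma matrix_inv_commute:
  fixes A B :: "'a::field^'n^'n"
  assumes "invertible A" "A ** B = B ** A"
  shows "matrix_inv A ** B = B ** matrix_inv A"
proof -
  have "matrix_inv A ** B = matrix_inv A ** (B ** (A ** matrix_inv A))"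
    by (simp add: matrix_inv_props[OF assms(1)])
  also have "\<dots> = matrix_inv A ** ((A ** B) ** matrix_inv A)"
    by (simp only: matrix_mul_assoc assms(2))
  also have "\<dots> = (matrix_inv A ** A) ** (B ** matrix_inv A)" by (simp only: matrix_mul_assoc)
  finally show ?thesis by (simp add: matrix_inv_props[OF assms(1)])
qed

lemma matrix_inv_mat: "c \<noteq> 0 \<Longrightarrow> matrix_inv (mat c) = mat (1 / c :: 'a::field)"
  by (rule inverse_of_left(1)) (simp flip: mat_mult)

lemma cinner_cnj: "cnj (cinner x y) = cinner y x"
  by (simp add: cinner_def cnj_sum mult.commute)

lemma bounded_linear_mat: "bounded_linear (mat :: complex \<Rightarrow> complex^'n^'n)"
  unfolding linear_conv_bounded_linear[symmetric]
  by (rule linearI) (simp_all add: vec_eq_iff mat_def)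

lemma norm_mat_mult: "norm (mat c ** A) = norm c * norm (A :: complex^'n^'n)"
proof -
  have "(mat c ** A) $ i = c *s A $ i" for i by (simp add: vec_eq_iff mat_mult_nth)
  then show ?thesis
    by (simp add: norm_vec_def[where 'a = "complex^'n"] norm_vector_scalar L2_set_right_distrib)
qed

lemmas continuous_on_matrix_mult =
  bounded_bilinear.continuous_on[OF bounded_bilinear_matrix_mult]
lemmas continuous_on_mat = bounded_linear.continuous_on[OF bounded_linear_mat]
lemmas bounded_linear_mult_matrix_left =
  bounded_bilinear.bounded_linear_right[OF bounded_bilinear_matrix_mult]
lemmas bounded_linear_mult_matrix_right =
  bounded_bilinear.bounded_linear_left[OF bounded_bilinear_matrix_mult]

lemma bounded_linear_matrix_nth: "bounded_linear (\<lambda>A :: complex^'n^'n. A $ i $ j)"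
  using bounded_linear_compose[OF bounded_linear_vec_nth bounded_linear_vec_nth, of i j] by simp

locale matrix_in_smooth_convex = smooth_convex +
  fixes T :: "complex^'n^'n" and c :: complex
  assumes range_T: "numerical_range T \<subseteq> D" and c: "c \<in> D"
begin

text \<open>The homotopy \<open>Th t\<close> shrinks \<open>T\<close> towards the scalar matrix \<open>c\<close> inside the domain.\<close>

definition "zt t z = of_real (1 - t) * c + of_real t * z"
definition "Th t = mat (of_real (1 - t) * c) + mat (of_real t) ** T"
definition "res t \<theta> = matrix_inv (mat (\<sigma> \<theta>) - Th t)"

lemma Th_0: "Th 0 = mat c" and Th_1: "Th 1 = T"
  by (simp_all add: Th_def mat_zero)

lemma zt_in_D:
  assumes "z \<in> D" "t \<in> {0..1}"
  shows "zt t z \<in> D"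
  using convexD[OF convex_D c assms(1), of "1 - t" t] assms(2)
  by (simp add: zt_def scaleR_conv_of_real)

lemma zt_closed_in_D:
  assumes "z \<in> Dc" "t \<in> {0..<1}"
  shows "zt t z \<in> D"
  unfolding D_def
proof (intro CollectI allI)
  fix \<theta>
  have "zt t z = (1 - t) *\<^sub>R c + t *\<^sub>R z" by (simp add: zt_def scaleR_conv_of_real)
  then have "cis \<theta> \<bullet> zt t z = (1 - t) * (cis \<theta> \<bullet> c) + t * (cis \<theta> \<bullet> z)"
    by (simp add: inner_add_right)
  also have "\<dots> < (1 - t) * h \<theta> + t * h \<theta>"
    using assms c by (intro add_less_le_mono mult_strict_left_mono mult_left_mono) (auto simp: D_def Dc_def)
  finally show "cis \<theta> \<bullet> zt t z < h \<theta>" by (simp add: algebra_simps)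
qed

lemma range_Th: "t \<in> {0..1} \<Longrightarrow> numerical_range (Th t) \<subseteq> D"
proof
  fix z assume t: "t \<in> {0..1}" and "z \<in> numerical_range (Th t)"
  then obtain v where v: "norm v = 1" "z = cinner v (Th t *v v)"
    by (auto simp: numerical_range_cinner)
  have "cinner v (Th t *v v) = zt t (cinner v (T *v v))"
    using v(1) by (simp add: Th_def zt_def matrix_vector_mult_add_rdistrib cinner_simps mat_vector_mult
        cinner_self flip: matrix_vector_mul_assoc)
  moreover have "cinner v (T *v v) \<in> D" using range_T v(1) by (auto simp: numerical_range_cinner)
  ultimately show "z \<in> D" using zt_in_D[OF _ t] v(2) by simp
qed

lemma invertible_Th: "t \<in> {0..1} \<Longrightarrow> invertible (mat (\<sigma> \<theta>) - Th t)"
  using range_Th[of t] \<sigma>_ne by (intro invertible_outside_numerical_range) blast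

section \<open>Resolvent integrals over the curve\<close>

lemma continuous_Th: "continuous_on S Th"
  unfolding Th_def by (intro continuous_intros continuous_on_mat continuous_on_matrix_mult)

lemma continuous_res: "continuous_on ({0..1} \<times> S) (\<lambda>p. res (fst p) (snd p))"
  unfolding res_def
  by (intro continuous_on_matrix_inv continuous_intros continuous_on_mat
      continuous_on_compose2[OF continuous_Th[of UNIV]]
      continuous_on_compose2[OF continuous_\<sigma>[of UNIV]]) (auto intro: invertible_Th)

lemma continuous_res_fixed: "t \<in> {0..1} \<Longrightarrow> continuous_on S (res t)"
proof -
  assume "t \<in> {0..1}"
  then have "continuous_on S (\<lambda>\<theta>. res (fst (t, \<theta>)) (snd (t, \<theta>)))"
    by (intro continuous_on_compose2[OF continuous_res[of S]] continuous_intros) auto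
  then show ?thesis by simp
qed

lemma res_commute:
  assumes "t \<in> {0..1}" "B ** T = T ** B"
  shows "res t \<theta> ** B = B ** res t \<theta>"
  unfolding res_def
proof (rule matrix_inv_commute[OF invertible_Th[OF assms(1)]])
  have "mat (of_real t) ** T ** B = B ** (mat (of_real t) ** T)"
    by (simp add: mat_mult_mult assms(2) flip: matrix_mul_assoc)
  then show "(mat (\<sigma> \<theta>) - Th t) ** B = B ** (mat (\<sigma> \<theta>) - Th t)"
    by (simp add: matrix_ring Th_def mat_commute[of B])
qed

text \<open>Up to the factor \<open>- 2 * pi * \<i>\<close> the integrand is the derivative of the
  resolvent along a closed curve.\<close>

lemma integral_res_square:
  assumes t: "t \<in> {0..1}"
  shows "((\<lambda>\<theta>. mat (wt \<theta>) ** (res t \<theta> ** res t \<theta>)) has_integral 0) {0..2 * pi}"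
proof -
  have X: "((\<lambda>\<theta>. mat (\<sigma> \<theta>) - Th t) has_vector_derivative mat (2 * pi * \<i> * wt \<theta>)) (at \<theta> within S)" for \<theta> S
    by (intro has_vector_derivative_diff_const[THEN iffD2]
        bounded_linear.has_vector_derivative[OF bounded_linear_mat] \<sigma>_derivative)
  have "(res t has_vector_derivative - (res t \<theta> ** mat (2 * pi * \<i> * wt \<theta>) ** res t \<theta>)) (at \<theta> within {0..2 * pi})"
    if "\<theta> \<in> {0..2 * pi}" for \<theta>
    unfolding res_def
    by (rule has_vector_derivative_matrix_inv[OF X that])
       (auto intro!: invertible_Th t continuous_intros continuous_on_mat continuous_\<sigma>)
  then have "((\<lambda>\<theta>. - (res t \<theta> ** mat (2 * pi * \<i> * wt \<theta>) ** res t \<theta>)) has_integral res t (2 * pi) - res t 0) {0..2 * pi}"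
    by (intro fundamental_theorem_of_calculus) auto
  moreover have "res t (2 * pi) = res t 0" using \<sigma>_periodic[of 0] by (simp add: res_def)
  moreover have "- (res t \<theta> ** mat (2 * pi * \<i> * wt \<theta>) ** res t \<theta>)
      = mat (- (2 * pi * \<i>)) ** (mat (wt \<theta>) ** (res t \<theta> ** res t \<theta>))" for \<theta>
  proof -
    have "mat (- (2 * pi * \<i>)) ** (mat (wt \<theta>) ** (res t \<theta> ** res t \<theta>))
        = mat (- (2 * pi * \<i> * wt \<theta>)) ** (res t \<theta> ** res t \<theta>)"
      by (simp add: matrix_mul_assoc flip: mat_mult)
    also have "\<dots> = - (mat (2 * pi * \<i> * wt \<theta>) ** res t \<theta> ** res t \<theta>)"
      by (simp add: vec_eq_iff mat_mult_nth flip: matrix_mul_assoc)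
    finally show ?thesis by (simp add: mat_commute[of "res t \<theta>"])
  qed
  ultimately have "((\<lambda>\<theta>. mat (- (2 * pi * \<i>)) ** (mat (wt \<theta>) ** (res t \<theta> ** res t \<theta>))) has_integral 0) {0..2 * pi}"
    by simp
  from has_integral_linear[OF this bounded_linear_mult_matrix_left[of "mat (1 / (- (2 * pi * \<i>)))"]]
  show ?thesis by (simp add: o_def matrix_mul_assoc flip: mat_mult)
qed

text \<open>Along the homotopy the integral has derivative \<open>(T - mat c)\<close> times the
  integral of \<open>integral_res_square\<close>, which is 0. At its start the matrix is scalar and
  the claim is \<open>winding_integral\<close>.\<close>

lemma integral_res: "((\<lambda>\<theta>. mat (wt \<theta>) ** res 1 \<theta>) has_integral mat 1) {0..2 * pi}"
proof -
  define J where "J t = integral (cbox 0 (2 * pi)) (\<lambda>\<theta>. mat (wt \<theta>) ** res t \<theta>)" for t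
  let ?B = "T - mat c"
  have BT: "?B ** T = T ** ?B" by (simp add: matrix_ring mat_commute)
  have cont: "continuous_on S (\<lambda>\<theta>. mat (wt \<theta>) ** res t \<theta>)" if "t \<in> {0..1}" for t S
    by (intro continuous_on_matrix_mult continuous_on_mat continuous_wt continuous_res_fixed that)
  have der: "(J has_vector_derivative 0) (at t within {0..1})" if t: "t \<in> {0..1}" for t
  proof -
    have "(J has_vector_derivative
        integral (cbox 0 (2 * pi)) (\<lambda>\<theta>. mat (wt \<theta>) ** (res t \<theta> ** ?B ** res t \<theta>))) (at t within {0..1})"
      unfolding J_def
    proof (rule leibniz_rule_vector_derivative[OF _ _ _ t])
      fix s \<theta> assume s: "s \<in> {0..1::real}"
      have "Th = (\<lambda>t. mat c + t *\<^sub>R ?B)"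
        by (simp add: Th_def fun_eq_iff scaleR_eq_mat matrix_ring left_diff_distrib mat_diff mat_mult)
      then have "((\<lambda>t. mat (\<sigma> \<theta>) - Th t) has_vector_derivative - ?B) (at s within {0..1})"
        by (auto intro!: derivative_eq_intros)
      moreover have "continuous_on {0..1} (\<lambda>t. mat (\<sigma> \<theta>) - Th t)"
        by (intro continuous_intros continuous_Th)
      ultimately have "((\<lambda>t. res t \<theta>) has_vector_derivative - (res s \<theta> ** (- ?B) ** res s \<theta>)) (at s within {0..1})"
        unfolding res_def by (intro has_vector_derivative_matrix_inv[OF _ s invertible_Th])
      moreover have "- (res s \<theta> ** (- ?B) ** res s \<theta>) = res s \<theta> ** ?B ** res s \<theta>"
        by (simp add: matrix_ring)
      ultimately show "((\<lambda>t. mat (wt \<theta>) ** res t \<theta>) has_vector_derivative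
          mat (wt \<theta>) ** (res s \<theta> ** ?B ** res s \<theta>)) (at s within {0..1})"
        using bounded_linear.has_vector_derivative[OF bounded_linear_mult_matrix_left] by fastforce
      show "(\<lambda>\<theta>. mat (wt \<theta>) ** res s \<theta>) integrable_on cbox 0 (2 * pi)"
        by (intro integrable_continuous cont s)
    next
      show "continuous_on ({0..1} \<times> cbox 0 (2 * pi)) (\<lambda>(t, \<theta>). mat (wt \<theta>) ** (res t \<theta> ** ?B ** res t \<theta>))"
        unfolding split_beta
        by (intro continuous_on_matrix_mult continuous_on_mat continuous_res continuous_on_const
            continuous_on_compose2[OF continuous_wt[of UNIV]] continuous_on_snd continuous_on_id) auto
    qed auto
    moreover have "((\<lambda>\<theta>. mat (wt \<theta>) ** (res t \<theta> ** ?B ** res t \<theta>)) has_integral 0) {0..2 * pi}"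
    proof -
      have "mat (wt \<theta>) ** (res t \<theta> ** ?B ** res t \<theta>) = ?B ** (mat (wt \<theta>) ** (res t \<theta> ** res t \<theta>))" for \<theta>
        by (simp add: res_commute[OF t BT] mat_mult_mult flip: matrix_mul_assoc)
      then show ?thesis
        using has_integral_linear[OF integral_res_square[OF t] bounded_linear_mult_matrix_left[of ?B]]
        by (simp add: o_def)
    qed
    ultimately show ?thesis by (simp add: integral_unique)
  qed
  have "J 1 = J 0"
    using fundamental_theorem_of_calculus[of 0 1 J "\<lambda>_. 0"] der by simp
  also have "J 0 = integral (cbox 0 (2 * pi)) (\<lambda>\<theta>. mat (wt \<theta> / (\<sigma> \<theta> - c)))"
  proof -
    have "res 0 \<theta> = mat (1 / (\<sigma> \<theta> - c))" for \<theta>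
      using \<sigma>_ne[OF c, of \<theta>] by (simp add: res_def Th_0 matrix_inv_mat flip: mat_diff)
    then show ?thesis by (simp add: J_def flip: mat_mult)
  qed
  also have "\<dots> = mat 1"
    using integral_unique[OF has_integral_linear[OF winding_integral[OF c] bounded_linear_mat]]
    by (simp add: o_def)
  finally show ?thesis
    using integrable_integral[OF integrable_continuous[OF cont[of 1 "cbox 0 (2 * pi)"]]] by (simp add: J_def)
qed

text \<open>\<open>calc f F\<close> states that \<open>F = f(T)\<close>: the matrix function \<open>f(z) I - F\<close> is divisible by
  \<open>z I - T\<close> near the closed domain.\<close>

definition calc :: "(complex \<Rightarrow> complex) \<Rightarrow> complex^'n^'n \<Rightarrow> bool" where
  "calc f F \<longleftrightarrow> F ** T = T ** F \<and> (\<exists>U H. open U \<and> convex U \<and> Dc \<subseteq> U \<and> f holomorphic_on U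
    \<and> (\<forall>i j. (\<lambda>z. H z $ i $ j) holomorphic_on U) \<and> (\<forall>z\<in>U. mat (f z) - F = (mat z - T) ** H z))"

section \<open>Closure properties of the functional calculus\<close>

lemma calcI:
  assumes "F ** T = T ** F" "open U" "convex U" "Dc \<subseteq> U" "f holomorphic_on U"
    "\<And>i j. (\<lambda>z. H z $ i $ j) holomorphic_on U" "\<And>z. z \<in> U \<Longrightarrow> mat (f z) - F = (mat z - T) ** H z"
  shows "calc f F"
  using assms unfolding calc_def by blast

lemma calcE:
  assumes "calc f F"
  obtains U H where "F ** T = T ** F" "open U" "convex U" "Dc \<subseteq> U" "f holomorphic_on U"
    "\<forall>i j. (\<lambda>z. H z $ i $ j) holomorphic_on U" "\<forall>z\<in>U. mat (f z) - F = (mat z - T) ** H z"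
  using assms unfolding calc_def by blast

lemma calc_const: "calc (\<lambda>_. a) (mat a)"
  by (rule calcI[where U = UNIV and H = "\<lambda>_. 0"]) (auto simp: mat_commute)

lemma calc_id: "calc (\<lambda>z. z) T"
  by (rule calcI[where U = UNIV and H = "\<lambda>_. mat 1"]) auto

lemma calc_add:
  assumes "calc f F" "calc g G"
  shows "calc (\<lambda>z. f z + g z) (F + G)"
proof -
  obtain U H where U: "F ** T = T ** F" "open U" "convex U" "Dc \<subseteq> U" "f holomorphic_on U"
    "\<forall>i j. (\<lambda>z. H z $ i $ j) holomorphic_on U" "\<forall>z\<in>U. mat (f z) - F = (mat z - T) ** H z"
    using assms(1) by (rule calcE)
  obtain V K where V: "G ** T = T ** G" "open V" "convex V" "Dc \<subseteq> V" "g holomorphic_on V"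
    "\<forall>i j. (\<lambda>z. K z $ i $ j) holomorphic_on V" "\<forall>z\<in>V. mat (g z) - G = (mat z - T) ** K z"
    using assms(2) by (rule calcE)
  show ?thesis
  proof (rule calcI[where U = "U \<inter> V" and H = "\<lambda>z. H z + K z"])
    show "(F + G) ** T = T ** (F + G)" using U(1) V(1) by (simp add: matrix_ring)
    show "mat (f z + g z) - (F + G) = (mat z - T) ** (H z + K z)" if "z \<in> U \<inter> V" for z
    proof -
      have "mat (f z + g z) - (F + G) = (mat (f z) - F) + (mat (g z) - G)" by (simp add: mat_add)
      also have "\<dots> = (mat z - T) ** (H z + K z)" using that U(7) V(7) by (simp add: matrix_add_ldistrib)
      finally show ?thesis .
    qed
    show "(\<lambda>z. (H z + K z) $ i $ j) holomorphic_on U \<inter> V" for i j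
      unfolding vector_add_component
      by (rule holomorphic_on_add[OF holomorphic_on_subset[OF U(6)[rule_format] Int_lower1]
            holomorphic_on_subset[OF V(6)[rule_format] Int_lower2]])
    show "(\<lambda>z. f z + g z) holomorphic_on U \<inter> V"
      using U(5) V(5) by (intro holomorphic_on_add) (auto elim: holomorphic_on_subset)
  qed (use U(2-4) V(2-4) in \<open>auto intro: convex_Int\<close>)
qed

lemma calc_mult:
  assumes "calc f F" "calc g G"
  shows "calc (\<lambda>z. f z * g z) (F ** G)"
proof -
  obtain U H where U: "F ** T = T ** F" "open U" "convex U" "Dc \<subseteq> U" "f holomorphic_on U"
    "\<forall>i j. (\<lambda>z. H z $ i $ j) holomorphic_on U" "\<forall>z\<in>U. mat (f z) - F = (mat z - T) ** H z"
    using assms(1) by (rule calcE)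
  obtain V K where V: "G ** T = T ** G" "open V" "convex V" "Dc \<subseteq> V" "g holomorphic_on V"
    "\<forall>i j. (\<lambda>z. K z $ i $ j) holomorphic_on V" "\<forall>z\<in>V. mat (g z) - G = (mat z - T) ** K z"
    using assms(2) by (rule calcE)
  show ?thesis
  proof (rule calcI[where U = "U \<inter> V" and H = "\<lambda>z. mat (g z) ** H z + F ** K z"])
    have "F ** G ** T = F ** (T ** G)" by (simp only: V(1) flip: matrix_mul_assoc)
    also have "\<dots> = T ** (F ** G)" by (simp only: matrix_mul_assoc U(1))
    finally show "F ** G ** T = T ** (F ** G)" .
    show "mat (f z * g z) - F ** G = (mat z - T) ** (mat (g z) ** H z + F ** K z)" if "z \<in> U \<inter> V" for z
    proof -
      have "F ** (mat z - T) = (mat z - T) ** F" using U(1) by (simp add: matrix_ring mat_commute)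
      then have F: "F ** ((mat z - T) ** K z) = (mat z - T) ** (F ** K z)" by (simp add: matrix_mul_assoc)
      have "mat (f z * g z) - F ** G = mat (g z) ** (mat (f z) - F) + F ** (mat (g z) - G)"
        by (simp add: matrix_ring mat_commute[of F] flip: mat_mult) (simp add: mult.commute)
      also have "\<dots> = (mat z - T) ** (mat (g z) ** H z + F ** K z)"
        using that U(7) V(7) by (simp add: matrix_add_ldistrib F mat_mult_mult)
      finally show ?thesis .
    qed
    show "(\<lambda>z. (mat (g z) ** H z + F ** K z) $ i $ j) holomorphic_on U \<inter> V" for i j
    proof -
      have "H' holomorphic_on U \<inter> V" if "H' holomorphic_on U \<or> H' holomorphic_on V" for H'
        using that by (auto elim: holomorphic_on_subset)
      then have "(\<lambda>z. g z * H z $ i $ j + (\<Sum>k\<in>UNIV. F $ i $ k * K z $ k $ j)) holomorphic_on U \<inter> V"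
        by (intro holomorphic_intros) (use U(6) V(5,6) in auto)
      then show ?thesis unfolding vector_add_component mat_mult_nth by (simp add: matrix_matrix_mult_def)
    qed
    show "(\<lambda>z. f z * g z) holomorphic_on U \<inter> V"
      using U(5) V(5) by (intro holomorphic_on_mult) (auto elim: holomorphic_on_subset)
  qed (use U(2-4) V(2-4) in \<open>auto intro: convex_Int\<close>)
qed

lemma calc_cong:
  assumes "calc f F" "\<And>z. f z = g z"
  shows "calc g F"
  using assms by (metis ext)

lemma calc_inverse_linear:
  assumes "open U" "convex U" "Dc \<subseteq> U" "a \<notin> U"
  shows "calc (\<lambda>z. 1 / (z - a)) (matrix_inv (T - mat a))"
proof (rule calcI[OF _ assms(1-3), where H = "\<lambda>z. mat (- 1 / (z - a)) ** matrix_inv (T - mat a)"])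
  have "a \<notin> numerical_range T" using assms(3,4) range_T D_subset_Dc by blast
  then have inv: "invertible (T - mat a)"
    by (intro invertible_uminus_diff invertible_outside_numerical_range)
  show "matrix_inv (T - mat a) ** T = T ** matrix_inv (T - mat a)"
    by (rule matrix_inv_commute[OF inv]) (simp add: matrix_ring mat_commute)
  have ne: "z - a \<noteq> 0" if "z \<in> U" for z using assms(4) that by auto
  show "(\<lambda>z. 1 / (z - a)) holomorphic_on U"
    using ne by (intro holomorphic_intros) auto
  show "(\<lambda>z. (mat (- 1 / (z - a)) ** matrix_inv (T - mat a)) $ i $ j) holomorphic_on U" for i j
    unfolding mat_mult_nth using ne by (intro holomorphic_intros) auto
  show "mat (1 / (z - a)) - matrix_inv (T - mat a) = (mat z - T) ** (mat (- 1 / (z - a)) ** matrix_inv (T - mat a))"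
    if "z \<in> U" for z
  proof -
    let ?I = "matrix_inv (T - mat a)"
    have "mat z - T = mat (z - a) - (T - mat a)" by (simp add: mat_diff)
    then have "(mat z - T) ** ?I = mat (z - a) ** ?I - mat 1"
      by (simp only: matrix_mult_diff_left[of "mat (z - a)"] matrix_inv_props[OF inv])
    then have "(mat z - T) ** (mat (- 1 / (z - a)) ** ?I) = mat (- 1 / (z - a)) ** (mat (z - a) ** ?I - mat 1)"
      by (simp only: mat_mult_mult)
    also have "\<dots> = mat (- 1 / (z - a) * (z - a)) ** ?I - mat (- 1 / (z - a))"
      by (simp only: matrix_mult_diff_right mat_mult matrix_mul_assoc matrix_mul_rid)
    also have "- 1 / (z - a) * (z - a) = - 1" using ne[OF that] by simp
    finally show ?thesis by (simp add: mat_minus matrix_mult_minus_left)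
  qed
qed

text \<open>Multiplying the divisibility relation by the resolvent splits the integrand into
  \<open>wt \<theta>\<close> times \<open>H (\<sigma> \<theta>)\<close>, which integrates to 0
  entrywise by Cauchy's theorem, and \<open>F\<close> times the integrand of
  \<open>integral_res\<close>.\<close>

lemma calc_cauchy:
  assumes "calc f F"
  shows "((\<lambda>\<theta>. mat (f (\<sigma> \<theta>)) ** (mat (wt \<theta>) ** res 1 \<theta>)) has_integral F) {0..2 * pi}"
proof -
  obtain U H where U: "F ** T = T ** F" "open U" "convex U" "Dc \<subseteq> U" "f holomorphic_on U"
    "\<forall>i j. (\<lambda>z. H z $ i $ j) holomorphic_on U" "\<forall>z\<in>U. mat (f z) - F = (mat z - T) ** H z"
    using assms by (rule calcE)
  have eq: "mat (f (\<sigma> \<theta>)) ** (mat (wt \<theta>) ** res 1 \<theta>) = mat (wt \<theta>) ** H (\<sigma> \<theta>) + F ** (mat (wt \<theta>) ** res 1 \<theta>)" for \<theta>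
  proof -
    have inv: "invertible (mat (\<sigma> \<theta>) - T)" using invertible_Th[of 1 \<theta>] by (simp add: Th_1)
    have "mat (f (\<sigma> \<theta>)) - F = (mat (\<sigma> \<theta>) - T) ** H (\<sigma> \<theta>)"
      using U(4,7) \<sigma>_in_Dc by blast
    then have "res 1 \<theta> ** (mat (f (\<sigma> \<theta>)) - F) = (res 1 \<theta> ** (mat (\<sigma> \<theta>) - T)) ** H (\<sigma> \<theta>)"
      by (simp only: matrix_mul_assoc)
    then have "H (\<sigma> \<theta>) = res 1 \<theta> ** (mat (f (\<sigma> \<theta>)) - F)"
      by (simp add: res_def Th_1 matrix_inv_props(1)[OF inv])
    also have "\<dots> = mat (f (\<sigma> \<theta>)) ** res 1 \<theta> - F ** res 1 \<theta>"
      using res_commute[of 1 F] U(1) by (simp add: matrix_ring mat_commute)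
    finally have "mat (f (\<sigma> \<theta>)) ** res 1 \<theta> = H (\<sigma> \<theta>) + F ** res 1 \<theta>" by simp
    then show ?thesis by (simp add: mat_mult_mult matrix_add_ldistrib)
  qed
  have "((\<lambda>\<theta>. mat (wt \<theta>) ** H (\<sigma> \<theta>)) has_integral 0) {0..2 * pi}"
  proof -
    have ij: "((\<lambda>\<theta>. (mat (wt \<theta>) ** H (\<sigma> \<theta>)) $ i $ j) has_integral 0) {0..2 * pi}" for i j
      using contour_integral_zero[OF U(6)[rule_format] U(3,2,4), of i j] by (simp add: mat_mult_nth mult.commute)
    have "continuous_on {0..2 * pi} (\<lambda>\<theta>. \<chi> i j. wt \<theta> * H (\<sigma> \<theta>) $ i $ j)"
      by (intro continuous_on_vec_lambda continuous_on_mult continuous_wt continuous_on_f\<sigma>[OF U(6)[rule_format] U(4)])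
    moreover have "(\<chi> i j. wt \<theta> * H (\<sigma> \<theta>) $ i $ j) = mat (wt \<theta>) ** H (\<sigma> \<theta>)" for \<theta>
      by (simp add: vec_eq_iff mat_mult_nth)
    ultimately have "continuous_on {0..2 * pi} (\<lambda>\<theta>. mat (wt \<theta>) ** H (\<sigma> \<theta>))" by simp
    from integrable_integral[OF integrable_continuous_real[OF this]]
    obtain I where I: "((\<lambda>\<theta>. mat (wt \<theta>) ** H (\<sigma> \<theta>)) has_integral I) {0..2 * pi}" ..
    have "I $ i $ j = 0" for i j
      using has_integral_unique[OF has_integral_linear[OF I bounded_linear_matrix_nth[of i j], unfolded o_def] ij] .
    then have "I = 0" by (simp add: vec_eq_iff)
    then show ?thesis using I by simp
  qed
  from has_integral_add[OF this has_integral_linear[OF integral_res bounded_linear_mult_matrix_left[of F]]]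
  show ?thesis by (simp add: eq o_def)
qed

text \<open>With \<open>w\<close> the resolvent applied to \<open>v\<close>, the form
  \<open>cinner w v\<close> is \<open>|w|^2 * (\<sigma> \<theta> - \<zeta>)\<close> for a point
  \<zeta> of the numerical range. So the sign is that of
  \<open>h \<theta> - cis \<theta> \<bullet> \<zeta>\<close>: convexity at the level of
  operators.\<close>

lemma double_layer_nonneg: "0 \<le> v \<bullet> ((mat (wt \<theta>) ** res 1 \<theta>) *v v)"
proof -
  define w where "w = res 1 \<theta> *v v"
  have v: "v = \<sigma> \<theta> *s w - T *v w"
  proof -
    have "v = (mat (\<sigma> \<theta>) - T) *v w"
      using matrix_inv_props(2)[OF invertible_Th[of 1 \<theta>]]
      by (simp add: w_def res_def Th_1 matrix_vector_mul_assoc)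
    then show ?thesis by (simp add: matrix_vector_mult_diff_rdistrib mat_vector_mult)
  qed
  have wt: "wt \<theta> = ((h \<theta> + h2 \<theta>) / (2 * pi)) *\<^sub>R cis \<theta>" by (simp add: wt_def scaleR_conv_of_real)
  have "v \<bullet> ((mat (wt \<theta>) ** res 1 \<theta>) *v v) = Re (wt \<theta> * cinner v w)"
    by (simp only: inner_eq_Re_cinner matrix_vector_mul_assoc[symmetric] mat_vector_mult cinner_simps w_def)
  also have "cinner v w = cnj (cinner w v)" by (simp add: cinner_cnj)
  also have "Re (wt \<theta> * cnj (cinner w v)) = wt \<theta> \<bullet> cinner w v" by (simp add: inner_complex_def)
  also have "\<dots> = (h \<theta> + h2 \<theta>) / (2 * pi) * (cis \<theta> \<bullet> cinner w v)" by (simp add: wt)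
  finally have eq: "v \<bullet> ((mat (wt \<theta>) ** res 1 \<theta>) *v v) = (h \<theta> + h2 \<theta>) / (2 * pi) * (cis \<theta> \<bullet> cinner w v)" .
  have "0 \<le> cis \<theta> \<bullet> cinner w v"
  proof (cases "w = 0")
    case False
    define \<zeta> where "\<zeta> = cinner w (T *v w) / of_real ((norm w)\<^sup>2)"
    have "\<zeta> \<in> D" using cinner_in_numerical_range[OF False, of T] range_T by (auto simp: \<zeta>_def)
    then have le: "cis \<theta> \<bullet> \<zeta> \<le> h \<theta>" by (auto simp: D_def less_imp_le)
    have "v = \<sigma> \<theta> *s w + (-1) *s (T *v w)" using v by (simp add: vec_eq_iff)
    then have "cinner w v = \<sigma> \<theta> * of_real ((norm w)\<^sup>2) - cinner w (T *v w)"
      by (simp only: cinner_simps cinner_self) simp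
    also have "\<dots> = ((norm w)\<^sup>2) *\<^sub>R (\<sigma> \<theta> - \<zeta>)"
      using False by (simp add: \<zeta>_def scaleR_conv_of_real algebra_simps)
    finally show ?thesis using le by (simp add: inner_diff_right inner_cis_\<sigma>)
  qed (simp add: cinner_def)
  then show ?thesis unfolding eq using curvature_pos[of \<theta>] by simp
qed

text \<open>The operator analogue of \<kappa>: twice the real part becomes the sum with the
  conjugate transpose.\<close>

definition "P \<theta> = mat (wt \<theta>) ** res 1 \<theta> + ctrans (mat (wt \<theta>) ** res 1 \<theta>)"

lemma continuous_P: "continuous_on S P"
  unfolding P_def
  by (intro continuous_on_add bounded_linear.continuous_on[OF bounded_linear_ctrans]
      continuous_on_matrix_mult continuous_on_mat continuous_wt continuous_res_fixed) auto

lemma P_nonneg: "0 \<le> v \<bullet> (P \<theta> *v v)"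
proof -
  let ?K = "mat (wt \<theta>) ** res 1 \<theta>"
  have "v \<bullet> (ctrans ?K *v v) = v \<bullet> (?K *v v)"
    using inner_ctrans[of ?K v v] by (simp only: inner_commute)
  then show ?thesis
    using double_layer_nonneg[of v \<theta>] by (simp add: P_def matrix_vector_mult_add_rdistrib inner_add_right)
qed

lemma P_symmetric: "x \<bullet> (P \<theta> *v y) = y \<bullet> (P \<theta> *v x)"
proof -
  have "ctrans (P \<theta>) = P \<theta>" by (simp add: P_def ctrans_simps add.commute)
  then show ?thesis using inner_ctrans[of "P \<theta>" x y] by (simp add: inner_commute)
qed

lemma integral_P: "(P has_integral mat 2) {0..2 * pi}"
proof -
  have "(P has_integral mat 1 + ctrans (mat 1)) {0..2 * pi}"
    unfolding P_def[abs_def]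
    using has_integral_add[OF integral_res has_integral_linear[OF integral_res bounded_linear_ctrans]]
    by (simp add: o_def)
  then show ?thesis by (simp add: ctrans_simps flip: mat_add)
qed

lemma inner_scalar_scalar:
  fixes x y :: "complex^'m"
  assumes "norm a = 1"
  shows "(a *s x) \<bullet> (a *s y) = x \<bullet> y"
proof -
  have "cnj a * a = 1" using complex_norm_square[of a] assms by (simp add: mult.commute)
  moreover have "cinner (a *s x) (a *s y) = (cnj a * a) * cinner x y" by (simp add: cinner_simps)
  ultimately show ?thesis by (simp add: inner_eq_Re_cinner)
qed

text \<open>Cauchy-Schwarz for a semidefinite form, in the additive version that survives
  integration. It results from expanding the form at \<open>y - b *s x\<close>, where the unimodular
  \<open>b\<close> absorbs the phase of \<open>a\<close>.\<close>

lemma P_form_bound: "\<bar>y \<bullet> ((mat a ** P \<theta>) *v x)\<bar> \<le> norm a * ((y \<bullet> (P \<theta> *v y) + x \<bullet> (P \<theta> *v x)) / 2)"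
proof -
  have unit: "y \<bullet> (b *s (P \<theta> *v x)) \<le> (y \<bullet> (P \<theta> *v y) + x \<bullet> (P \<theta> *v x)) / 2" if "norm b = 1" for b
  proof -
    let ?u = "b *s x"
    have "0 \<le> (y - ?u) \<bullet> (P \<theta> *v (y - ?u))" by (rule P_nonneg)
    also have "\<dots> = y \<bullet> (P \<theta> *v y) - 2 * (y \<bullet> (P \<theta> *v ?u)) + ?u \<bullet> (P \<theta> *v ?u)"
      by (simp add: matrix_vector_mult_diff_distrib inner_diff_left inner_diff_right P_symmetric[where x = ?u and y = y])
    also have "?u \<bullet> (P \<theta> *v ?u) = x \<bullet> (P \<theta> *v x)"
      by (simp add: matrix_vector_scalar inner_scalar_scalar[OF that])
    finally show ?thesis by (simp add: matrix_vector_scalar)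
  qed
  have eq: "(mat a ** P \<theta>) *v x = a *s (P \<theta> *v x)"
    by (simp only: matrix_vector_mul_assoc[symmetric] mat_vector_mult)
  show ?thesis
  proof (cases "a = 0")
    case False
    let ?b = "a / of_real (norm a)"
    have b: "norm ?b = 1" "norm (- ?b) = 1" using False by (simp_all add: norm_divide)
    have "a *s (P \<theta> *v x) = norm a *\<^sub>R (?b *s (P \<theta> *v x))"
      using False by (simp add: scaleR_eq_scalar)
    then have "y \<bullet> ((mat a ** P \<theta>) *v x) = norm a * (y \<bullet> (?b *s (P \<theta> *v x)))" by (simp add: eq)
    moreover have le: "\<bar>y \<bullet> (?b *s (P \<theta> *v x))\<bar> \<le> (y \<bullet> (P \<theta> *v y) + x \<bullet> (P \<theta> *v x)) / 2"
    proof -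
      have "(- ?b) *s (P \<theta> *v x) = - (?b *s (P \<theta> *v x))" by (simp add: vec_eq_iff)
      then show ?thesis using unit[OF b(1)] unit[OF b(2)] by (simp only: inner_minus_right abs_le_iff) 
    qed
    ultimately show ?thesis using mult_left_mono[OF le, of "norm a"] by (simp only: abs_mult) simp
  qed (simp add: eq)
qed

text \<open>Integrating \<open>P_form_bound\<close> against the total mass \<open>mat 2\<close>
  gives \<open>y \<bullet> Q x <= B * (|y|^2 + |x|^2)\<close>; equalising the two norms turns this
  into a bound for the operator.\<close>

lemma integral_fP_bound:
  assumes f: "continuous_on {0..2 * pi} \<phi>" and B: "\<And>\<theta>. norm (\<phi> \<theta>) \<le> B"
  shows "spectral_norm (integral {0..2 * pi} (\<lambda>\<theta>. mat (\<phi> \<theta>) ** P \<theta>)) \<le> 2 * B"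
proof -
  let ?Q = "integral {0..2 * pi} (\<lambda>\<theta>. mat (\<phi> \<theta>) ** P \<theta>)"
  have B0: "0 \<le> B" using norm_ge_zero order_trans B by blast
  have Q: "((\<lambda>\<theta>. mat (\<phi> \<theta>) ** P \<theta>) has_integral ?Q) {0..2 * pi}"
    by (intro integrable_integral integrable_continuous_real continuous_on_matrix_mult continuous_on_mat f continuous_P)
  have form: "((\<lambda>\<theta>. y \<bullet> (A \<theta> *v x)) has_integral y \<bullet> (I *v x)) {0..2 * pi}"
    if "(A has_integral I) {0..2 * pi}" for A :: "real \<Rightarrow> complex^'n^'n" and I x y
    using has_integral_linear[OF that bounded_linear_compose[OF bounded_linear_inner_right bounded_linear_matrix_vector_left], of y x]
    by (simp add: o_def)
  have two: "y \<bullet> (mat 2 *v y) = 2 * (norm y)\<^sup>2" for y :: "complex^'n"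
  proof -
    have "(mat 2 :: complex^'n^'n) *v y = 2 *\<^sub>R y" by (simp add: mat_vector_mult scaleR_eq_scalar)
    then show ?thesis by (simp add: power2_norm_eq_inner)
  qed
  have le: "y \<bullet> (?Q *v x) \<le> B * ((norm y)\<^sup>2 + (norm x)\<^sup>2)" for x y
  proof -
    have "((\<lambda>\<theta>. B * ((y \<bullet> (P \<theta> *v y) + x \<bullet> (P \<theta> *v x)) / 2)) has_integral
        B * ((y \<bullet> (mat 2 *v y) + x \<bullet> (mat 2 *v x)) / 2)) {0..2 * pi}"
      by (intro has_integral_mult_right has_integral_divide has_integral_add form integral_P)
    then have "y \<bullet> (?Q *v x) \<le> B * ((y \<bullet> (mat 2 *v y) + x \<bullet> (mat 2 *v x)) / 2)"
    proof (rule has_integral_le[OF form[OF Q]])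
      fix \<theta>
      have "y \<bullet> ((mat (\<phi> \<theta>) ** P \<theta>) *v x) \<le> norm (\<phi> \<theta>) * ((y \<bullet> (P \<theta> *v y) + x \<bullet> (P \<theta> *v x)) / 2)"
        using P_form_bound[of y "\<phi> \<theta>" \<theta> x] by linarith
      also have "\<dots> \<le> B * ((y \<bullet> (P \<theta> *v y) + x \<bullet> (P \<theta> *v x)) / 2)"
        by (intro mult_right_mono B) (simp add: P_nonneg)
      finally show "y \<bullet> ((mat (\<phi> \<theta>) ** P \<theta>) *v x) \<le> B * ((y \<bullet> (P \<theta> *v y) + x \<bullet> (P \<theta> *v x)) / 2)" .
    qed
    then show ?thesis by (simp add: two)
  qed
  show ?thesis
  proof (rule spectral_norm_le)
    fix x
    show "norm (?Q *v x) \<le> 2 * B * norm x"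
    proof (cases "?Q *v x = 0 \<or> x = 0")
      case False
      \<comment> \<open>The vector in the direction of \<open>?Q *v x\<close> with the length of
        \<open>x\<close>.\<close>
      let ?y = "(norm x / norm (?Q *v x)) *\<^sub>R (?Q *v x)"
      have "?y \<bullet> (?Q *v x) = norm x * norm (?Q *v x)"
        using False by (simp add: power2_norm_eq_inner[symmetric] power2_eq_square)
      moreover have "norm ?y = norm x" using False by simp
      ultimately have "norm x * norm (?Q *v x) \<le> B * ((norm x)\<^sup>2 + (norm x)\<^sup>2)" using le[of ?y x] by simp
      then have "norm x * norm (?Q *v x) \<le> norm x * (2 * B * norm x)"
        by (simp add: power2_eq_square algebra_simps)
      then show ?thesis using False by simp
    qed (use B0 in auto)
  qed (use B0 in simp)
qed

text \<open>\<open>companion f 1\<close> is \<open>g(T)\<close> for the Cauchy transform \<open>g\<close> of the conjugate of \<open>f\<close>. As \<open>g\<close> is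
  holomorphic only inside the domain, it is approximated by the dilations \<open>g \<circ> zt t\<close> with \<open>t < 1\<close>.\<close>

definition "companion f t = integral {0..2 * pi} (\<lambda>\<theta>. mat (cnj (f (\<sigma> \<theta>)) * wt \<theta>) ** res t \<theta>)"

context
  fixes f U
  assumes f: "f holomorphic_on U" "convex U" "open U" "Dc \<subseteq> U"
begin

lemma continuous_companion_integrand:
  "continuous_on ({0..1} \<times> S) (\<lambda>(t, \<theta>). mat (cnj (f (\<sigma> \<theta>)) * wt \<theta>) ** res t \<theta>)"
  unfolding split_beta
  by (intro continuous_on_matrix_mult continuous_on_mat continuous_res continuous_on_mult continuous_on_cnj
      continuous_on_compose2[OF continuous_wt[of UNIV]] continuous_on_compose2[OF continuous_on_f\<sigma>[OF f(1,4), of UNIV]]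
      continuous_on_snd continuous_on_id) auto

lemma companion_integral:
  assumes "t \<in> {0..1}"
  shows "((\<lambda>\<theta>. mat (cnj (f (\<sigma> \<theta>)) * wt \<theta>) ** res t \<theta>) has_integral companion f t) {0..2 * pi}"
  unfolding companion_def
  by (intro integrable_integral integrable_continuous_real continuous_on_matrix_mult continuous_on_mat
      continuous_on_mult continuous_on_cnj continuous_wt continuous_on_f\<sigma>[OF f(1,4)] continuous_res_fixed assms)

lemma companion_tendsto: "(companion f \<longlongrightarrow> companion f 1) (at_left 1)"
proof -
  have "continuous_on {0..1} (companion f)"
    using integral_continuous_on_param[OF continuous_companion_integrand[of "cbox 0 (2 * pi)"]]
    by (simp add: companion_def[abs_def])
  then have "(companion f \<longlongrightarrow> companion f 1) (at 1 within {0..1})" by (simp add: continuous_on_def)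
  then show ?thesis by (simp add: at_within_Icc_at_left)
qed

text \<open>The conjugations of \<open>f\<close> in the companion and of the conjugate transpose
  cancel, so both integrands carry the same scalar factor \<open>f (\<sigma> \<theta>)\<close> and
  add up to it times \<open>P \<theta>\<close>.\<close>

lemma spectral_norm_add_companion:
  assumes "calc f F" and B: "\<And>z. z \<in> Dc \<Longrightarrow> norm (f z) \<le> B"
  shows "spectral_norm (F + ctrans (companion f 1)) \<le> 2 * B"
proof -
  have "((\<lambda>\<theta>. mat (f (\<sigma> \<theta>)) ** (mat (wt \<theta>) ** res 1 \<theta>) + ctrans (mat (cnj (f (\<sigma> \<theta>)) * wt \<theta>) ** res 1 \<theta>))
      has_integral F + ctrans (companion f 1)) {0..2 * pi}"
    using has_integral_add[OF calc_cauchy[OF assms(1)] has_integral_linear[OF companion_integral[of 1] bounded_linear_ctrans]]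
    by (simp add: o_def)
  moreover have "mat (f (\<sigma> \<theta>)) ** (mat (wt \<theta>) ** res 1 \<theta>) + ctrans (mat (cnj (f (\<sigma> \<theta>)) * wt \<theta>) ** res 1 \<theta>)
      = mat (f (\<sigma> \<theta>)) ** P \<theta>" for \<theta>
  proof -
    have "ctrans (mat (cnj a * b) ** X) = mat a ** ctrans (mat b ** X)" for a b and X :: "complex^'n^'n"
    proof -
      have "mat (cnj a * b) ** X = mat (cnj a) ** (mat b ** X)" by (simp only: mat_mult matrix_mul_assoc)
      then have "ctrans (mat (cnj a * b) ** X) = ctrans (mat b ** X) ** mat a"
        by (simp only: ctrans_simps complex_cnj_cnj)
      then show ?thesis by (simp only: mat_commute[of "ctrans (mat b ** X)"])
    qed
    then show ?thesis by (simp only: P_def matrix_add_ldistrib)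
  qed
  ultimately have "F + ctrans (companion f 1) = integral {0..2 * pi} (\<lambda>\<theta>. mat (f (\<sigma> \<theta>)) ** P \<theta>)"
    by (simp add: integral_unique)
  then show ?thesis
    using integral_fP_bound[OF continuous_on_f\<sigma>[OF f(1,4)], of B] B[OF \<sigma>_in_Dc] by simp
qed

text \<open>For \<open>t < 1\<close> the map \<open>zt t\<close> sends \<open>Dc\<close> into
  \<open>D\<close>, so its preimage \<open>V\<close> of \<open>D\<close> is the neighbourhood of
  \<open>Dc\<close> that \<open>calc\<close> demands. The quotient \<open>H\<close> integrates the
  resolvent identity for the scalar \<open>zt t z\<close> and the matrix
  \<open>Th t\<close>.\<close>

lemma calc_companion:
  assumes t: "t \<in> {0..<1}"
  shows "calc (\<lambda>z. ctransform f (zt t z)) (companion f t)"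
proof -
  have t': "t \<in> {0..1}" using t by simp
  define V where "V = {z. zt t z \<in> D}"
  define \<phi> where "\<phi> \<theta> = of_real t * (cnj (f (\<sigma> \<theta>)) * wt \<theta>)" for \<theta>
  define H where "H z = integral {0..2 * pi} (\<lambda>\<theta>. mat (\<phi> \<theta> / (\<sigma> \<theta> - zt t z)) ** res t \<theta>)" for z
  have zt: "continuous_on UNIV (zt t)" "zt t holomorphic_on V"
    unfolding zt_def by (auto intro!: continuous_intros holomorphic_intros)
  have cont: "continuous_on S \<phi>" for S
    unfolding \<phi>_def by (intro continuous_intros continuous_on_cnj continuous_wt continuous_on_f\<sigma>[OF f(1,4)])
  have Hcont: "continuous_on S (\<lambda>\<theta>. mat (\<phi> \<theta> / (\<sigma> \<theta> - zt t z)) ** res t \<theta>)" if "z \<in> V" for z S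
    by (intro continuous_on_matrix_mult continuous_on_mat continuous_on_divide continuous_on_diff continuous_on_const
        cont continuous_\<sigma> continuous_res_fixed t') (use that \<sigma>_ne in \<open>auto simp: V_def\<close>)
  have Hint: "((\<lambda>\<theta>. mat (\<phi> \<theta> / (\<sigma> \<theta> - zt t z)) ** res t \<theta>) has_integral H z) {0..2 * pi}" if "z \<in> V" for z
    unfolding H_def by (intro integrable_integral integrable_continuous_real Hcont that)
  show ?thesis
  proof (rule calcI[where U = V and H = H])
    show "companion f t ** T = T ** companion f t"
    proof (rule has_integral_unique)
      show "((\<lambda>\<theta>. mat (cnj (f (\<sigma> \<theta>)) * wt \<theta>) ** res t \<theta> ** T) has_integral companion f t ** T) {0..2 * pi}"
        using has_integral_linear[OF companion_integral[OF t'] bounded_linear_mult_matrix_right[of T]]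
        by (simp add: o_def)
      have "T ** (mat (cnj (f (\<sigma> \<theta>)) * wt \<theta>) ** res t \<theta>) = mat (cnj (f (\<sigma> \<theta>)) * wt \<theta>) ** res t \<theta> ** T" for \<theta>
        by (simp add: mat_mult_mult res_commute[OF t'] flip: matrix_mul_assoc)
      then show "((\<lambda>\<theta>. mat (cnj (f (\<sigma> \<theta>)) * wt \<theta>) ** res t \<theta> ** T) has_integral T ** companion f t) {0..2 * pi}"
        using has_integral_linear[OF companion_integral[OF t'] bounded_linear_mult_matrix_left[of T]]
        by (simp add: o_def)
    qed
    show "open V"
      using open_vimage[OF open_D zt(1)] by (simp add: V_def vimage_def)
    show "convex V"
    proof (rule convexI)
      fix x y and u v :: real assume "x \<in> V" "y \<in> V" "0 \<le> u" "0 \<le> v" and uv: "u + v = 1"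
      moreover have "zt t (u *\<^sub>R x + v *\<^sub>R y) = u *\<^sub>R zt t x + v *\<^sub>R zt t y"
      proof -
        have "u = 1 - v" using uv by simp
        show ?thesis unfolding \<open>u = 1 - v\<close> by (simp add: zt_def scaleR_conv_of_real algebra_simps)
      qed
      ultimately show "u *\<^sub>R x + v *\<^sub>R y \<in> V" using convex_D by (simp add: V_def convex_def)
    qed
    show "Dc \<subseteq> V" using zt_closed_in_D[OF _ t] by (auto simp: V_def)
    show "(\<lambda>z. ctransform f (zt t z)) holomorphic_on V"
      using holomorphic_on_compose_gen[OF zt(2) ctransform_holomorphic[OF f(1,4)]] by (auto simp: V_def o_def)
    show "(\<lambda>z. H z $ i $ j) holomorphic_on V" for i j
    proof -
      have "(\<lambda>w. integral {0..2 * pi} (\<lambda>\<theta>. (\<phi> \<theta> * res t \<theta> $ i $ j) / (\<sigma> \<theta> - w))) holomorphic_on D"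
        by (intro cauchy_type_holomorphic continuous_on_mult cont
            bounded_linear.continuous_on[OF bounded_linear_matrix_nth] continuous_res_fixed t')
      from holomorphic_on_compose_gen[OF zt(2) this]
      have "(\<lambda>z. integral {0..2 * pi} (\<lambda>\<theta>. (\<phi> \<theta> * res t \<theta> $ i $ j) / (\<sigma> \<theta> - zt t z))) holomorphic_on V"
        by (auto simp: V_def o_def)
      moreover have "H z $ i $ j = integral {0..2 * pi} (\<lambda>\<theta>. (\<phi> \<theta> * res t \<theta> $ i $ j) / (\<sigma> \<theta> - zt t z))"
        if "z \<in> V" for z
        using integral_unique[OF has_integral_linear[OF Hint[OF that] bounded_linear_matrix_nth[of i j]]]
        by (simp add: o_def mat_mult_nth)
      ultimately show ?thesis by (simp cong: holomorphic_cong)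
    qed
    show "mat (ctransform f (zt t z)) - companion f t = (mat z - T) ** H z" if "z \<in> V" for z
    proof (rule has_integral_unique)
      have ne: "\<sigma> \<theta> - zt t z \<noteq> 0" for \<theta> using that \<sigma>_ne by (auto simp: V_def)
      have "((\<lambda>\<theta>. cnj (f (\<sigma> \<theta>)) * (wt \<theta> / (\<sigma> \<theta> - zt t z))) has_integral ctransform f (zt t z)) {0..2 * pi}"
        unfolding ctransform_def using that
        by (intro integrable_integral integrable_continuous_real continuous_on_mult continuous_on_cnj
            continuous_on_f\<sigma>[OF f(1,4)] continuous_kernel) (auto simp: V_def)
      from has_integral_diff[OF has_integral_linear[OF this bounded_linear_mat] companion_integral[OF t']]
      show "((\<lambda>\<theta>. mat (cnj (f (\<sigma> \<theta>)) * (wt \<theta> / (\<sigma> \<theta> - zt t z))) - mat (cnj (f (\<sigma> \<theta>)) * wt \<theta>) ** res t \<theta>)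
          has_integral mat (ctransform f (zt t z)) - companion f t) {0..2 * pi}"
        by (simp add: o_def)
      have "(mat z - T) ** (mat (\<phi> \<theta> / (\<sigma> \<theta> - zt t z)) ** res t \<theta>)
          = mat (cnj (f (\<sigma> \<theta>)) * (wt \<theta> / (\<sigma> \<theta> - zt t z))) - mat (cnj (f (\<sigma> \<theta>)) * wt \<theta>) ** res t \<theta>" for \<theta>
      proof -
        define a where "a = \<sigma> \<theta> - zt t z"
        define q where "q = cnj (f (\<sigma> \<theta>)) * wt \<theta>"
        \<comment> \<open>The difference between \<open>zt t z\<close> and \<open>Th t\<close> is
          \<open>t\<close> times that between \<open>z\<close> and \<open>T\<close>; this is the
          factor \<open>t\<close> in \<phi>.\<close>
        have "mat (of_real t) ** (mat z - T) = (mat (\<sigma> \<theta>) - Th t) - mat a"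
          by (simp add: a_def Th_def zt_def mat_diff mat_add matrix_ring mat_mult)
        then have "mat (of_real t) ** (mat z - T) ** res t \<theta> = mat 1 - mat a ** res t \<theta>"
          using matrix_inv_props(2)[OF invertible_Th[OF t'], of \<theta>] by (simp add: matrix_ring res_def)
        then have "mat (q / a) ** (mat (of_real t) ** (mat z - T) ** res t \<theta>) = mat (q / a) ** (mat 1 - mat a ** res t \<theta>)"
          by (simp only:)
        also have "\<dots> = mat (q / a) - mat (q / a * a) ** res t \<theta>"
          by (simp only: matrix_mult_diff_right mat_mult matrix_mul_assoc matrix_mul_rid)
        also have "q / a * a = q" using ne[of \<theta>] by (simp add: a_def)
        finally have "mat (q / a) ** (mat (of_real t) ** (mat z - T) ** res t \<theta>) = mat (q / a) - mat q ** res t \<theta>" .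
        moreover have "mat (q / a) ** (mat (of_real t) ** (mat z - T) ** res t \<theta>)
            = (mat z - T) ** (mat (\<phi> \<theta> / a) ** res t \<theta>)"
        proof -
          have "\<phi> \<theta> / a = q / a * of_real t" by (simp add: \<phi>_def q_def)
          then have "mat (\<phi> \<theta> / a) = mat (q / a) ** (mat (of_real t) :: complex^'n^'n)" by (simp only: mat_mult)
          moreover have "(mat z - T) ** (mat (\<phi> \<theta> / a) ** res t \<theta>) = mat (\<phi> \<theta> / a) ** ((mat z - T) ** res t \<theta>)"
            by (rule mat_mult_mult)
          ultimately show ?thesis by (simp only: matrix_mul_assoc)
        qed
        ultimately show ?thesis by (simp add: a_def q_def)
      qed
      then show "((\<lambda>\<theta>. mat (cnj (f (\<sigma> \<theta>)) * (wt \<theta> / (\<sigma> \<theta> - zt t z))) - mat (cnj (f (\<sigma> \<theta>)) * wt \<theta>) ** res t \<theta>)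
          has_integral (mat z - T) ** H z) {0..2 * pi}"
        using has_integral_linear[OF Hint[OF that] bounded_linear_mult_matrix_left[of "mat z - T"]]
        by (simp add: o_def)
    qed
  qed
qed

end

end

section \<open>The Crouzeix--Palencia theorem\<close>

lemma cubic_bound:
  fixes N K :: real
  assumes "0 \<le> N" "N ^ 4 \<le> 2 * N ^ 3 + K * N" "0 \<le> K"
  shows "N ^ 3 \<le> 2 * N\<^sup>2 + K"
proof (cases "N = 0")
  case False
  have "N * N ^ 3 \<le> N * (2 * N\<^sup>2 + K)" using assms(2) by (simp add: power_eq_if algebra_simps)
  then show ?thesis using False assms(1) by simp
qed (use assms(3) in simp)

text \<open>The supremum \<open>K\<close> may not be attained, so it cannot be inserted for
  \<open>N\<close>. If \<open>K\<close> exceeded the root \<open>1 + sqrt 2\<close> of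
  \<open>x^2 - 2 x - 1\<close>, take \<open>N0\<close> between the two and let \<open>d\<close> be
  the value of this quadratic at \<open>N0\<close>. Every \<open>N > N0\<close> in \<open>S\<close>
  then has \<open>N * (1 + d) <= K\<close>, which keeps all of \<open>S\<close> away from
  \<open>K\<close>.\<close>

lemma Sup_cubic_bound:
  fixes S :: "real set"
  assumes S: "S \<noteq> {}" "bdd_above S" and nonneg: "\<And>N. N \<in> S \<Longrightarrow> 0 \<le> N"
    and le: "\<And>N. N \<in> S \<Longrightarrow> N ^ 3 \<le> 2 * N\<^sup>2 + Sup S"
  shows "Sup S \<le> 1 + sqrt 2"
proof (rule ccontr)
  let ?K = "Sup S" and ?c = "1 + sqrt 2"
  assume "\<not> ?K \<le> ?c"
  then have gt: "?c < ?K" by simp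
  define N0 where "N0 = (?c + ?K) / 2"
  define d where "d = N0\<^sup>2 - 2 * N0 - 1"
  have N0: "?c < N0" "N0 < ?K" using gt by (simp_all add: N0_def)
  have s: "0 < sqrt (2 :: real)" by simp
  have "0 < (N0 - ?c) * (N0 - (1 - sqrt 2))" by (intro mult_pos_pos) (use N0(1) s in linarith)+
  then have d: "0 < d" by (simp add: d_def power2_eq_square algebra_simps)
  have "N \<le> max N0 (?K / (1 + d))" if N: "N \<in> S" for N
  proof (cases "N \<le> N0")
    case False
    have "0 \<le> (N - N0) * (N + N0 - 2)" by (intro mult_nonneg_nonneg) (use False N0(1) s in linarith)+
    then have "1 + d \<le> N\<^sup>2 - 2 * N" by (simp add: d_def power2_eq_square algebra_simps)
    then have "N * (1 + d) \<le> N * (N\<^sup>2 - 2 * N)" using nonneg[OF N] by (rule mult_left_mono)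
    also have "\<dots> = N ^ 3 - 2 * N\<^sup>2" by (simp add: power_eq_if algebra_simps)
    also have "\<dots> \<le> ?K" using le[OF N] by simp
    finally show ?thesis using d by (simp add: pos_le_divide_eq le_max_iff_disj)
  qed simp
  then have "?K \<le> max N0 (?K / (1 + d))" using S(1) by (intro cSup_least)
  moreover have "?K / (1 + d) < ?K"
  proof -
    have "0 < ?K * d" by (intro mult_pos_pos) (use d gt s in linarith)+
    then show ?thesis using d by (simp add: divide_less_eq algebra_simps)
  qed
  ultimately show False using N0(2) by (simp add: le_max_iff_disj)
qed

context matrix_in_smooth_convex
begin

text \<open>A crude bound depending on the matrix and the curve; it only makes the supremum of the
  extremal argument finite.\<close>

lemma calc_bounded:
  obtains C where "\<And>f F. calc f F \<Longrightarrow> (\<And>z. z \<in> Dc \<Longrightarrow> norm (f z) \<le> 1) \<Longrightarrow> spectral_norm F \<le> C"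
proof -
  obtain C where C: "\<And>A :: complex^'n^'n. spectral_norm A \<le> C * norm A" "0 \<le> C"
    using spectral_norm_le_norm by blast
  let ?k = "\<lambda>\<theta>. mat (wt \<theta>) ** res 1 \<theta>"
  have "continuous_on {0..2 * pi} ?k"
    by (intro continuous_on_matrix_mult continuous_on_mat continuous_wt continuous_res_fixed) auto
  then have int: "(\<lambda>\<theta>. norm (?k \<theta>)) integrable_on {0..2 * pi}"
    by (intro integrable_continuous_real continuous_on_norm)
  show thesis
  proof (rule that)
    fix f F assume f: "calc f F" "\<And>z. z \<in> Dc \<Longrightarrow> norm (f z) \<le> 1"
    have "norm (integral {0..2 * pi} (\<lambda>\<theta>. mat (f (\<sigma> \<theta>)) ** ?k \<theta>)) \<le> integral {0..2 * pi} (\<lambda>\<theta>. norm (?k \<theta>))"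
    proof (rule integral_norm_bound_integral[OF has_integral_integrable[OF calc_cauchy[OF f(1)]] int])
      fix \<theta>
      show "norm (mat (f (\<sigma> \<theta>)) ** ?k \<theta>) \<le> norm (?k \<theta>)"
        unfolding norm_mat_mult[of "f (\<sigma> \<theta>)"] using f(2)[OF \<sigma>_in_Dc] by (intro mult_left_le_one_le) auto
    qed
    then have "norm F \<le> integral {0..2 * pi} (\<lambda>\<theta>. norm (?k \<theta>))"
      by (simp only: integral_unique[OF calc_cauchy[OF f(1)]])
    then show "spectral_norm F \<le> C * integral {0..2 * pi} (\<lambda>\<theta>. norm (?k \<theta>))"
      using C(1)[of F] mult_left_mono[OF _ C(2)] by (meson order_trans)
  qed
qed

lemma calc_quartic_bound:
  assumes f: "calc f F" "\<And>z. z \<in> Dc \<Longrightarrow> norm (f z) \<le> 1"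
    and K: "\<And>g G. calc g G \<Longrightarrow> (\<And>z. z \<in> Dc \<Longrightarrow> norm (g z) \<le> 1) \<Longrightarrow> spectral_norm G \<le> K"
  shows "spectral_norm F ^ 4 \<le> 2 * spectral_norm F ^ 3 + K * spectral_norm F"
proof -
  obtain U where U: "open U" "convex U" "Dc \<subseteq> U" "f holomorphic_on U"
    using f(1) by (auto simp: calc_def)
  define G where "G = companion f 1"
  let ?N = "spectral_norm F" and ?F' = "ctrans F"
  have sum: "spectral_norm (F + ctrans G) \<le> 2"
    using spectral_norm_add_companion[OF U(4,2,1,3) f(1), of 1] f(2) by (simp add: G_def)
  \<comment> \<open>For \<open>t < 1\<close> the product belongs to a function bounded by 1 on
    \<open>Dc\<close>, so the bound \<open>K\<close> applies to it. At \<open>t = 1\<close> the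
    estimate is obtained as a limit.\<close>
  have FGF: "spectral_norm (F ** G ** F) \<le> K"
  proof (rule tendsto_upperbound)
    have "((\<lambda>t. F ** companion f t ** F) \<longlongrightarrow> F ** G ** F) (at_left 1)"
      unfolding G_def
      by (intro bounded_bilinear.tendsto[OF bounded_bilinear_matrix_mult] tendsto_const
          companion_tendsto[OF U(4,2,1,3)])
    then show "((\<lambda>t. spectral_norm (F ** companion f t ** F)) \<longlongrightarrow> spectral_norm (F ** G ** F)) (at_left 1)"
      by (rule tendsto_spectral_norm)
    show "\<forall>\<^sub>F t in at_left 1. spectral_norm (F ** companion f t ** F) \<le> K"
    proof (rule eventually_at_leftI[of 0])
      fix t :: real assume "t \<in> {0<..<1}"
      then have t: "t \<in> {0..<1}" by simp
      have "calc (\<lambda>z. f z * ctransform f (zt t z) * f z) (F ** companion f t ** F)"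
        by (intro calc_mult f(1) calc_companion[OF U(4,2,1,3) t])
      moreover have "norm (f z * ctransform f (zt t z) * f z) \<le> 1" if "z \<in> Dc" for z
      proof -
        have "norm (ctransform f (zt t z)) \<le> 1"
          by (rule norm_ctransform_le[OF U(4,2,1,3) f(2) zt_closed_in_D[OF that t]])
        then have "norm (f z) * norm (ctransform f (zt t z)) * norm (f z) \<le> 1 * 1 * 1"
          using f(2)[OF that] by (intro mult_mono) auto
        then show ?thesis by (simp add: norm_mult)
      qed
      ultimately show "spectral_norm (F ** companion f t ** F) \<le> K" by (rule K)
    qed simp
  qed simp
  have "?N ^ 4 = (?N\<^sup>2)\<^sup>2" by simp
  also have "\<dots> \<le> (spectral_norm (F ** ?F'))\<^sup>2"
    by (intro power_mono spectral_norm_mult_ctrans) simp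
  also have "\<dots> \<le> spectral_norm ((F ** ?F') ** ctrans (F ** ?F'))" by (rule spectral_norm_mult_ctrans)
  \<comment> \<open>\<open>F ** ?F'\<close> is its own conjugate transpose. In its square the second
    factor \<open>?F'\<close> is replaced by \<open>ctrans (F + ctrans G) = ?F' + G\<close>, and the
    surplus term is subtracted.\<close>
  also have "(F ** ?F') ** ctrans (F ** ?F') = F ** ctrans (F + ctrans G) ** (F ** ?F') + (- (F ** G ** F)) ** ?F'"
    by (simp add: ctrans_simps matrix_ring matrix_mul_assoc)
  also have "spectral_norm \<dots> \<le> spectral_norm (F ** ctrans (F + ctrans G) ** (F ** ?F')) + spectral_norm ((- (F ** G ** F)) ** ?F')"
    by (rule spectral_norm_add)
  also have "\<dots> \<le> (?N * 2) * (?N * ?N) + K * ?N"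
  proof (rule add_mono)
    have n1: "spectral_norm (F ** ctrans (F + ctrans G)) \<le> ?N * 2"
      using order_trans[OF spectral_norm_mult mult_left_mono[OF _ spectral_norm_nonneg]] sum
      by (metis spectral_norm_ctrans)
    have n2: "spectral_norm (F ** ?F') \<le> ?N * ?N"
      using spectral_norm_mult[of F ?F'] by (simp add: spectral_norm_ctrans)
    show "spectral_norm (F ** ctrans (F + ctrans G) ** (F ** ?F')) \<le> (?N * 2) * (?N * ?N)"
      by (rule order_trans[OF spectral_norm_mult mult_mono[OF n1 n2]]) (simp_all add: spectral_norm_nonneg)
    show "spectral_norm ((- (F ** G ** F)) ** ?F') \<le> K * ?N"
      using FGF by (intro order_trans[OF spectral_norm_mult] mult_mono)
        (simp_all add: spectral_norm_nonneg spectral_norm_ctrans spectral_norm_minus order_trans[OF spectral_norm_nonneg FGF])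
  qed
  finally show ?thesis by (simp add: power_eq_if algebra_simps)
qed

text \<open>Rescaling by \<open>1 / B\<close> reduces to functions bounded by 1, whose norms form
  the set \<open>S\<close> with supremum at most \<open>1 + sqrt 2\<close>.\<close>

lemma calc_norm_le:
  assumes "calc f F" "\<And>z. z \<in> Dc \<Longrightarrow> norm (f z) \<le> B" "0 < B"
  shows "spectral_norm F \<le> (1 + sqrt 2) * B"
proof -
  define S where "S = {spectral_norm F | f F. calc f F \<and> (\<forall>z\<in>Dc. norm (f z) \<le> 1)}"
  have S: "spectral_norm F \<in> S" if "calc f F" "\<And>z. z \<in> Dc \<Longrightarrow> norm (f z) \<le> 1" for f F
    using that unfolding S_def by blast
  obtain C where C: "\<And>f F. calc f F \<Longrightarrow> (\<And>z. z \<in> Dc \<Longrightarrow> norm (f z) \<le> 1) \<Longrightarrow> spectral_norm F \<le> C"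
    using calc_bounded by blast
  have bdd: "bdd_above S" unfolding S_def by (rule bdd_aboveI[of _ C]) (auto intro: C)
  have Sup: "spectral_norm F \<le> Sup S" if "calc f F" "\<And>z. z \<in> Dc \<Longrightarrow> norm (f z) \<le> 1" for f F
    by (rule cSup_upper[OF S[OF that] bdd])
  have "Sup S \<le> 1 + sqrt 2"
  proof (rule Sup_cubic_bound[OF _ bdd])
    show "S \<noteq> {}" using S[OF calc_const[of 0]] by auto
    fix N assume "N \<in> S"
    then obtain f F where N: "N = spectral_norm F" "calc f F" "\<And>z. z \<in> Dc \<Longrightarrow> norm (f z) \<le> 1"
      unfolding S_def by blast
    show "0 \<le> N" by (simp add: N(1) spectral_norm_nonneg)
    have "0 \<le> Sup S" using Sup[OF N(2,3)] spectral_norm_nonneg order_trans by blast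
    then show "N ^ 3 \<le> 2 * N\<^sup>2 + Sup S"
      unfolding N(1) by (intro cubic_bound spectral_norm_nonneg calc_quartic_bound[OF N(2,3)] Sup) auto
  qed
  moreover have "spectral_norm (mat (of_real (1 / B)) ** F) \<le> Sup S"
  proof (rule Sup[OF calc_mult[OF calc_const assms(1)]])
    fix z assume "z \<in> Dc"
    then show "norm (complex_of_real (1 / B) * f z) \<le> 1"
      using assms(2)[of z] assms(3) by (simp add: norm_mult norm_divide divide_le_eq)
  qed
  moreover have "spectral_norm F \<le> B * spectral_norm (mat (of_real (1 / B)) ** F)"
  proof -
    have "F = mat (of_real B) ** (mat (of_real (1 / B)) ** F)"
      using assms(3) by (simp add: matrix_mul_assoc flip: mat_mult)
    then have "spectral_norm F \<le> spectral_norm (mat (of_real B) :: complex^'n^'n) * spectral_norm (mat (of_real (1 / B)) ** F)"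
      by (metis spectral_norm_mult)
    moreover have "spectral_norm (mat (of_real B) :: complex^'n^'n) \<le> B"
      by (rule spectral_norm_le) (use assms(3) in \<open>simp_all add: mat_vector_mult norm_vector_scalar\<close>)
    ultimately show ?thesis
      using mult_right_mono[OF _ spectral_norm_nonneg] order_trans by blast
  qed
  ultimately have "spectral_norm F \<le> B * spectral_norm (mat (of_real (1 / B)) ** F)"
    "spectral_norm (mat (of_real (1 / B)) ** F) \<le> 1 + sqrt 2" by linarith+
  then have "spectral_norm F \<le> B * (1 + sqrt 2)"
    using mult_left_mono[of "spectral_norm (mat (of_real (1 / B)) ** F)" "1 + sqrt 2" B] assms(3) by linarith
  then show ?thesis by (simp only: mult.commute)
qed

end

section \<open>Polynomials and rational functions of matrices\<close>

lemma mat_poly_eq_sum: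
  assumes "degree p \<le> n"
  shows "mat_poly p A = (\<Sum>i\<le>n. mat (coeff p i) ** mat_power A i)"
  unfolding mat_poly_def
  by (rule sum.mono_neutral_left) (use assms in \<open>auto simp: coeff_eq_0 mat_zero\<close>)

lemma mat_power_simps: "mat_power A 0 = mat 1" "mat_power A (Suc k) = A ** mat_power A k"
  by (simp_all add: mat_power_def)

lemma matrix_mult_sum_right: "A ** (\<Sum>i\<in>I. F i) = (\<Sum>i\<in>I. A ** F i)" for A :: "complex^'n^'n"
  by (induction I rule: infinite_finite_induct) (simp_all add: matrix_add_ldistrib)

lemma mat_poly_pCons: "mat_poly (pCons a p) A = mat a + A ** mat_poly p A"
proof -
  have "mat_poly (pCons a p) A = (\<Sum>i\<le>Suc (degree p). mat (coeff (pCons a p) i) ** mat_power A i)"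
    by (rule mat_poly_eq_sum) (simp add: degree_pCons_le)
  also have "\<dots> = mat a + (\<Sum>i\<le>degree p. mat (coeff p i) ** (A ** mat_power A i))"
    by (simp only: sum.atMost_Suc_shift coeff_pCons_0 coeff_pCons_Suc mat_power_simps matrix_mul_rid)
  also have "\<dots> = mat a + A ** mat_poly p A"
    by (simp add: mat_poly_def matrix_mult_sum_right mat_mult_mult)
  finally show ?thesis .
qed

lemma mat_poly_0: "mat_poly 0 A = 0"
  by (simp add: mat_poly_def mat_zero)

lemma mat_poly_add: "mat_poly (p + q) A = mat_poly p A + mat_poly q A"
proof -
  let ?n = "max (degree p) (degree q)"
  have "mat_poly (p + q) A = (\<Sum>i\<le>?n. mat (coeff (p + q) i) ** mat_power A i)"
    by (rule mat_poly_eq_sum) (rule degree_add_le_max)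
  then show ?thesis
    by (simp add: mat_poly_eq_sum[of p ?n] mat_poly_eq_sum[of q ?n] mat_add matrix_mult_add_left sum.distrib)
qed

lemma mat_poly_smult: "mat_poly (smult a p) A = mat a ** mat_poly p A"
  by (simp add: mat_poly_eq_sum[OF degree_smult_le] mat_poly_def matrix_mult_sum_right mat_mult matrix_mul_assoc)

lemma mat_poly_linear_mult: "mat_poly ([:- a, 1:] * q) A = (A - mat a) ** mat_poly q A"
proof -
  have eq: "[:- a, 1:] * q = smult (- a) q + pCons 0 q" by simp
  show ?thesis unfolding eq mat_poly_add mat_poly_smult mat_poly_pCons
    by (simp add: mat_zero mat_minus matrix_ring)
qed

context matrix_in_smooth_convex
begin

lemma calc_poly: "calc (poly p) (mat_poly p T)"
proof (induction p)
  case 0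
  have "calc (poly 0) (mat 0)" by (rule calc_cong[OF calc_const]) simp
  then show ?case by (simp only: mat_poly_0 mat_zero)
next
  case (pCons a p)
  have "calc (\<lambda>z. a + z * poly p z) (mat a + T ** mat_poly p T)"
    by (intro calc_add calc_mult calc_const calc_id pCons.IH)
  then have "calc (poly (pCons a p)) (mat a + T ** mat_poly p T)" by (rule calc_cong) simp
  then show ?case by (simp only: mat_poly_pCons)
qed

text \<open>Over the complex numbers the polynomial splits, and all its roots lie outside
  \<open>U\<close>; the induction removes one linear factor at a time by
  \<open>calc_inverse_linear\<close>.\<close>

lemma calc_inverse_poly:
  assumes U: "open U" "convex U" "Dc \<subseteq> U"
  shows "(\<And>z. z \<in> U \<Longrightarrow> poly b z \<noteq> 0) \<Longrightarrow>
    invertible (mat_poly b T) \<and> calc (\<lambda>z. 1 / poly b z) (matrix_inv (mat_poly b T))"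
proof (induction "degree b" arbitrary: b)
  case 0
  then obtain k where b: "b = [:k:]" by (metis degree_eq_zeroE)
  have "c \<in> U" using c D_subset_Dc U(3) by blast
  then have k: "k \<noteq> 0" using 0(2) b by force
  have T: "mat_poly b T = mat k" by (simp add: b mat_poly_pCons mat_poly_0)
  have "mat (1 / k) ** mat k = (mat 1 :: complex^'n^'n)" using k by (simp flip: mat_mult)
  from inverse_of_left[OF this] show ?case using calc_const[of "1 / k"] by (simp add: T) (simp add: b)
next
  case (Suc n)
  then obtain a where "poly b a = 0" using alg_closed_imp_poly_has_root[of b] by auto
  then obtain q where b: "b = [:- a, 1:] * q" by (metis dvdE poly_eq_0_iff_dvd)
  have "b \<noteq> 0" using Suc(2) by auto
  then have "q \<noteq> 0" using b by auto
  then have "degree b = degree [:- a, 1:] + degree q" unfolding b by (intro degree_mult_eq) auto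
  then have deg: "degree b = Suc (degree q)" by simp
  have a: "a \<notin> U" using Suc.prems \<open>poly b a = 0\<close> by blast
  have IH: "invertible (mat_poly q T)" "calc (\<lambda>z. 1 / poly q z) (matrix_inv (mat_poly q T))"
    using Suc.hyps(1)[of q] Suc.prems Suc(2) deg b by auto
  have "a \<notin> numerical_range T" using a U(3) range_T D_subset_Dc by blast
  then have inv: "invertible (T - mat a)"
    by (intro invertible_uminus_diff invertible_outside_numerical_range)
  let ?I = "matrix_inv (mat_poly q T) ** matrix_inv (T - mat a)"
  have "?I ** mat_poly b T = matrix_inv (mat_poly q T) ** (matrix_inv (T - mat a) ** (T - mat a)) ** mat_poly q T"
    by (simp only: b mat_poly_linear_mult matrix_mul_assoc)
  also have "\<dots> = mat 1"
    by (simp only: matrix_inv_props(1)[OF inv] matrix_mul_rid matrix_inv_props(1)[OF IH(1)])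
  finally have "?I ** mat_poly b T = mat 1" .
  note I = inverse_of_left[OF this]
  have "calc (\<lambda>z. 1 / poly q z * (1 / (z - a))) ?I"
    by (rule calc_mult[OF IH(2) calc_inverse_linear[OF U a]])
  then have "calc (\<lambda>z. 1 / poly b z) ?I"
    by (rule calc_cong) (simp add: b algebra_simps)
  then show ?case using I by simp
qed

end

text \<open>The subtracted polynomial \<open>e\<close> will be a Taylor polynomial of the
  exponential. By compactness the function has no poles and stays below
  \<open>m + \<epsilon>\<close> on a neighbourhood of the numerical range, inside which the smooth
  domain is placed.\<close>

theorem crouzeix_palencia_rational:
  fixes T :: "complex^'n^'n"
  assumes den: "\<And>z. z \<in> numerical_range T \<Longrightarrow> poly b z \<noteq> 0"
    and m: "\<And>z. z \<in> numerical_range T \<Longrightarrow> norm (poly a z / poly b z - poly e z) \<le> m"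
  shows "invertible (mat_poly b T)"
    and "spectral_norm (mat_poly a T ** matrix_inv (mat_poly b T) - mat_poly e T) \<le> (1 + sqrt 2) * m"
proof -
  let ?W = "numerical_range T" and ?f = "\<lambda>z. poly a z / poly b z - poly e z"
  have m0: "0 \<le> m" using numerical_range_nonempty[of T] m norm_ge_zero order_trans by blast
  have main: "invertible (mat_poly b T) \<and>
    spectral_norm (mat_poly a T ** matrix_inv (mat_poly b T) - mat_poly e T) \<le> (1 + sqrt 2) * (m + \<epsilon>)"
    if "\<epsilon> > 0" for \<epsilon>
  proof -
    have pos: "0 < m + \<epsilon>" using m0 that by (rule add_nonneg_pos)
    define V where "V = {z. poly b z \<noteq> 0}"
    have V: "open V" unfolding V_def by (intro open_Collect_neq continuous_intros)
    have cont: "continuous_on V ?f" by (intro continuous_intros) (auto simp: V_def)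
    have "open (V \<inter> ?f -` ball 0 (m + \<epsilon>))" by (rule continuous_open_preimage[OF cont V open_ball])
    moreover have "?W \<subseteq> V \<inter> ?f -` ball 0 (m + \<epsilon>)" using den m \<open>\<epsilon> > 0\<close> by (force simp: V_def)
    ultimately obtain d where d: "d > 0" "(\<Union>w\<in>?W. ball w d) \<subseteq> V \<inter> ?f -` ball 0 (m + \<epsilon>)"
      using compact_subset_open_imp_ball_epsilon_subset[OF compact_numerical_range] by metis
    define U where "U = (\<Union>w\<in>?W. ball w d)"
    \<comment> \<open>As a sum of convex sets, one of them an open ball, \<open>U\<close> is convex
      and open.\<close>
    have Usum: "U = (\<Union>x\<in>?W. \<Union>y\<in>ball 0 d. {x + y})"
    proof (intro equalityI subsetI)
      fix x assume "x \<in> U"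
      then obtain w where "w \<in> ?W" "dist w x < d" by (auto simp: U_def)
      then show "x \<in> (\<Union>x\<in>?W. \<Union>y\<in>ball 0 d. {x + y})"
        by (intro UN_I[of w] UN_I[of "x - w"]) (auto simp: dist_norm norm_minus_commute)
    next
      fix x assume "x \<in> (\<Union>x\<in>?W. \<Union>y\<in>ball 0 d. {x + y})"
      then obtain w y where "w \<in> ?W" "norm y < d" "x = w + y" by auto
      then show "x \<in> U" by (auto simp: U_def dist_norm intro!: bexI[of _ w])
    qed
    have U: "open U" "convex U"
      unfolding Usum by (intro open_sums disjI2 open_ball, intro convex_sums convex_numerical_range convex_ball)
    obtain h h1 h2 where hs:
      "\<And>\<theta>. (h has_real_derivative h1 \<theta>) (at \<theta>)" "\<And>\<theta>. (h1 has_real_derivative h2 \<theta>) (at \<theta>)"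
      "continuous_on UNIV h2" "\<And>\<theta>. h (\<theta> + 2 * pi) = h \<theta>" "\<And>\<theta>. 0 < h \<theta> + h2 \<theta>"
      "\<And>z \<theta>. z \<in> ?W \<Longrightarrow> Re (cis (- \<theta>) * z) < h \<theta>"
      "\<And>z. (\<And>\<theta>. Re (cis (- \<theta>) * z) \<le> h \<theta>) \<Longrightarrow> \<exists>w\<in>?W. dist w z < d"
      by (rule smooth_convex_neighbourhood[OF compact_numerical_range numerical_range_nonempty convex_numerical_range d(1)]) blast
    interpret smooth_convex h h1 h2 using hs(1-5) by unfold_locales
    obtain c where cW: "c \<in> ?W" using numerical_range_nonempty by blast
    have WD: "?W \<subseteq> D" using hs(6) by (auto simp: D_def Re_cis_minus_mult simp del: times_complex.sel)
    interpret matrix_in_smooth_convex h h1 h2 T c using WD cW by unfold_locales auto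
    have DU: "Dc \<subseteq> U"
      using hs(7) by (auto simp: Dc_def U_def Re_cis_minus_mult simp del: times_complex.sel)
    have UV: "U \<subseteq> V \<inter> ?f -` ball 0 (m + \<epsilon>)" using d(2) by (simp only: U_def)
    have bU: "poly b z \<noteq> 0" if "z \<in> U" for z using that UV unfolding V_def by blast
    note inv = calc_inverse_poly[OF U DU bU]
    have "calc (\<lambda>z. poly a z * (1 / poly b z) + (- 1) * poly e z)
        (mat_poly a T ** matrix_inv (mat_poly b T) + mat (- 1) ** mat_poly e T)"
      using inv by (intro calc_add calc_mult calc_const calc_poly) auto
    moreover have "norm (poly a z * (1 / poly b z) + (- 1) * poly e z) \<le> m + \<epsilon>" if "z \<in> Dc" for z
    proof -
      have "?f z \<in> ball 0 (m + \<epsilon>)" using that DU UV by blast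
      then show ?thesis by simp
    qed
    ultimately have "spectral_norm (mat_poly a T ** matrix_inv (mat_poly b T) + mat (- 1) ** mat_poly e T)
        \<le> (1 + sqrt 2) * (m + \<epsilon>)"
      by (rule calc_norm_le[OF _ _ pos])
    moreover have "mat (- 1) ** mat_poly e T = - mat_poly e T" by (simp add: vec_eq_iff mat_mult_nth)
    ultimately show ?thesis using inv by simp
  qed
  show "invertible (mat_poly b T)" using main[of 1] by simp
  show "spectral_norm (mat_poly a T ** matrix_inv (mat_poly b T) - mat_poly e T) \<le> (1 + sqrt 2) * m"
  proof (rule field_le_epsilon)
    fix x :: real assume "0 < x"
    have p: "0 < 1 + sqrt 2" by (simp add: add_pos_pos)
    then have "(1 + sqrt 2) * (m + x / (1 + sqrt 2)) = (1 + sqrt 2) * m + x"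
      by (simp add: distrib_left)
    then show "spectral_norm (mat_poly a T ** matrix_inv (mat_poly b T) - mat_poly e T) \<le> (1 + sqrt 2) * m + x"
      using main[of "x / (1 + sqrt 2)"] \<open>0 < x\<close> p by simp
  qed
qed

section \<open>The positive definite square root\<close>

lemma transpose_diff: "transpose (A - B) = transpose A - transpose (B :: 'a::ab_group_add^'n^'m)"
  by (simp add: transpose_def vec_eq_iff)

lemma inner_transpose_vector: "(x :: real^'n) \<bullet> (A *v y) = (transpose A *v x) \<bullet> y"
  by (simp add: dot_lmul_matrix)

text \<open>\<open>l\<close> is the minimum of the quadratic form on the unit sphere.\<close>

lemma sym_pos_def_coercive:
  assumes "sym_pos_def M"
  obtains l where "l > 0" "\<And>x. l * (norm x)\<^sup>2 \<le> x \<bullet> (M *v (x :: real^'n))"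
proof -
  let ?S = "sphere (0 :: real^'n) 1"
  obtain e :: "real^'n" where "norm e = 1" using vector_choose_size[of 1] by auto
  then have "?S \<noteq> {}" by auto
  moreover have "continuous_on ?S (\<lambda>x. x \<bullet> (M *v x))"
    by (intro continuous_intros linear_continuous_on bounded_linear_matrix_vector)
  ultimately obtain x where x: "x \<in> ?S" "\<And>y. y \<in> ?S \<Longrightarrow> x \<bullet> (M *v x) \<le> y \<bullet> (M *v y)"
    using continuous_attains_inf[OF compact_sphere] by blast
  show thesis
  proof (rule that[of "x \<bullet> (M *v x)"])
    show "0 < x \<bullet> (M *v x)" 
    proof -
      have "x \<noteq> 0" using x(1) by auto
      then show ?thesis using assms by (simp add: sym_pos_def_def)
    qed
    fix y :: "real^'n"
    show "x \<bullet> (M *v x) * (norm y)\<^sup>2 \<le> y \<bullet> (M *v y)"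
    proof (cases "y = 0")
      case False
      let ?z = "y /\<^sub>R norm y"
      have "x \<bullet> (M *v x) \<le> ?z \<bullet> (M *v ?z)" using False by (intro x(2)) simp
      also have "\<dots> = (y \<bullet> (M *v y)) / (norm y)\<^sup>2"
        by (simp add: matrix_vector_mult_scaleR power2_eq_square divide_inverse)
      finally show ?thesis using False by (simp add: pos_le_divide_eq)
    qed simp
  qed
qed

section \<open>Frobenius norms of products\<close>

lemma norm_matrix_sum_columns: "(norm A)\<^sup>2 = (\<Sum>j\<in>UNIV. (norm (column j A))\<^sup>2)" for A :: "real^'n^'n"
proof -
  have "(norm A)\<^sup>2 = (\<Sum>i\<in>UNIV. \<Sum>j\<in>UNIV. (A $ i $ j)\<^sup>2)"
    by (simp add: norm_vec_def L2_set_def sum_nonneg)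
  also have "\<dots> = (\<Sum>j\<in>UNIV. \<Sum>i\<in>UNIV. (A $ i $ j)\<^sup>2)" by (rule sum.swap)
  finally show ?thesis by (simp add: norm_vec_def L2_set_def sum_nonneg column_def)
qed

lemma column_matrix_mult: "column j (A ** B) = A *v column j B" for A B :: "real^'n^'n"
  by (simp add: column_def matrix_matrix_mult_def matrix_vector_mult_def vec_eq_iff)

text \<open>The fixed point theorem below works in the metric of the type, the Frobenius norm, while
  the contraction factor is a spectral norm; this lemma and its mirror image mix the two.\<close>

lemma norm_matrix_mult_left: "norm (A ** B) \<le> spectral_norm A * norm B" for A B :: "real^'n^'n"
proof -
  have "(norm (A ** B))\<^sup>2 \<le> (\<Sum>j\<in>UNIV. (spectral_norm A * norm (column j B))\<^sup>2)"
    unfolding norm_matrix_sum_columns column_matrix_mult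
    by (intro sum_mono power_mono norm_matrix_vector) auto
  also have "\<dots> = (spectral_norm A * norm B)\<^sup>2"
    by (simp add: power_mult_distrib sum_distrib_left norm_matrix_sum_columns)
  finally show ?thesis by (rule power2_le_imp_le) (simp add: spectral_norm_nonneg)
qed

lemma norm_transpose: "norm (transpose A) = norm A" for A :: "real^'n^'n"
proof -
  have "(norm (transpose A))\<^sup>2 = (norm A)\<^sup>2"
    unfolding norm_matrix_sum_columns[of "transpose A"]
    by (simp add: column_def transpose_def norm_vec_def[of A] L2_set_def sum_nonneg norm_vec_def)
  then show ?thesis by simp
qed

lemma spectral_norm_transpose_le: "spectral_norm (transpose A) \<le> spectral_norm A" for A :: "real^'n^'n"
proof (rule spectral_norm_le[OF _ spectral_norm_nonneg])
  fix x
  let ?y = "transpose A *v x"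
  have "norm ?y * norm ?y = x \<bullet> (A *v ?y)"
    unfolding inner_transpose_vector[of x A] by (simp only: dot_square_norm power2_eq_square)
  also have "\<dots> \<le> norm x * norm (A *v ?y)" by (rule norm_cauchy_schwarz)
  also have "\<dots> \<le> norm x * (spectral_norm A * norm ?y)"
    by (intro mult_left_mono norm_matrix_vector) auto
  finally have "norm ?y * norm ?y \<le> (spectral_norm A * norm x) * norm ?y" by (simp add: algebra_simps)
  then show "norm ?y \<le> spectral_norm A * norm x"
    by (cases "norm ?y = 0") (simp_all add: spectral_norm_nonneg)
qed

lemma norm_matrix_mult_right: "norm (A ** B) \<le> norm A * spectral_norm B" for A B :: "real^'n^'n"
proof -
  have "norm (A ** B) = norm (transpose B ** transpose A)"
    by (simp only: matrix_transpose_mul[symmetric] norm_transpose)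
  also have "\<dots> \<le> spectral_norm (transpose B) * norm (transpose A)" by (rule norm_matrix_mult_left)
  also have "\<dots> \<le> spectral_norm B * norm A"
    by (intro mult_mono spectral_norm_transpose_le) (simp_all add: norm_transpose spectral_norm_nonneg)
  finally show ?thesis by (simp add: mult.commute)
qed

lemma scaleR_mult_scaleR: "(a *\<^sub>R A) ** (b *\<^sub>R B) = (a * b) *\<^sub>R (A ** B)" for A B :: "real^'n^'n"
  by (simp add: vec_eq_iff matrix_matrix_mult_def sum_distrib_left algebra_simps)

text \<open>\<open>I - Y\<close> is a square root of \<open>I - X\<close> iff \<open>Y\<close> is a fixed point of
  \<open>Y \<mapsto> (X + Y\<^sup>2) / 2\<close>, a contraction on the symmetric matrices of spectral norm at
  most \<open>q < 1\<close> when \<open>X\<close> is one of them.\<close>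

lemma sqrt_near_identity:
  fixes X :: "real^'n^'n"
  assumes X: "transpose X = X" "spectral_norm X \<le> q" and q: "0 \<le> q" "q < 1"
  obtains Y where "transpose Y = Y" "spectral_norm Y \<le> q" "(mat 1 - Y) ** (mat 1 - Y) = mat 1 - X"
proof -
  \<comment> \<open>The spectral bound is stated vector by vector, which exhibits \<open>Z\<close>
    as an intersection of closed sets.\<close>
  define Z where "Z = {Y :: real^'n^'n. transpose Y = Y \<and> (\<forall>x. norm (Y *v x) \<le> q * norm x)}"
  define \<Phi> where "\<Phi> Y = (1 / 2) *\<^sub>R (X + Y ** Y)" for Y :: "real^'n^'n"
  have sn: "spectral_norm Y \<le> q" if "Y \<in> Z" for Y
    using that q by (intro spectral_norm_le) (auto simp: Z_def)
  have scale: "spectral_norm ((1 / 2) *\<^sub>R A) \<le> spectral_norm A / 2" for A :: "real^'n^'n"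
  proof (rule spectral_norm_le)
    fix x
    have "((1 / 2) *\<^sub>R A) *v x = (1 / 2) *\<^sub>R (A *v x)"
      by (simp add: vec_eq_iff matrix_vector_mult_def sum_divide_distrib)
    then show "norm (((1 / 2) *\<^sub>R A) *v x) \<le> spectral_norm A / 2 * norm x"
      using norm_matrix_vector[of A x] by simp
  qed (simp add: spectral_norm_nonneg)
  have "complete Z"
  proof -
    have vec: "continuous_on UNIV (\<lambda>Y :: real^'n^'n. Y *v x)" for x
      unfolding matrix_vector_mult_def by (intro continuous_intros)
    have "Z = {Y. transpose Y = Y} \<inter> (\<Inter>x. {Y. norm (Y *v x) \<le> q * norm x})"
      by (auto simp: Z_def)
    moreover have "closed {Y :: real^'n^'n. transpose Y = Y}"
      unfolding transpose_def by (intro closed_Collect_eq continuous_intros)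
    moreover have "closed {Y :: real^'n^'n. norm (Y *v x) \<le> q * norm x}" for x
      by (intro closed_Collect_le continuous_on_norm vec continuous_on_const)
    ultimately show ?thesis by (simp add: complete_eq_closed closed_Int closed_INT)
  qed
  moreover have "Z \<noteq> {}"
  proof -
    have "0 \<in> Z" using q by (simp add: Z_def transpose_def vec_eq_iff)
    then show ?thesis by blast
  qed
  moreover have "\<Phi> ` Z \<subseteq> Z"
  proof
    fix V assume "V \<in> \<Phi> ` Z"
    then obtain Y where Y: "Y \<in> Z" "V = \<Phi> Y" by blast
    have "transpose V = V"
    proof -
      have "transpose (Y ** Y) = Y ** Y" using Y(1) by (simp add: matrix_transpose_mul Z_def)
      then show ?thesis using X(1) by (simp add: Y(2) \<Phi>_def transpose_def vec_eq_iff)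
    qed
    moreover have "spectral_norm V \<le> q"
    proof -
      have "spectral_norm V \<le> (spectral_norm X + spectral_norm (Y ** Y)) / 2"
        unfolding Y(2) \<Phi>_def using order_trans[OF scale divide_right_mono[OF spectral_norm_add]] by simp
      also have "\<dots> \<le> (q + q * q) / 2"
        using X(2) sn[OF Y(1)] q
        by (intro divide_right_mono add_mono order_trans[OF spectral_norm_mult] mult_mono)
           (auto simp: spectral_norm_nonneg)
      also have "\<dots> \<le> q" using q mult_right_le_one_le[of q q] by simp
      finally show ?thesis .
    qed
    then have "norm (V *v x) \<le> q * norm x" for x
      using norm_matrix_vector[of V x] mult_right_mono[of "spectral_norm V" q "norm x"] by simp
    ultimately show "V \<in> Z" by (simp add: Z_def)
  qed
  moreover have "dist (\<Phi> Y) (\<Phi> V) \<le> q * dist Y V" if "Y \<in> Z" "V \<in> Z" for Y V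
  proof -
    \<comment> \<open>This splitting of \<open>Y^2 - V^2\<close> works without
      commutativity.\<close>
    have "\<Phi> Y - \<Phi> V = (1 / 2) *\<^sub>R (Y ** (Y - V) + (Y - V) ** V)"
      by (simp add: \<Phi>_def matrix_ring scaleR_diff_right scaleR_add_right)
    then have "dist (\<Phi> Y) (\<Phi> V) \<le> (norm (Y ** (Y - V)) + norm ((Y - V) ** V)) / 2"
      using norm_triangle_ineq[of "Y ** (Y - V)" "(Y - V) ** V"] by (simp add: dist_norm)
    also have "\<dots> \<le> (q * norm (Y - V) + norm (Y - V) * q) / 2"
    proof (intro divide_right_mono add_mono)
      show "norm (Y ** (Y - V)) \<le> q * norm (Y - V)"
        using norm_matrix_mult_left[of Y "Y - V"] mult_right_mono[OF sn[OF that(1)], of "norm (Y - V)"] by simp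
      show "norm ((Y - V) ** V) \<le> norm (Y - V) * q"
        using norm_matrix_mult_right[of "Y - V" V] mult_left_mono[OF sn[OF that(2)], of "norm (Y - V)"] by simp
    qed simp
    finally show ?thesis by (simp add: dist_norm)
  qed
  ultimately have "\<exists>!Y. Y \<in> Z \<and> \<Phi> Y = Y"
    using q by (intro Banach_fix) auto
  then obtain Y where Y: "Y \<in> Z" "\<Phi> Y = Y" by blast
  have "X + Y ** Y = 2 *\<^sub>R Y" 
  proof -
    have "2 *\<^sub>R \<Phi> Y = X + Y ** Y" by (simp add: \<Phi>_def)
    then show ?thesis by (simp only: Y(2))
  qed
  then have "(mat 1 - Y) ** (mat 1 - Y) = mat 1 - X" by (simp add: matrix_ring scaleR_2 algebra_simps)
  then show thesis using Y(1) sn[OF Y(1)] by (intro that[of Y]) (auto simp: Z_def)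
qed

text \<open>A small multiple \<open>e\<close> of \<open>M\<close> is close enough to the identity
  for \<open>sqrt_near_identity\<close>; rescaling its root by \<open>1 / sqrt e\<close> gives the
  root of \<open>M\<close>. Positivity holds because \<open>Y\<close> has spectral norm below
  1.\<close>

lemma sym_pos_def_sqrt_exists:
  assumes "sym_pos_def (M :: real^'n^'n)"
  obtains S where "sym_pos_def S" "S ** S = M"
proof -
  obtain l where l: "l > 0" "\<And>x. l * (norm x)\<^sup>2 \<le> x \<bullet> (M *v x)"
    using sym_pos_def_coercive[OF assms] by blast
  \<comment> \<open>The summand \<open>l\<close> ensures both \<open>0 < L\<close> and
    \<open>l <= L\<close>.\<close>
  define L where "L = spectral_norm M + l"
  have L: "L > 0" using l(1) by (simp add: L_def add_nonneg_pos spectral_norm_nonneg)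
  \<comment> \<open>This value minimises \<open>1 - 2 * e * l + e^2 * L^2\<close>, the bound for the
    squared norm of \<open>X\<close>, and makes it \<open>1 - e * l\<close>.\<close>
  define e where "e = l / L\<^sup>2"
  have e: "e > 0" using l L by (simp add: e_def)
  define X where "X = mat 1 - e *\<^sub>R M"
  define q where "q = sqrt (1 - e * l)"
  have el: "0 \<le> 1 - e * l"
  proof -
    have "l\<^sup>2 \<le> L\<^sup>2" using l(1) by (intro power_mono) (auto simp: L_def spectral_norm_nonneg)
    then show ?thesis using L by (simp add: e_def power2_eq_square divide_le_eq)
  qed
  have q: "0 \<le> q" "q < 1" using el e l(1) by (simp_all add: q_def)
  have "spectral_norm X \<le> q"
  proof (rule spectral_norm_le[OF _ q(1)])
    fix x :: "real^'n"
    have Xx: "X *v x = x - e *\<^sub>R (M *v x)"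
      by (simp add: X_def matrix_vector_mult_diff_rdistrib scaleR_matrix_vector_assoc)
    have "norm (M *v x) \<le> L * norm x"
      using norm_matrix_vector[of M x] l(1) by (simp add: L_def distrib_right add_increasing2)
    then have MM: "(norm (M *v x))\<^sup>2 \<le> L\<^sup>2 * (norm x)\<^sup>2"
      using power_mono[of "norm (M *v x)" "L * norm x" 2] by (simp add: power_mult_distrib)
    have "(norm (X *v x))\<^sup>2 = (norm x)\<^sup>2 - 2 * e * (x \<bullet> (M *v x)) + e\<^sup>2 * (norm (M *v x))\<^sup>2"
      unfolding Xx power2_norm_eq_inner
      by (simp add: inner_diff_left inner_diff_right inner_commute[of "M *v x" x] power2_eq_square algebra_simps)
    also have "\<dots> \<le> (norm x)\<^sup>2 - 2 * e * (l * (norm x)\<^sup>2) + e\<^sup>2 * (L\<^sup>2 * (norm x)\<^sup>2)"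
      using l(2)[of x] e MM by (intro add_mono diff_mono mult_left_mono) auto
    also have "e\<^sup>2 * (L\<^sup>2 * (norm x)\<^sup>2) = e * l * (norm x)\<^sup>2"
      using L by (simp add: e_def power2_eq_square)
    finally have "(norm (X *v x))\<^sup>2 \<le> (1 - e * l) * (norm x)\<^sup>2" by (simp add: algebra_simps)
    then have "(norm (X *v x))\<^sup>2 \<le> (q * norm x)\<^sup>2" using el by (simp add: q_def power_mult_distrib)
    then show "norm (X *v x) \<le> q * norm x" by (rule power2_le_imp_le) (simp add: q)
  qed
  moreover have "transpose X = X"
    using assms by (simp add: X_def sym_pos_def_def transpose_def vec_eq_iff mat_def)
  ultimately obtain Y where Y: "transpose Y = Y" "spectral_norm Y \<le> q" "(mat 1 - Y) ** (mat 1 - Y) = mat 1 - X"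
    using sqrt_near_identity q by metis
  define S where "S = (1 / sqrt e) *\<^sub>R (mat 1 - Y)"
  have "S ** S = (1 / e) *\<^sub>R ((mat 1 - Y) ** (mat 1 - Y))"
    using e by (simp add: S_def scaleR_mult_scaleR)
  also have "\<dots> = M" using e by (simp add: Y(3) X_def)
  finally have "S ** S = M" .
  moreover have "sym_pos_def S"
    unfolding sym_pos_def_def
  proof (intro conjI allI impI)
    show "transpose S = S" using Y(1) by (simp add: S_def transpose_def vec_eq_iff mat_def)
    fix x :: "real^'n" assume x: "x \<noteq> 0"
    have "x \<bullet> (Y *v x) \<le> norm x * norm (Y *v x)" by (rule norm_cauchy_schwarz)
    also have "\<dots> \<le> norm x * (q * norm x)"
      using norm_matrix_vector[of Y x] mult_right_mono[OF Y(2), of "norm x"] by (intro mult_left_mono) auto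
    also have "\<dots> < x \<bullet> x" using q x by (simp add: power2_norm_eq_inner[symmetric] power2_eq_square)
    finally have "0 < x \<bullet> x - x \<bullet> (Y *v x)" by simp
    moreover have "S *v x = (1 / sqrt e) *\<^sub>R (x - Y *v x)"
      by (simp add: S_def matrix_vector_mult_diff_rdistrib scaleR_matrix_vector_assoc[symmetric])
    ultimately show "0 < x \<bullet> (S *v x)" using e by (simp add: inner_diff_right)
  qed
  ultimately show thesis using that by blast
qed

text \<open>For two roots \<open>S\<close>, \<open>R\<close> of the same matrix the symmetric matrix \<open>E = S - R\<close> satisfies
  \<open>S E + E R = 0\<close>; multiplying by \<open>E\<close> and taking traces shows \<open>E = 0\<close>.\<close>

lemma sym_pos_def_sqrt_unique:
  fixes S R :: "real^'n^'n"
  assumes S: "sym_pos_def S" and R: "sym_pos_def R" and eq: "S ** S = R ** R"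
  shows "S = R"
proof -
  define E where "E = S - R"
  have E: "transpose E = E" using S R by (simp add: E_def sym_pos_def_def transpose_diff)
  have "S ** E + E ** R = 0" by (simp add: E_def matrix_ring eq)
  then have "trace (E ** (S ** E)) + trace (E ** (E ** R)) = 0"
  proof -
    have "E ** (S ** E) + E ** (E ** R) = E ** (S ** E + E ** R)" by (simp only: matrix_add_ldistrib)
    also have "\<dots> = 0" using \<open>S ** E + E ** R = 0\<close> by simp
    finally have "trace (E ** (S ** E) + E ** (E ** R)) = 0" by (simp add: trace_def)
    then show ?thesis by (simp only: trace_add)
  qed
  moreover have tr: "trace (E ** (Q ** E)) = (\<Sum>j\<in>UNIV. column j E \<bullet> (Q *v column j E))" for Q :: "real^'n^'n"
  proof -
    have Eij: "E $ i $ j = E $ j $ i" for i j using E by (metis transpose_def vec_lambda_beta)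
    show ?thesis
      by (simp add: trace_def matrix_matrix_mult_def matrix_vector_mult_def column_def inner_vec_def Eij)
  qed
  moreover have "trace (E ** (E ** R)) = trace (E ** (R ** E))"
    using trace_mul_sym[of "E ** R" E] trace_mul_sym[of E "E ** R"] by (simp only: matrix_mul_assoc)
  ultimately have sum: "(\<Sum>j\<in>UNIV. column j E \<bullet> (S *v column j E)) + (\<Sum>j\<in>UNIV. column j E \<bullet> (R *v column j E)) = 0"
    by simp
  have nonneg: "0 \<le> x \<bullet> (Q *v x)" if "sym_pos_def Q" for Q and x :: "real^'n"
    using that by (cases "x = 0") (auto simp: sym_pos_def_def less_imp_le)
  have "(\<Sum>j\<in>UNIV. column j E \<bullet> (S *v column j E)) = 0"
    using sum sum_nonneg[of UNIV "\<lambda>j. column j E \<bullet> (S *v column j E)"]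
      sum_nonneg[of UNIV "\<lambda>j. column j E \<bullet> (R *v column j E)"] nonneg[OF S] nonneg[OF R] by simp
  then have "column j E \<bullet> (S *v column j E) = 0" for j
    using sum_nonneg_eq_0_iff[of UNIV "\<lambda>j. column j E \<bullet> (S *v column j E)"] nonneg[OF S] by simp
  then have "column j E = 0" for j using S unfolding sym_pos_def_def by (metis less_irrefl)
  then have "E = 0" by (simp add: vec_eq_iff column_def)
  then show ?thesis by (simp add: E_def)
qed

lemma spd_sqrt_props:
  assumes "sym_pos_def M"
  shows "sym_pos_def (spd_sqrt M)" "spd_sqrt M ** spd_sqrt M = M"
proof -
  have "\<exists>!S. sym_pos_def S \<and> S ** S = M"
    using sym_pos_def_sqrt_exists[OF assms] sym_pos_def_sqrt_unique by metis
  from theI'[OF this] show "sym_pos_def (spd_sqrt M)" "spd_sqrt M ** spd_sqrt M = M"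
    by (simp_all add: spd_sqrt_def)
qed

text \<open>Applied to the root of \<open>M\<close> and to its inverse, this produces the square
  root of the condition number.\<close>

lemma spectral_norm_symmetric_le_sqrt:
  fixes S :: "real^'n^'n"
  assumes "transpose S = S"
  shows "spectral_norm S \<le> sqrt (spectral_norm (S ** S))"
proof (rule spectral_norm_le)
  fix x :: "real^'n"
  have "(norm (S *v x))\<^sup>2 = x \<bullet> ((S ** S) *v x)"
    using inner_transpose_vector[of x S "S *v x"] by (simp add: assms power2_norm_eq_inner matrix_vector_mul_assoc)
  also have "\<dots> \<le> norm x * norm ((S ** S) *v x)" by (rule norm_cauchy_schwarz)
  also have "\<dots> \<le> norm x * (spectral_norm (S ** S) * norm x)"
    by (intro mult_left_mono norm_matrix_vector) auto
  finally have "(norm (S *v x))\<^sup>2 \<le> (sqrt (spectral_norm (S ** S)) * norm x)\<^sup>2"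
    by (simp add: power_mult_distrib spectral_norm_nonneg power2_eq_square algebra_simps)
  then show "norm (S *v x) \<le> sqrt (spectral_norm (S ** S)) * norm x"
    by (rule power2_le_imp_le) (simp add: spectral_norm_nonneg)
qed (simp add: spectral_norm_nonneg)

text \<open>A real matrix acts separately on real and imaginary parts, whose squared norms add
  up.\<close>

lemma spectral_norm_cmat_le: "spectral_norm (cmat S) \<le> spectral_norm S" for S :: "real^'n^'n"
proof (rule spectral_norm_le[OF _ spectral_norm_nonneg])
  fix z :: "complex^'n"
  define x y where "x = (\<chi> i. Re (z $ i))" and "y = (\<chi> i. Im (z $ i))"
  have split: "(norm w)\<^sup>2 = (norm (\<chi> i. Re (w $ i)))\<^sup>2 + (norm (\<chi> i. Im (w $ i)))\<^sup>2" for w :: "complex^'n"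
    by (simp add: norm_vec_def L2_set_def sum_nonneg cmod_power2 sum.distrib)
  have "(\<chi> i. Re ((cmat S *v z) $ i)) = S *v x" "(\<chi> i. Im ((cmat S *v z) $ i)) = S *v y"
    by (simp_all add: x_def y_def vec_eq_iff matrix_vector_mult_def map_matrix_def Re_sum Im_sum)
  then have "(norm (cmat S *v z))\<^sup>2 = (norm (S *v x))\<^sup>2 + (norm (S *v y))\<^sup>2"
    by (simp add: split[of "cmat S *v z"])
  also have "\<dots> \<le> (spectral_norm S * norm x)\<^sup>2 + (spectral_norm S * norm y)\<^sup>2"
    by (intro add_mono power_mono norm_matrix_vector) auto
  also have "\<dots> = (spectral_norm S * norm z)\<^sup>2"
    by (simp add: split[of z] x_def y_def power_mult_distrib distrib_left)
  finally show "norm (cmat S *v z) \<le> spectral_norm S * norm z"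
    by (rule power2_le_imp_le) (simp add: spectral_norm_nonneg)
qed

lemma cmat_mult: "cmat (A ** B) = cmat A ** cmat B" for A B :: "real^'n^'n"
  by (simp add: vec_eq_iff map_matrix_def matrix_matrix_mult_def)

lemma cmat_mat: "cmat (mat 1) = mat 1"
  by (simp add: vec_eq_iff map_matrix_def mat_def)

section \<open>Matrix exponential and similarity\<close>

lemma mat_poly_monom: "mat_poly (monom a k) A = mat a ** mat_power A k"
proof (induction k)
  case 0
  show ?case by (simp add: monom_0 mat_poly_pCons mat_poly_0 mat_power_simps)
next
  case (Suc k)
  then show ?case by (simp add: monom_Suc mat_poly_pCons mat_zero mat_power_simps mat_mult_mult)
qed

definition exp_poly :: "nat \<Rightarrow> complex poly" where
  "exp_poly n = (\<Sum>k<n. monom (1 / fact k) k)"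

lemma poly_exp_poly: "poly (exp_poly n) z = (\<Sum>k<n. z ^ k /\<^sub>R fact k)"
  by (simp add: exp_poly_def poly_sum poly_monom scaleR_conv_of_real divide_inverse)

lemma mat_poly_exp_poly: "mat_poly (exp_poly n) A = (\<Sum>k<n. (1 / fact k) *\<^sub>R mat_power A k)"
proof (induction n)
  case 0
  show ?case by (simp add: exp_poly_def mat_poly_0)
next
  case (Suc n)
  have "mat (1 / fact n) ** mat_power A n = (1 / fact n) *\<^sub>R mat_power A n"
    by (simp add: scaleR_eq_mat)
  then show ?case
    using Suc by (simp add: exp_poly_def mat_poly_add mat_poly_monom)
qed

lemma summable_mat_exp:
  fixes A :: "complex^'n^'n"
  shows "summable (\<lambda>k. (1 / fact k) *\<^sub>R mat_power A k)"
proof -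
  obtain K where K: "0 < K" "\<forall>(X :: complex^'n^'n) (Y :: complex^'n^'n). norm (X ** Y) \<le> norm X * norm Y * K"
    using bounded_bilinear.pos_bounded[OF bounded_bilinear_matrix_mult] by (elim exE conjE)
  have le: "norm (mat_power A k) \<le> norm (mat 1 :: complex^'n^'n) * (norm A * K) ^ k" for k
  proof (induction k)
    case (Suc k)
    have "norm (mat_power A (Suc k)) \<le> norm A * norm (mat_power A k) * K"
      unfolding mat_power_simps using K(2) by simp
    also have "\<dots> \<le> norm A * (norm (mat 1 :: complex^'n^'n) * (norm A * K) ^ k) * K"
      using K(1) by (intro mult_right_mono mult_left_mono Suc.IH) auto
    finally show ?case by (simp add: algebra_simps)
  qed (simp add: mat_power_simps)
  have "summable (\<lambda>k. norm (mat 1 :: complex^'n^'n) * (inverse (fact k) * (norm A * K) ^ k))"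
    by (intro summable_mult summable_exp)
  then show ?thesis
  proof (rule summable_comparison_test'[of _ 0])
    show "norm ((1 / fact k) *\<^sub>R mat_power A k) \<le> norm (mat 1 :: complex^'n^'n) * (inverse (fact k) * (norm A * K) ^ k)" for k
      using mult_left_mono[OF le[of k], of "inverse (fact k)"] by (simp add: divide_inverse algebra_simps)
  qed
qed

lemma mat_exp_tendsto: "(\<lambda>n. mat_poly (exp_poly n) A) \<longlonglongrightarrow> mat_exp A"
  unfolding mat_poly_exp_poly mat_exp_def by (rule summable_LIMSEQ[OF summable_mat_exp])

lemma uniform_limit_exp_poly:
  assumes "bounded W"
  shows "uniform_limit W (\<lambda>n z. poly (exp_poly n) z) exp sequentially"
proof -
  obtain R where R: "\<And>z. z \<in> W \<Longrightarrow> norm z \<le> R" using assms by (auto simp: bounded_iff)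
  have "uniform_limit W (\<lambda>n z. \<Sum>k<n. z ^ k /\<^sub>R fact k) (\<lambda>z. \<Sum>k. z ^ k /\<^sub>R fact k) sequentially"
  proof (rule Weierstrass_m_test)
    show "norm (z ^ k /\<^sub>R fact k) \<le> inverse (fact k) * R ^ k" if "z \<in> W" for k z
      using power_mono[OF R[OF that] norm_ge_zero, of k] by (simp add: norm_power mult_left_mono)
    show "summable (\<lambda>k. inverse (fact k) * R ^ k)" by (rule summable_exp)
  qed
  then show ?thesis by (simp add: poly_exp_poly exp_def[abs_def])
qed

section \<open>Invariance of the matrix functions under similarity\<close>

context
  fixes P Q B :: "complex^'n^'n"
  assumes PQ: "Q ** P = mat 1"
begin

lemma mat_poly_similar: "mat_poly p (P ** B ** Q) = P ** mat_poly p B ** Q"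
proof (induction p)
  case 0
  show ?case by (simp add: mat_poly_0)
next
  case (pCons a p)
  have "P ** B ** Q ** (P ** mat_poly p B ** Q) = P ** B ** (Q ** P) ** mat_poly p B ** Q"
    by (simp only: matrix_mul_assoc)
  moreover have "P ** mat a ** Q = mat a"
    using inverse_of_left(2)[OF PQ] by (simp add: mat_commute[of P] flip: matrix_mul_assoc)
  ultimately show ?case
    by (simp add: mat_poly_pCons pCons.IH PQ matrix_add_ldistrib matrix_mult_add_left matrix_mul_assoc)
qed

lemma matrix_inv_similar:
  assumes "invertible X"
  shows "matrix_inv (P ** X ** Q) = P ** matrix_inv X ** Q"
proof (rule inverse_of_left(1))
  have "P ** matrix_inv X ** Q ** (P ** X ** Q) = P ** (matrix_inv X ** (Q ** P) ** X) ** Q"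
    by (simp only: matrix_mul_assoc)
  then show "P ** matrix_inv X ** Q ** (P ** X ** Q) = mat 1"
    using inverse_of_left(2)[OF PQ] by (simp add: PQ matrix_inv_props[OF assms])
qed

lemma mat_exp_similar: "mat_exp (P ** B ** Q) = P ** mat_exp B ** Q"
proof (rule LIMSEQ_unique[OF mat_exp_tendsto])
  show "(\<lambda>n. mat_poly (exp_poly n) (P ** B ** Q)) \<longlonglongrightarrow> P ** mat_exp B ** Q"
    unfolding mat_poly_similar
    by (intro bounded_bilinear.tendsto[OF bounded_bilinear_matrix_mult] tendsto_const mat_exp_tendsto)
qed

lemma rat_eval_mat_similar:
  assumes "invertible (mat_poly (rat_den r) B)"
  shows "rat_eval_mat r (P ** B ** Q) = P ** rat_eval_mat r B ** Q"
proof -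
  have "P ** X ** Q ** (P ** Y ** Q) = P ** (X ** (Q ** P) ** Y) ** Q" for X Y
    by (simp only: matrix_mul_assoc)
  then show ?thesis
    by (simp add: rat_eval_mat_def mat_poly_similar matrix_inv_similar[OF assms] PQ)
qed

end

text \<open>On the bounded numerical range the Taylor polynomials converge uniformly to the
  exponential. So \<open>m + \<epsilon>\<close> eventually bounds the rational function minus the
  polynomial, and the estimate passes to the limit in the matrices.\<close>

lemma rat_minus_exp_norm_le:
  fixes B :: "complex^'n^'n"
  assumes "rat_bounded_on r (numerical_range B)"
  shows "invertible (mat_poly (rat_den r) B)"
    and "spectral_norm (rat_eval_mat r B - mat_exp B)
      \<le> (1 + sqrt 2) * (SUP z\<in>numerical_range B. norm (rat_eval r z - exp z))"
proof -
  let ?W = "numerical_range B"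
  define m where "m = (SUP z\<in>?W. norm (rat_eval r z - exp z))"
  have den: "\<And>z. z \<in> ?W \<Longrightarrow> poly (rat_den r) z \<noteq> 0" using assms by (simp add: rat_bounded_on_def)
  have "continuous_on ?W (\<lambda>z. norm (rat_eval r z - exp z))"
    unfolding rat_eval_def by (intro continuous_intros) (use den in auto)
  \<comment> \<open>Without an upper bound the real supremum would be unspecified; it exists because
    the function is continuous on a compact set.\<close>
  then have "bdd_above ((\<lambda>z. norm (rat_eval r z - exp z)) ` ?W)"
    by (intro bounded_imp_bdd_above compact_imp_bounded compact_continuous_image compact_numerical_range)
  then have m: "norm (rat_eval r z - exp z) \<le> m" if "z \<in> ?W" for z
    unfolding m_def using that by (intro cSUP_upper)
  have main: "invertible (mat_poly (rat_den r) B) \<and> spectral_norm (rat_eval_mat r B - mat_exp B) \<le> (1 + sqrt 2) * (m + \<epsilon>)"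
    if "\<epsilon> > 0" for \<epsilon>
  proof -
    have "eventually (\<lambda>n. \<forall>z\<in>?W. dist (poly (exp_poly n) z) (exp z) < \<epsilon>) sequentially"
      using uniform_limit_exp_poly[OF compact_imp_bounded[OF compact_numerical_range]] that
      by (rule uniform_limitD)
    then have ev: "eventually (\<lambda>n. invertible (mat_poly (rat_den r) B) \<and>
        spectral_norm (rat_eval_mat r B - mat_poly (exp_poly n) B) \<le> (1 + sqrt 2) * (m + \<epsilon>)) sequentially"
    proof eventually_elim
      fix n assume n: "\<forall>z\<in>?W. dist (poly (exp_poly n) z) (exp z) < \<epsilon>"
      have le: "norm (poly (rat_num r) z / poly (rat_den r) z - poly (exp_poly n) z) \<le> m + \<epsilon>" if "z \<in> ?W" for z
        using m[OF that] n that norm_triangle_ineq[of "rat_eval r z - exp z" "exp z - poly (exp_poly n) z"]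
        by (fastforce simp: rat_eval_def dist_norm norm_minus_commute)
      show "invertible (mat_poly (rat_den r) B) \<and>
        spectral_norm (rat_eval_mat r B - mat_poly (exp_poly n) B) \<le> (1 + sqrt 2) * (m + \<epsilon>)"
        unfolding rat_eval_mat_def using crouzeix_palencia_rational[where T = B, OF den le] by simp
    qed
    have "(\<lambda>n. spectral_norm (rat_eval_mat r B - mat_poly (exp_poly n) B)) \<longlonglongrightarrow> spectral_norm (rat_eval_mat r B - mat_exp B)"
      by (intro tendsto_spectral_norm tendsto_diff tendsto_const mat_exp_tendsto)
    then have "spectral_norm (rat_eval_mat r B - mat_exp B) \<le> (1 + sqrt 2) * (m + \<epsilon>)"
      by (rule tendsto_upperbound) (use ev in \<open>auto elim: eventually_mono\<close>)
    moreover obtain n where "invertible (mat_poly (rat_den r) B)"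
      using eventually_happens'[OF sequentially_bot ev] by blast
    ultimately show ?thesis by simp
  qed
  show "invertible (mat_poly (rat_den r) B)" using main[of 1] by simp
  show "spectral_norm (rat_eval_mat r B - mat_exp B) \<le> (1 + sqrt 2) * (SUP z\<in>?W. norm (rat_eval r z - exp z))"
    unfolding m_def[symmetric]
  proof (rule field_le_epsilon)
    fix x :: real assume "0 < x"
    have p: "0 < 1 + sqrt 2" by (simp add: add_pos_pos)
    then have "(1 + sqrt 2) * (m + x / (1 + sqrt 2)) = (1 + sqrt 2) * m + x" by (simp add: distrib_left)
    then show "spectral_norm (rat_eval_mat r B - mat_exp B) \<le> (1 + sqrt 2) * m + x"
      using main[of "x / (1 + sqrt 2)"] \<open>0 < x\<close> p by simp
  qed
qed

theorem theorem1:
  fixes \<tau> :: real and M K A Ahat :: "real^'n^'n" and r :: "complex poly fract"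
  assumes "\<tau> > 0"
    and "sym_pos_def M"
    and "A = \<tau> *\<^sub>R (matrix_inv M ** K)"
    and "Ahat = spd_sqrt M ** A ** matrix_inv (spd_sqrt M)"
    and "rat_bounded_on r (numerical_range (cmat Ahat))"
  shows "spectral_norm (rat_eval_mat r (cmat A) - mat_exp (cmat A))
    \<le> (1 + sqrt 2) * sqrt (cond_number M)
      * (SUP z\<in>numerical_range (cmat Ahat). norm (rat_eval r z - exp z))"
proof -
  define S where "S = spd_sqrt M"
  define R where "R = matrix_inv S"
  have S: "sym_pos_def S" "S ** S = M" using spd_sqrt_props[OF assms(2)] by (simp_all add: S_def)
  have "invertible S"
  proof (rule invertible_if_inj)
    fix x assume "S *v x = 0"
    then show "x = 0" using S(1) by (metis inner_zero_right less_irrefl sym_pos_def_def)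
  qed
  then have RS: "R ** S = mat 1" "S ** R = mat 1" by (simp_all add: R_def matrix_inv_props)
  have "R ** R ** M = R ** (R ** S) ** S" by (simp only: S(2)[symmetric] matrix_mul_assoc)
  then have M: "matrix_inv M = R ** R" by (intro inverse_of_left(1)) (simp add: RS)
  \<comment> \<open>Being symmetric, \<open>R\<close> is a root of \<open>matrix_inv M\<close> to
    which \<open>spectral_norm_symmetric_le_sqrt\<close> applies just as to
    \<open>S\<close>.\<close>
  have R: "transpose R = R"
  proof -
    have "transpose R ** S = mat 1"
      using arg_cong[OF RS(2), of transpose] S(1)
      by (simp add: matrix_transpose_mul transpose_mat sym_pos_def_def)
    then show ?thesis using inverse_of_left(1)[of "transpose R" S] by (simp add: R_def)
  qed
  let ?P = "cmat R" and ?Q = "cmat S" and ?B = "cmat Ahat"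
  have QP: "?Q ** ?P = mat 1" by (simp only: cmat_mult[symmetric] RS cmat_mat)
  have "R ** Ahat ** S = (R ** S) ** A ** (R ** S)"
    by (simp only: assms(4) S_def[symmetric] R_def[symmetric] matrix_mul_assoc)
  then have A: "cmat A = ?P ** ?B ** ?Q" by (simp add: RS flip: cmat_mult)
  let ?E = "rat_eval_mat r ?B - mat_exp ?B"
  let ?m = "SUP z\<in>numerical_range ?B. norm (rat_eval r z - exp z)"
  note B = rat_minus_exp_norm_le[OF assms(5)]
  have nP: "spectral_norm ?P \<le> sqrt (spectral_norm (matrix_inv M))"
    using spectral_norm_cmat_le[of R] spectral_norm_symmetric_le_sqrt[OF R] by (simp add: M)
  have nQ: "spectral_norm ?Q \<le> sqrt (spectral_norm M)"
    using spectral_norm_cmat_le[of S] spectral_norm_symmetric_le_sqrt[of S] S by (simp add: sym_pos_def_def)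
  have "rat_eval_mat r (cmat A) - mat_exp (cmat A) = ?P ** ?E ** ?Q"
    by (simp add: A rat_eval_mat_similar[OF QP B(1)] mat_exp_similar[OF QP] matrix_ring)
  then have "spectral_norm (rat_eval_mat r (cmat A) - mat_exp (cmat A)) \<le> spectral_norm (?P ** ?E) * spectral_norm ?Q"
    by (simp only: spectral_norm_mult)
  also have "\<dots> \<le> (sqrt (spectral_norm (matrix_inv M)) * ((1 + sqrt 2) * ?m)) * sqrt (spectral_norm M)"
  proof (rule mult_mono[OF _ nQ])
    show le: "spectral_norm (?P ** ?E) \<le> sqrt (spectral_norm (matrix_inv M)) * ((1 + sqrt 2) * ?m)"
      by (rule order_trans[OF spectral_norm_mult mult_mono[OF nP B(2)]]) (simp_all add: spectral_norm_nonneg)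
    \<comment> \<open>The sign is read off from the bound just shown, whose left-hand side is a
      norm.\<close>
    show "0 \<le> sqrt (spectral_norm (matrix_inv M)) * ((1 + sqrt 2) * ?m)"
      using le spectral_norm_nonneg order_trans by blast
  qed (rule spectral_norm_nonneg)
  also have "\<dots> = (1 + sqrt 2) * sqrt (cond_number M) * ?m"
    by (simp add: cond_number_def real_sqrt_mult)
  finally show ?thesis .
qed

end
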